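(* Let $K$ be an algebraically closed field of characteristic zero. Let $E_{f,q}=(V,\nabla)$ and $E_{g,q'}=(W,\nabla')$ be irreducible $K(\!(x)\!)$-connections, where $f\in K(\!(x^{1/q})\!)$ and $g\in K(\!(x^{1/q'})\!)$ have classes in $R_q^{o}(x)\setminus\{0\}$ and $R_{q'}^{o}(x)\setminus\{0\}$ respectively, and write $\operatorname{ord}(f)=-p/q$, $\operatorname{ord}(g)=-p'/q'$. If $E_{f,q}\not\cong E_{g,q'}$, then $$I\left(C_{f,q},C_{g,q'}\right)=pq'+p'q-\mathrm{Irr}\left(\mathrm{Hom}_{K(\!(x)\!)}(V,W)\right),$$ where $\mathrm{Hom}_{K(\!(x)\!)}(V,W)$ carries the connection $\nabla''$ given by $\nabla''(\phi)(v)=\nabla'(\phi(v))-\phi(\nabla(v))$ for $\phi\in\mathrm{Hom}_{K(\!(x)\!)}(V,W)$, $v\in V$. Similarly, $$I\left(C_{f,q},\frac{\partial}{\partial y}C_{f,q}\right)=2p(q-1)-\mathrm{Irr}\left(\mathrm{End}_{K(\!(x)\!)}(V)\right).$$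
   Context: Connections: a $K(\!(x)\!)$-connection $(V,\nabla)$ is a finite dimensional $K(\!(x)\!)$-vector space $V$ with a $K$-linear map $\nabla:V\to V$ satisfying $\nabla(hv)=h\nabla(v)+\frac{dh}{dx}v$ for $h\in K(\!(x)\!)$, $v\in V$. Morphisms are $K(\!(x)\!)$-linear maps commuting with the connections; $(V,\nabla)$ is irreducible if it has no proper nonzero $\nabla$-stable $K(\!(x)\!)$-subspace. $\mathrm{End}_{K(\!(x)\!)}(V)=\mathrm{Hom}_{K(\!(x)\!)}(V,V)$ with the connection $\nabla''$ for $\nabla'=\nabla$. For $q\in\mathbb{Z}_{>0}$ and $f\in K(\!(x^{1/q})\!)$, $E_{f,q}=(V,\nabla)$ is the connection with $V=K(\!(x^{1/q})\!)$ regarded as a $K(\!(x)\!)$-vector space and $\nabla(v)=(\frac{d}{dx}+x^{-1}f)v$. The order $\operatorname{ord}(f)\in\frac1q\mathbb{Z}$ is the lowest exponent of $x$ occurring in $f$ with nonzero coefficient. Put $R_q(x)=K(\!(x^{1/q})\!)/\left(x^{1/q}K[\![x^{1/q}]\!]+\frac1q\mathbb{Z}\right)$, and let $R_q^{o}(x)$ be the set of elements of $R_q(x)$ that cannot be represented by elements of $K(\!(x^{1/r})\!)$ for any $0<r<q$. It is known that $E_{f,q}$ is irreducible if and only if the class of $f$ lies in $R_q^{o}(x)$. Associated curve: for $f$ with class in $R_q^{o}(x)\setminus\{0\}$, $C_{f,q}(x,y)=\prod_{i=1}^{q}\left(y-\frac{1}{f_i(x^{1/q})}\right)\in K[\![x,y]\!]$,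 where $f_i(x^{1/q})=f(\zeta_q^i x^{1/q})$ and $\zeta_q$ is a primitive $q$-th root of unity. Intersection number: $I(F,G)=\dim_K K[\![x,y]\!]/\langle F,G\rangle$. Irregularity: every connection decomposes as $\bigoplus_i (E_{f_i,q_i}\otimes J_{m_i})$ with $f_i$ having class in $R_{q_i}^{o}(x)$ and $J_m=(K(\!(x)\!)^{\oplus m},\frac{d}{dx}+x^{-1}N_m)$, $N_m$ the nilpotent Jordan block of size $m$ (Hukuhara–Turrittin–Levelt). Then $\mathrm{Irr}=\sum_i m_i q_i\max(0,-\operatorname{ord}(f_i))$ (with $\operatorname{ord}(0)=+\infty$); this is independent of the decomposition. *)

theory Defs
  imports
    "HOL-Library.Function_Algebras"
    "HOL-Library.Extended_Nat"
    "HOL-Computational_Algebra.Computational_Algebra"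
    "HOL-Algebra.Algebraic_Closure_Type"
    "HOL-Algebra.Embedded_Algebras"
    "HOL-Algebra.QuotRing"
begin

section \<open>Connections over \<open>K((x))\<close>\<close>

text \<open>
  The ambient type \<open>'v\<close> is a vector space over \<open>K((x))\<close> as a whole, and the space underlying the
  connection is a subspace of it. This is what makes \<open>Hom(V,W)\<close> (a proper subset of a
  function type) a connection of the same kind as \<open>V\<close> and \<open>W\<close>.
\<close>

record (overloaded) ('k, 'v) conn =
  conn_space :: "'v set"
  conn_scale :: "'k fls \<Rightarrow> 'v \<Rightarrow> 'v"
  conn_nabla :: "'v \<Rightarrow> 'v"

definition conn_subspace :: "('k::field, 'v::ab_group_add) conn \<Rightarrow> 'v set \<Rightarrow> bool" where
  "conn_subspace C U \<longleftrightarrow> Modules.module.subspace (conn_scale C) U \<and> U \<subseteq> conn_space C"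

definition nabla_stable :: "('k, 'v) conn \<Rightarrow> 'v set \<Rightarrow> bool" where
  "nabla_stable C U \<longleftrightarrow> (\<forall>u\<in>U. conn_nabla C u \<in> U)"

definition connection :: "('k::field, 'v::ab_group_add) conn \<Rightarrow> bool" where
  "connection C \<longleftrightarrow>
     vector_space (conn_scale C) \<and>
     (\<exists>B. finite B \<and> conn_space C = Modules.module.span (conn_scale C) B) \<and>
     nabla_stable C (conn_space C) \<and>
     (\<forall>v\<in>conn_space C. \<forall>w\<in>conn_space C.
        conn_nabla C (v + w) = conn_nabla C v + conn_nabla C w) \<and>
     (\<forall>c. \<forall>v\<in>conn_space C.
        conn_nabla C (conn_scale C (fls_const c) v) = conn_scale C (fls_const c) (conn_nabla C v)) \<and>
     (\<forall>h. \<forall>v\<in>conn_space C.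
        conn_nabla C (conn_scale C h v)
          = conn_scale C h (conn_nabla C v) + conn_scale C (fls_deriv h) v)"

definition irreducible_connection :: "('k::field, 'v::ab_group_add) conn \<Rightarrow> bool" where
  "irreducible_connection C \<longleftrightarrow>
     connection C \<and>
     (\<forall>U. conn_subspace C U \<and> nabla_stable C U \<longrightarrow> U = {0} \<or> U = conn_space C)"

definition conn_linear ::
    "('k, 'v::ab_group_add) conn \<Rightarrow> ('k, 'w::ab_group_add) conn \<Rightarrow> ('v \<Rightarrow> 'w) \<Rightarrow> bool" where
  "conn_linear C D \<phi> \<longleftrightarrow>
     (\<forall>v\<in>conn_space C. \<phi> v \<in> conn_space D) \<and>
     (\<forall>v\<in>conn_space C. \<forall>w\<in>conn_space C. \<phi> (v + w) = \<phi> v + \<phi> w) \<and>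
     (\<forall>h. \<forall>v\<in>conn_space C. \<phi> (conn_scale C h v) = conn_scale D h (\<phi> v))"

definition conn_morphism ::
    "('k, 'v::ab_group_add) conn \<Rightarrow> ('k, 'w::ab_group_add) conn \<Rightarrow> ('v \<Rightarrow> 'w) \<Rightarrow> bool" where
  "conn_morphism C D \<phi> \<longleftrightarrow>
     conn_linear C D \<phi> \<and> (\<forall>v\<in>conn_space C. \<phi> (conn_nabla C v) = conn_nabla D (\<phi> v))"

definition conn_isomorphic ::
    "('k, 'v::ab_group_add) conn \<Rightarrow> ('k, 'w::ab_group_add) conn \<Rightarrow> bool" where
  "conn_isomorphic C D \<longleftrightarrow>
     (\<exists>\<phi>. conn_morphism C D \<phi> \<and> bij_betw \<phi> (conn_space C) (conn_space D))"

text \<open>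
  A linear map \<open>V \<rightarrow> W\<close> is represented by the function that is extended by \<open>0\<close> outside of \<open>V\<close>.
\<close>

definition Hom_conn ::
    "('k, 'v::ab_group_add) conn \<Rightarrow> ('k, 'w::ab_group_add) conn \<Rightarrow> ('k, 'v \<Rightarrow> 'w) conn" where
  "Hom_conn C D =
     \<lparr> conn_space = {\<phi>. conn_linear C D \<phi> \<and> (\<forall>v. v \<notin> conn_space C \<longrightarrow> \<phi> v = 0)},
       conn_scale = (\<lambda>h \<phi> v. conn_scale D h (\<phi> v)),
       conn_nabla = (\<lambda>\<phi> v. if v \<in> conn_space C
                            then conn_nabla D (\<phi> v) - \<phi> (conn_nabla C v) else 0) \<rparr>"

definition End_conn :: "('k, 'v::ab_group_add) conn \<Rightarrow> ('k, 'v \<Rightarrow> 'v) conn" where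
  "End_conn C = Hom_conn C C"


section \<open>The connections \<open>E\<^bsub>f,q\<^esub>\<close>\<close>

text \<open>
  An element of \<open>K((x\<^bsup>1/q\<^esup>))\<close> is a formal Laurent series in the variable \<open>t = x\<^bsup>1/q\<^esup>\<close>; then
  \<open>h \<in> K((x))\<close> acts as multiplication by \<open>h(t\<^sup>q)\<close>, and \<open>d/dx = (1/q) t\<^bsup>1-q\<^esup> d/dt\<close>.
\<close>

definition puiseux_deriv :: "nat \<Rightarrow> 'k::field fls \<Rightarrow> 'k fls" where
  "puiseux_deriv q v = fls_const (1 / of_nat q) * fls_X_intpow (1 - int q) * fls_deriv v"

definition E_conn :: "'k::field fls \<Rightarrow> nat \<Rightarrow> ('k, 'k fls) conn" where
  "E_conn f q =
     \<lparr> conn_space = UNIV,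
       conn_scale = (\<lambda>h v. fls_compose_power h q * v),
       conn_nabla = (\<lambda>v. puiseux_deriv q v + fls_compose_power fls_X_inv q * f * v) \<rparr>"

text \<open>Only meaningful for \<open>f \<noteq> 0\<close>.\<close>

definition puiseux_ord :: "nat \<Rightarrow> 'k::zero fls \<Rightarrow> rat" where
  "puiseux_ord q f = of_int (fls_subdegree f) / of_nat q"

definition R_rel :: "nat \<Rightarrow> ('k::field fls \<times> 'k fls) set" where
  "R_rel q = {(f, g). \<exists>u n. f - g = fls_X * fps_to_fls u + fls_const (of_int n / of_nat q)}"

definition R_class :: "nat \<Rightarrow> 'k::field fls \<Rightarrow> 'k fls set" where
  "R_class q f = R_rel q `` {f}"

text \<open>\<open>K((x\<^bsup>1/q\<^esup>)) \<inter> K((x\<^bsup>1/r\<^esup>))\<close>, as a subset of \<open>K((x\<^bsup>1/q\<^esup>))\<close>.\<close>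

definition puiseux_sub :: "nat \<Rightarrow> nat \<Rightarrow> 'k::zero fls set" where
  "puiseux_sub q r =
     {h. \<forall>n. fls_nth h n \<noteq> 0 \<longrightarrow> (\<exists>k::int. rat_of_int n / of_nat q = of_int k / of_nat r)}"

definition R_o :: "nat \<Rightarrow> 'k::field fls set set" where
  "R_o q = {c \<in> UNIV // R_rel q. \<forall>r. 0 < r \<and> r < q \<longrightarrow> c \<inter> puiseux_sub q r = {}}"


section \<open>Irregularity\<close>

text \<open>
  The tensor product of a connection \<open>V\<close> with \<open>(K((x))\<^sup>m, d/dx + A)\<close>, on the space
  \<open>V \<otimes> K((x))\<^sup>m = V\<^sup>m\<close>: the family \<open>w\<close> stands for \<open>\<Sum>k<m. w k \<otimes> e\<^sub>k\<close>.
\<close>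

definition tensor_conn ::
    "('k, 'v::ab_group_add) conn \<Rightarrow> nat \<Rightarrow> (nat \<Rightarrow> nat \<Rightarrow> 'k fls) \<Rightarrow> ('k, nat \<Rightarrow> 'v) conn" where
  "tensor_conn C m A =
     \<lparr> conn_space = {w. (\<forall>k<m. w k \<in> conn_space C) \<and> (\<forall>k\<ge>m. w k = 0)},
       conn_scale = (\<lambda>h w k. conn_scale C h (w k)),
       conn_nabla = (\<lambda>w k. if k < m
          then conn_nabla C (w k) + (\<Sum>l<m. conn_scale C (A k l) (w l)) else 0) \<rparr>"

definition jordan_nilp :: "nat \<Rightarrow> nat \<Rightarrow> 'k::field fls" where
  "jordan_nilp k l = (if l = Suc k then 1 else 0)"

definition tensor_J ::
    "('k::field, 'v::ab_group_add) conn \<Rightarrow> nat \<Rightarrow> ('k, nat \<Rightarrow> 'v) conn" where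
  "tensor_J C m = tensor_conn C m (\<lambda>k l. fls_X_inv * jordan_nilp k l)"

definition conn_direct_sum ::
    "('k::field, 'v::ab_group_add) conn \<Rightarrow> nat \<Rightarrow> (nat \<Rightarrow> 'v set) \<Rightarrow> bool" where
  "conn_direct_sum C n U \<longleftrightarrow>
     (\<forall>i<n. conn_subspace C (U i) \<and> nabla_stable C (U i)) \<and>
     (\<forall>v\<in>conn_space C. \<exists>!u. (\<forall>i<n. u i \<in> U i) \<and> (\<forall>i\<ge>n. u i = 0) \<and> v = (\<Sum>i<n. u i))"

definition HTL_decomposition ::
    "('k::field, 'v::ab_group_add) conn \<Rightarrow> nat \<Rightarrow>
       (nat \<Rightarrow> 'k fls) \<Rightarrow> (nat \<Rightarrow> nat) \<Rightarrow> (nat \<Rightarrow> nat) \<Rightarrow> bool" where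
  "HTL_decomposition C n f q m \<longleftrightarrow>
     (\<forall>i<n. 0 < q i \<and> 0 < m i \<and> R_class (q i) (f i) \<in> R_o (q i)) \<and>
     (\<exists>U. conn_direct_sum C n U \<and>
        (\<forall>i<n. conn_isomorphic (C\<lparr>conn_space := U i\<rparr>) (tensor_J (E_conn (f i) (q i)) (m i))))"

text \<open>
  A summand with \<open>f i = 0\<close>, whose order is \<open>+\<infinity>\<close>, contributes \<open>0\<close>; this agrees with the
  formula below because \<open>fls_subdegree 0 = 0\<close>.
\<close>

definition irregularity :: "('k::field, 'v::ab_group_add) conn \<Rightarrow> rat" where
  "irregularity C =
     (THE r. \<exists>n f q m. HTL_decomposition C n f q m \<and>
        r = (\<Sum>i<n. of_nat (m i) * of_nat (q i) * max 0 (- puiseux_ord (q i) (f i))))"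


section \<open>Associated curves and intersection numbers\<close>

text \<open>
  \<open>K[[x,y]]\<close> is represented as \<open>K[[x]][[y]]\<close>, that is by the type \<open>'k fps fps\<close> with outer
  variable \<open>y\<close>; in particular \<open>fps_deriv\<close> is \<open>\<partial>/\<partial>y\<close>.
\<close>

definition primitive_root_of_unity :: "nat \<Rightarrow> 'k::field \<Rightarrow> bool" where
  "primitive_root_of_unity q z \<longleftrightarrow> z ^ q = 1 \<and> (\<forall>k. 0 < k \<and> k < q \<longrightarrow> z ^ k \<noteq> 1)"

definition conjugate :: "'k::field \<Rightarrow> 'k fls \<Rightarrow> nat \<Rightarrow> 'k fls" where
  "conjugate z f i = fls_compose_fps f (fps_const (z ^ i) * fps_X)"

definition curve_product :: "'k::field \<Rightarrow> 'k fls \<Rightarrow> nat \<Rightarrow> 'k fls poly" where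
  "curve_product z f q = (\<Prod>i=1..q. [: - (1 / conjugate z f i), 1 :])"

text \<open>
  The product is formed in \<open>K((t))[y]\<close>, where \<open>t = x\<^bsup>1/q\<^esup>\<close>; the curve is the power series in
  \<open>x\<close> and \<open>y\<close> that becomes this product when \<open>x = t\<^sup>q\<close>.
\<close>

definition curve :: "'k::field \<Rightarrow> 'k fls \<Rightarrow> nat \<Rightarrow> 'k fps fps" where
  "curve z f q =
     (THE C. \<forall>j. fls_compose_power (fps_to_fls (fps_nth C j)) q
                  = Polynomial.coeff (curve_product z f q) j)"

definition intersection_quotient :: "'k::field fps fps \<Rightarrow> 'k fps fps \<Rightarrow> 'k fps fps set ring" where
  "intersection_quotient F G =
     ring_of_type_algebra Quot (Idl\<^bsub>ring_of_type_algebra\<^esub> {F, G})"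

definition quotient_scalars :: "'k::field fps fps \<Rightarrow> 'k fps fps \<Rightarrow> 'k fps fps set set" where
  "quotient_scalars F G =
     range (\<lambda>c. (Idl\<^bsub>ring_of_type_algebra\<^esub> {F, G})
                  +>\<^bsub>ring_of_type_algebra\<^esub> fps_const (fps_const c))"

definition has_intersection_number :: "'k::field fps fps \<Rightarrow> 'k fps fps \<Rightarrow> nat \<Rightarrow> bool" where
  "has_intersection_number F G n \<longleftrightarrow>
     ring.dimension (intersection_quotient F G) n
       (quotient_scalars F G) (carrier (intersection_quotient F G))"

definition intersection_number :: "'k::field fps fps \<Rightarrow> 'k fps fps \<Rightarrow> enat" where
  "intersection_number F G =
     (if \<exists>n. has_intersection_number F G n
      then enat (THE n. has_intersection_number F G n) else \<infinity>)"

end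

theory Submission
  imports Defs
begin

text \<open>
  Irregularity: applying \<open>x\<nabla>\<close> repeatedly to a \<open>K[[x]]\<close>-lattice enlarges it, up to a bounded error, by the
  irregularity in each step, so all decompositions give the same value. Write \<open>N = lcm(q, q')\<close>, \<open>d = gcd(q, q')\<close>.
  Then \<open>Hom(E\<^bsub>f,q\<^esub>, E\<^bsub>g,q'\<^esub>)\<close> is the sum of the \<open>E\<^bsub>g\<^sub>j - f, N\<^esub>\<close> over \<open>j < d\<close>, hence its irregularity is
  \<open>\<Sum>\<^bsub>j<d\<^esub> - N ord(g\<^sub>j - f)\<close>, because \<open>ord(g\<^sub>j - f) \<le> 0\<close> unless the connections are isomorphic.

  Intersection number: if \<open>f\<close> has no pole, then \<open>q = 1\<close> and \<open>C\<^bsub>f,q\<^esub>\<close> is a unit. Otherwise \<open>t \<mapsto> (t\<^sup>q, 1/f)\<close> parametrizes \<open>C\<^bsub>f,q\<^esub>\<close> and identifies \<open>K[[x,y]]/\<langle>C\<^bsub>f,q\<^esub>\<rangle>\<close> with a subring of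
  finite codimension in \<open>K[[t]]\<close>; the intersection number with \<open>G\<close> is therefore the \<open>t\<close>-order of \<open>G(t\<^sup>q, 1/f)\<close>.
  For \<open>G = C\<^bsub>g,q'\<^esub>\<close> this is the order of \<open>\<Prod>\<^sub>i (1/f - 1/g\<^sub>i)\<close>, and
  \<open>ord(1/f - 1/g\<^sub>i) = ord(g\<^sub>i - f) - ord f - ord g\<close>.
\<close>

text \<open>\<open>irregularity\<close> is a definite description over all HTL decompositions, so
  its value is known only after one decomposition with classes in \<open>R_o\<close> is exhibited
  and any two are compared. The summands of Hom found from the conjugates of g need not be
  irreducible; each is split once more, at no cost, since s pieces of pole order p/s replace one of
  pole order p. Both sides of the formula count the same differences of conjugates, but not equally
  often: the intersection number runs over all q' conjugates of g, the irregularity over only d of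
  them. In the common root u = x^(1/N) there is a Galois automorphism fixing f that shifts the index
  of the conjugates of g by d, so each order occurs M = q'/d times; as x^(1/q) = u^M has u-order M,
  this factor cancels. Non-isomorphism keeps every difference at order at most 0, so the maximum in
  the irregularity truncates nothing. For the derivative, the factor of the branch itself is
  missing, and correspondingly one summand of End is E_{0,q}, of irregularity 0.\<close>

unbundle fps_syntax

section \<open>Laurent series\<close>

lemma fls_times_nth_finite:
  fixes f g :: "'a::semiring_0 fls"
  assumes "finite S" "\<And>i. i \<notin> S \<Longrightarrow> f $$ i = 0 \<or> g $$ (n - i) = 0"
  shows "(f * g) $$ n = (\<Sum>i\<in>S. f $$ i * g $$ (n - i))"
proof -
  let ?T = "{fls_subdegree f..n - fls_subdegree g}"
  have "(f * g) $$ n = (\<Sum>i\<in>?T. f $$ i * g $$ (n - i))"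
    by (rule fls_times_nth(2))
  also have "\<dots> = (\<Sum>i\<in>S. f $$ i * g $$ (n - i))"
  proof (rule sum.mono_neutral_cong)
    show "f $$ i * g $$ (n - i) = 0" if "i \<in> S - ?T" for i
      using that by (cases "i < fls_subdegree f") auto
    show "f $$ i * g $$ (n - i) = 0" if "i \<in> ?T - S" for i
      using that assms(2)[of i] by auto
  qed (use assms in auto)
  finally show ?thesis .
qed

text \<open>Membership in t^a K[[t]]. A bound on \<open>fls_subdegree\<close> would not do, because
  \<open>fls_subdegree 0 = 0\<close> although 0 has infinite order.\<close>

definition fls_vanishes_below :: "int \<Rightarrow> 'a::zero fls \<Rightarrow> bool" where
  "fls_vanishes_below a v \<longleftrightarrow> (\<forall>n<a. v $$ n = 0)"

lemma fls_vanishes_below_iff: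
  "fls_vanishes_below a v \<longleftrightarrow> v = 0 \<or> a \<le> fls_subdegree v"
proof
  assume "fls_vanishes_below a v"
  then show "v = 0 \<or> a \<le> fls_subdegree v"
    unfolding fls_vanishes_below_def using fls_subdegree_geI by blast
qed (auto simp: fls_vanishes_below_def)

lemma fls_vanishes_below_zero [simp]: "fls_vanishes_below a 0"
  by (simp add: fls_vanishes_below_def)

lemma fls_vanishes_below_mono: "fls_vanishes_below a v \<Longrightarrow> b \<le> a \<Longrightarrow> fls_vanishes_below b v"
  by (auto simp: fls_vanishes_below_def)

lemma fls_vanishes_below_add:
  "fls_vanishes_below a v \<Longrightarrow> fls_vanishes_below a w \<Longrightarrow>
    fls_vanishes_below a (v + w :: 'a::monoid_add fls)"
  by (auto simp: fls_vanishes_below_def)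

lemma fls_vanishes_below_diff:
  "fls_vanishes_below a v \<Longrightarrow> fls_vanishes_below a w \<Longrightarrow>
    fls_vanishes_below a (v - w :: 'a::group_add fls)"
  by (auto simp: fls_vanishes_below_def)

lemma fls_vanishes_below_sum:
  "(\<And>i. i \<in> S \<Longrightarrow> fls_vanishes_below a (v i)) \<Longrightarrow>
    fls_vanishes_below a (\<Sum>i\<in>S. v i :: 'a::comm_monoid_add fls)"
  by (auto simp: fls_vanishes_below_def fls_nth_sum)

lemma fls_vanishes_below_mult:
  fixes v w :: "'a::idom fls"
  assumes "fls_vanishes_below a v" "fls_vanishes_below b w"
  shows "fls_vanishes_below (a + b) (v * w)"
  using assms by (cases "v = 0 \<or> w = 0") (auto simp: fls_vanishes_below_iff)

lemma fls_vanishes_below_nonneg: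
  assumes "fls_vanishes_below 0 v" shows "\<exists>u. v = fps_to_fls u"
  using assms fls_regpart_to_fls_trivial[of v] unfolding fls_vanishes_below_iff
  by (metis fls_zero_subdegree order_refl)

text \<open>The Euler operator t d/dt is diagonal on monomials; unlike d/dt it preserves the
  filtration by order and commutes with rescaling of t.\<close>

definition fls_theta :: "'a::ring_1 fls \<Rightarrow> 'a fls" where
  "fls_theta v = fls_X * fls_deriv v"

lemma fls_theta_nth [simp]: "fls_theta v $$ n = of_int n * v $$ n"
  by (simp add: fls_theta_def fls_X_times_conv_shift)

lemma fls_theta_add: "fls_theta (v + w) = fls_theta v + fls_theta w"
  by (intro fls_eqI) (simp add: distrib_left)

lemma fls_theta_zero [simp]: "fls_theta 0 = 0"
  by (intro fls_eqI) simp

lemma fls_theta_mult: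
  "fls_theta (v * w :: 'a::comm_ring_1 fls) = fls_theta v * w + v * fls_theta w"
  by (simp add: fls_theta_def algebra_simps)

lemma fls_theta_vanishes_below: "fls_vanishes_below a v \<Longrightarrow> fls_vanishes_below a (fls_theta v)"
  by (auto simp: fls_vanishes_below_def)

lemma fls_theta_X_intpow: "fls_theta (fls_X_intpow n) = of_int n * fls_X_intpow n"
proof (intro fls_eqI)
  fix m
  show "fls_theta (fls_X_intpow n) $$ m = (of_int n * fls_X_intpow n :: 'a fls) $$ m"
    unfolding fls_of_int fls_mult_const_nth by simp
qed

section \<open>The substitution t -> t^d\<close>

lemma fls_theta_compose_power:
  assumes "0 < d"
  shows "fls_theta (fls_compose_power v d) = of_nat d * fls_compose_power (fls_theta v) d"
proof (intro fls_eqI)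
  fix n
  show "fls_theta (fls_compose_power v d) $$ n = (of_nat d * fls_compose_power (fls_theta v) d) $$ n"
    using assms by (auto simp: fls_nth_compose_power fls_of_nat mult.assoc elim!: dvdE)
qed

lemma fls_compose_power_compose_power:
  assumes "0 < a" "0 < b"
  shows "fls_compose_power (fls_compose_power f a) b = fls_compose_power f (a * b)"
  using assms
  by (intro fls_eqI) (auto simp: fls_nth_compose_power zdiv_zmult2_eq mult.commute elim!: dvdE
      dest: dvd_mult_left)

lemma fls_compose_power_eq_iff:
  assumes "0 < d"
  shows "fls_compose_power f d = fls_compose_power g d \<longleftrightarrow> f = g"
proof
  assume eq: "fls_compose_power f d = fls_compose_power g d"
  show "f = g"
  proof (intro fls_eqI)
    fix n show "f $$ n = g $$ n"
      using arg_cong[OF eq, of "\<lambda>h. h $$ (int d * n)"] assms by (simp add: fls_nth_compose_power)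
  qed
qed simp

lemma fls_compose_power_eq_0_iff:
  "0 < d \<Longrightarrow> fls_compose_power f d = 0 \<longleftrightarrow> f = 0"
  using fls_compose_power_eq_iff[of d f 0] by simp

lemma fls_compose_power_sum:
  "fls_compose_power (\<Sum>i\<in>S. f i) d = (\<Sum>i\<in>S. fls_compose_power (f i) d)"
  by (induction S rule: infinite_finite_induct) auto

lemma fls_compose_power_1_right [simp]: "fls_compose_power f (Suc 0) = f"
  by (intro fls_eqI) (simp add: fls_nth_compose_power)

lemma fls_compose_power_inverse:
  fixes f :: "'a::field fls"
  shows "fls_compose_power (inverse f) d = inverse (fls_compose_power f d)"
proof (cases "d = 0 \<or> f = 0")
  case False
  then have "fls_compose_power (inverse f) d * fls_compose_power f d = fls_compose_power 1 d"
    by (simp flip: fls_compose_power_mult)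
  with False show ?thesis
    by (simp add: fls_compose_power_eq_0_iff field_simps)
qed auto

lemma fls_compose_power_vanishes_below:
  assumes "0 < d"
  shows "fls_vanishes_below (int d * a) (fls_compose_power f d) \<longleftrightarrow> fls_vanishes_below a f"
proof
  assume *: "fls_vanishes_below (int d * a) (fls_compose_power f d)"
  show "fls_vanishes_below a f"
    unfolding fls_vanishes_below_def
  proof (intro allI impI)
    fix n assume "n < a"
    then have "fls_compose_power f d $$ (int d * n) = 0"
      using * assms by (simp add: fls_vanishes_below_def)
    then show "f $$ n = 0" using assms by (simp add: fls_nth_compose_power)
  qed
next
  assume *: "fls_vanishes_below a f"
  show "fls_vanishes_below (int d * a) (fls_compose_power f d)"
    unfolding fls_vanishes_below_def
  proof (intro allI impI)
    fix n assume "n < int d * a"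
    then show "fls_compose_power f d $$ n = 0"
      using * assms by (auto simp: fls_vanishes_below_def fls_nth_compose_power elim!: dvdE)
  qed
qed

lemma fls_subdegree_compose_power:
  assumes "0 < d"
  shows "fls_subdegree (fls_compose_power f d) = int d * fls_subdegree f"
proof (cases "f = 0")
  case False
  then show ?thesis
  proof (intro fls_subdegree_eqI)
    show "fls_compose_power f d $$ (int d * fls_subdegree f) \<noteq> 0"
      using False assms by (simp add: fls_nth_compose_power)
    show "fls_compose_power f d $$ k = 0" if "k < int d * fls_subdegree f" for k
      using that fls_compose_power_vanishes_below[OF assms, of "fls_subdegree f" f]
      by (auto simp: fls_vanishes_below_def)
  qed
qed simp

text \<open>In characteristic zero this is 1/d times the trace from K((t)) to K((t^d)), written in
  the variable t^d.\<close>

definition fls_section :: "nat \<Rightarrow> 'a::zero fls \<Rightarrow> 'a fls" where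
  "fls_section d b = Abs_fls (\<lambda>n. b $$ (n * int d))"

lemma fls_section_nth [simp]:
  assumes "0 < d" shows "fls_section d b $$ n = b $$ (n * int d)"
proof -
  have "b $$ (n * int d) = 0" if "n < - \<bar>fls_subdegree b\<bar>" for n
  proof (rule fls_eq0_below_subdegree)
    have "\<bar>fls_subdegree b\<bar> * 1 < (- n) * int d"
      by (rule mult_less_le_imp_less) (use assms that in auto)
    then show "n * int d < fls_subdegree b" by (simp add: algebra_simps)
  qed
  then show ?thesis unfolding fls_section_def
    by (subst nth_Abs_fls_lower_bound[of "- \<bar>fls_subdegree b\<bar>"]) auto
qed

lemma fls_section_add: "0 < d \<Longrightarrow> fls_section d (a + b) = fls_section d a + fls_section d b"
  by (intro fls_eqI) simp

lemma fls_section_sum: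
  "0 < d \<Longrightarrow> fls_section d (\<Sum>i\<in>S. f i) = (\<Sum>i\<in>S. fls_section d (f i))"
  by (intro fls_eqI) (simp add: fls_nth_sum)

lemma fls_section_theta:
  fixes b :: "'a::comm_ring_1 fls"
  assumes "0 < d"
  shows "fls_section d (fls_theta b) = of_nat d * fls_theta (fls_section d b)"
  using assms by (intro fls_eqI) (simp add: fls_of_nat algebra_simps)

lemma fls_section_mult:
  fixes g b :: "'a::idom fls"
  assumes "0 < d"
  shows "fls_section d (fls_compose_power g d * b) = g * fls_section d b"
proof (intro fls_eqI)
  fix n
  \<comment> \<open>For i above this range, (n - i) d is smaller than -|ord b| and hence than ord b,
    whatever the sign of ord b.\<close>
  let ?S = "{fls_subdegree g..n + \<bar>fls_subdegree b\<bar>}"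
  have *: "b $$ ((n - i) * int d) = 0" if "i > n + \<bar>fls_subdegree b\<bar>" for i
  proof (rule fls_eq0_below_subdegree)
    have "\<bar>fls_subdegree b\<bar> * 1 < (i - n) * int d"
      by (rule mult_less_le_imp_less) (use assms that in auto)
    then show "(n - i) * int d < fls_subdegree b" by (simp add: algebra_simps)
  qed
  have "fls_section d (fls_compose_power g d * b) $$ n
      = (\<Sum>i\<in>(\<lambda>i. i * int d) ` ?S. fls_compose_power g d $$ i * b $$ (n * int d - i))"
    unfolding fls_section_nth[OF assms]
  proof (rule fls_times_nth_finite)
    fix i assume i: "i \<notin> (\<lambda>i. i * int d) ` ?S"
    show "fls_compose_power g d $$ i = 0 \<or> b $$ (n * int d - i) = 0"
    proof (cases "int d dvd i")
      case True
      then obtain k where k: "i = k * int d" by (metis dvdE mult.commute)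
      with i have "k \<notin> ?S" by blast
      then show ?thesis
        using *[of k] assms by (auto simp: k fls_nth_compose_power left_diff_distrib)
    qed (use assms in \<open>simp add: fls_nth_compose_power\<close>)
  qed simp
  also have "\<dots> = (\<Sum>i\<in>?S. fls_compose_power g d $$ (i * int d) * b $$ (n * int d - i * int d))"
    by (subst sum.reindex) (use assms in \<open>auto simp: inj_on_def\<close>)
  also have "\<dots> = (\<Sum>i\<in>?S. g $$ i * fls_section d b $$ (n - i))"
    using assms by (simp add: fls_nth_compose_power left_diff_distrib)
  also have "\<dots> = (g * fls_section d b) $$ n"
    by (rule fls_times_nth_finite[symmetric]) (use * assms in \<open>auto simp: not_le\<close>)
  finally show "fls_section d (fls_compose_power g d * b) $$ n = (g * fls_section d b) $$ n" .
qed

lemma fls_compose_power_section: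
  assumes "0 < d" "\<And>n. f $$ n \<noteq> 0 \<Longrightarrow> int d dvd n"
  shows "fls_compose_power (fls_section d f) d = f"
  using assms by (intro fls_eqI) (auto simp: fls_nth_compose_power)

lemma fls_section_X_intpow:
  "0 < d \<Longrightarrow> fls_section d (fls_X_intpow e) = (if int d dvd e then fls_X_intpow (e div int d) else 0)"
  by (intro fls_eqI) (auto, metis dvd_triv_right)

lemma fls_split_sections:
  \<comment> \<open>Instance of a basis expansion: the powers t^k, k < d, form a basis of K((t))
    over K((t^d)), and at the exponent n only the residue k = n mod d contributes.\<close>
  fixes v :: "'a::idom fls"
  assumes "0 < d"
  shows "v = (\<Sum>k<d. fls_X_intpow (int k) * fls_compose_power (fls_section d (fls_shift (int k) v)) d)"
    (is "v = ?R")
proof (rule fls_eqI)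
  fix n
  have "?R $$ n = (\<Sum>k<d. if k = nat (n mod int d) then v $$ n else 0)"
    unfolding fls_nth_sum
  proof (rule sum.cong[OF refl])
    fix k assume k: "k \<in> {..<d}"
    have "int d dvd n - int k \<longleftrightarrow> k = nat (n mod int d)"
    proof -
      have "int d dvd n - int k \<longleftrightarrow> n mod int d = int k mod int d"
        by (simp add: mod_eq_dvd_iff)
      also have "\<dots> \<longleftrightarrow> n mod int d = int k" using k by simp
      also have "\<dots> \<longleftrightarrow> k = nat (n mod int d)" using assms by auto
      finally show ?thesis .
    qed
    then show "(fls_X_intpow (int k) * fls_compose_power (fls_section d (fls_shift (int k) v)) d) $$ n
        = (if k = nat (n mod int d) then v $$ n else 0)"
      using assms by (simp add: fls_X_intpow_times_conv_shift fls_nth_compose_power)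
  qed
  also have "\<dots> = v $$ n"
  proof -
    have "nat (n mod int d) < d" using assms by (simp add: nat_less_iff)
    then show ?thesis by (simp add: sum.delta)
  qed
  finally show "v $$ n = ?R $$ n" by simp
qed

text \<open>The coordinates of an integral series in that basis are integral, since n < 0 and k < d
  give n d + k < 0.\<close>

lemma fls_section_shift_vanishes_below:
  assumes "k < d" "fls_vanishes_below 0 v"
  shows "fls_vanishes_below 0 (fls_section d (fls_shift (int k) v))"
  unfolding fls_vanishes_below_def
proof (intro allI impI)
  fix n :: int assume "n < 0"
  then have "(n + 1) * int d \<le> 0" by (simp add: mult_le_0_iff)
  then have "n * int d + int k < 0" using assms(1) by (simp add: algebra_simps)
  then show "fls_section d (fls_shift (int k) v) $$ n = 0"
    using assms by (simp add: fls_vanishes_below_def)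
qed

text \<open>For c^q = 1 the substitution t -> c t fixes K((t^q)); these maps produce the conjugates
  of a Puiseux series.\<close>

definition fls_rescale :: "'a::field \<Rightarrow> 'a fls \<Rightarrow> 'a fls" where
  "fls_rescale c f = fls_compose_fps f (fps_const c * fps_X)"

lemma conjugate_eq_rescale: "conjugate z f i = fls_rescale (z ^ i) f"
  by (simp add: conjugate_def fls_rescale_def)

lemma fls_rescale_nth: "c \<noteq> 0 \<Longrightarrow> fls_rescale c f $$ n = f $$ n * c powi n"
  by (simp add: fls_rescale_def fls_nth_fls_compose_fps_linear)

lemma
  assumes "c \<noteq> 0"
  shows fls_rescale_add: "fls_rescale c (f + g) = fls_rescale c f + fls_rescale c g"
    and fls_rescale_diff: "fls_rescale c (f - g) = fls_rescale c f - fls_rescale c g"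
    and fls_rescale_mult: "fls_rescale c (f * g) = fls_rescale c f * fls_rescale c g"
    and fls_rescale_divide: "fls_rescale c (f / g) = fls_rescale c f / fls_rescale c g"
    and fls_rescale_eq_0_iff: "fls_rescale c f = 0 \<longleftrightarrow> f = 0"
    and fls_rescale_subdegree: "fls_subdegree (fls_rescale c f) = fls_subdegree f"
  unfolding fls_rescale_def
  using assms
  by (auto simp: fls_compose_fps_add fls_compose_fps_diff fls_compose_fps_mult
      fls_compose_fps_divide fls_compose_fps_eq_0_iff subdegree_mult)

lemma fls_rescale_0_right [simp]: "fls_rescale c 0 = 0"
  and fls_rescale_1_right [simp]: "fls_rescale c 1 = 1"
  and fls_rescale_const [simp]: "fls_rescale c (fls_const a) = fls_const a"
  by (simp_all add: fls_rescale_def)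

lemma fls_rescale_1 [simp]: "fls_rescale 1 f = f"
  by (intro fls_eqI) (simp add: fls_rescale_nth)

lemma fls_rescale_sum:
  "c \<noteq> 0 \<Longrightarrow> fls_rescale c (\<Sum>i\<in>S. f i) = (\<Sum>i\<in>S. fls_rescale c (f i))"
  by (induction S rule: infinite_finite_induct) (auto simp: fls_rescale_add)

lemma fls_rescale_theta: "c \<noteq> 0 \<Longrightarrow> fls_rescale c (fls_theta f) = fls_theta (fls_rescale c f)"
  by (intro fls_eqI) (simp add: fls_rescale_nth)

lemma fls_rescale_rescale:
  "c \<noteq> 0 \<Longrightarrow> d \<noteq> 0 \<Longrightarrow> fls_rescale c (fls_rescale d f) = fls_rescale (c * d) f"
  by (intro fls_eqI) (simp add: fls_rescale_nth power_int_mult_distrib)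

lemma fls_rescale_compose_power:
  assumes "c \<noteq> 0" "0 < d"
  shows "fls_rescale c (fls_compose_power f d) = fls_compose_power (fls_rescale (c ^ d) f) d"
  using assms
  by (intro fls_eqI)
    (auto simp: fls_rescale_nth fls_nth_compose_power power_int_mult power_int_mult_distrib elim!: dvdE)

text \<open>The operator \<open>x d/dx + f\<close> on \<open>K((x\<^bsup>1/q\<^esup>))\<close>.\<close>

definition log_nabla :: "'k::field fls \<Rightarrow> nat \<Rightarrow> 'k fls \<Rightarrow> 'k fls" where
  "log_nabla f q v = fls_const (1 / of_nat q) * fls_theta v + f * v"

lemma E_conn_simps [simp]:
  "conn_space (E_conn f q) = UNIV"
  "conn_scale (E_conn f q) h v = fls_compose_power h q * v"
  by (simp_all add: E_conn_def)

lemma E_conn_nabla: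
  assumes "0 < q"
  shows "conn_nabla (E_conn f q) v = fls_compose_power fls_X_inv q * log_nabla f q v"
proof -
  have "fls_X_intpow (1 - int q) = fls_compose_power fls_X_inv q * (fls_X :: 'a fls)"
    using assms by (simp add: fls_X_times_conv_shift fls_X_intpow_times_conv_shift)
  then show ?thesis
    by (simp add: E_conn_def puiseux_deriv_def log_nabla_def fls_theta_def algebra_simps)
qed

lemma log_nabla_add: "log_nabla f q (v + w) = log_nabla f q v + log_nabla f q w"
  by (simp add: log_nabla_def fls_theta_add algebra_simps)

text \<open>The solution is exp of q times the integral of h dt/t. As h has positive order, h/t is a
  power series, so no logarithm arises and the exponent has constant term 0.\<close>

lemma exists_exponential:
  fixes h :: "'k::field_char_0 fls"
  assumes "0 < q" "fls_vanishes_below 1 h"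
  shows "\<exists>e. e \<noteq> 0 \<and> fls_subdegree e = 0 \<and> fls_const (1 / of_nat q) * fls_theta e = h * e"
proof -
  from assms(2) have "fls_vanishes_below 0 (fls_X_inv * h)"
    by (auto simp: fls_vanishes_below_def fls_X_inv_times_conv_shift)
  then obtain u where u: "fls_X_inv * h = fps_to_fls u" using fls_vanishes_below_nonneg by blast
  have h: "h = fls_X * fps_to_fls u"
    unfolding u[symmetric] by (simp add: fls_X_times_conv_shift fls_X_inv_times_conv_shift)
  define w where "w = fps_integral0 (fps_const (of_nat q) * u)"
  define e where "e = fps_compose (fps_exp 1) w"
  have w0: "fps_nth w 0 = 0" by (simp add: w_def fps_integral_def)
  have e0: "fps_nth e 0 = 1" by (simp add: e_def)
  have "fps_deriv e = fps_const (of_nat q) * u * e"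
    using w0 by (simp add: e_def fps_compose_deriv w_def fps_deriv_fps_integral mult.commute)
  then have "fls_theta (fps_to_fls e) = fls_const (of_nat q) * (h * fps_to_fls e)"
    by (simp add: fls_theta_def fls_deriv_fps_to_fls fls_times_fps_to_fls h algebra_simps)
  then have "fls_const (1 / of_nat q) * fls_theta (fps_to_fls e) = h * fps_to_fls e"
    using assms(1) by (simp flip: mult.assoc)
  moreover have "subdegree e = 0" using e0 by (intro subdegreeI) auto
  then have "fls_subdegree (fps_to_fls e) = 0" by (simp add: fls_subdegree_fls_to_fps)
  moreover have "e \<noteq> 0" using e0 by auto
  ultimately show ?thesis by (intro exI[of _ "fps_to_fls e"]) simp
qed

section \<open>Growth of lattices\<close>

lemma sum_apply: "(\<Sum>x\<in>A. F x) y = (\<Sum>x\<in>A. F x y :: 'b::comm_monoid_add)"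
  by (induction A rule: infinite_finite_induct) auto

text \<open>Gaussian elimination: an equation with a nonzero coefficient at s0 is solved for the
  unknown s0, which leaves one equation and one unknown less. Applied over K to compare lattices and
  over K((x)) to obtain a linear relation.\<close>

lemma homogeneous_system_solvable:
  fixes M :: "'s \<Rightarrow> 't \<Rightarrow> 'k::field"
  assumes "finite T" "finite S" "card T < card S"
  shows "\<exists>a. (\<exists>s\<in>S. a s \<noteq> 0) \<and> (\<forall>t\<in>T. (\<Sum>s\<in>S. a s * M s t) = 0)"
  using assms
proof (induction T arbitrary: S M rule: finite_induct)
  case empty
  then show ?case by (intro exI[of _ "\<lambda>_. 1"]) (auto simp: card_gt_0_iff)
next
  case (insert t T)
  show ?case
  proof (cases "\<forall>s\<in>S. M s t = 0")
    case True
    obtain a where "\<exists>s\<in>S. a s \<noteq> 0" "\<forall>t\<in>T. (\<Sum>s\<in>S. a s * M s t) = 0"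
      using insert.IH[of S M] insert.prems insert.hyps by auto
    with True show ?thesis by (intro exI[of _ a]) auto
  next
    case False
    then obtain s0 where s0: "s0 \<in> S" "M s0 t \<noteq> 0" by blast
    define S' where "S' = S - {s0}"
    define M' where "M' = (\<lambda>s u. M s u - M s t / M s0 t * M s0 u)"
    have S': "finite S'" "card T < card S'" "S = insert s0 S'" "s0 \<notin> S'"
      using insert.prems insert.hyps s0 by (auto simp: S'_def card_Diff_singleton)
    obtain a where a: "\<exists>s\<in>S'. a s \<noteq> 0" "\<And>u. u \<in> T \<Longrightarrow> (\<Sum>s\<in>S'. a s * M' s u) = 0"
      using insert.IH[of S' M'] S' by auto
    define c where "c = - (\<Sum>s\<in>S'. a s * M s t) / M s0 t"
    define b where "b = a(s0 := c)"
    have sum_b: "(\<Sum>s\<in>S. b s * M s u) = c * M s0 u + (\<Sum>s\<in>S'. a s * M s u)" for u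
      using S' by (simp add: b_def) (intro sum.cong, auto)
    have "(\<Sum>s\<in>S. b s * M s u) = 0" if u: "u \<in> insert t T" for u
    proof (cases "u = t")
      case True
      then show ?thesis using s0 by (simp add: sum_b c_def)
    next
      case False
      have "0 = (\<Sum>s\<in>S'. a s * M s u - a s * M s t * (M s0 u / M s0 t))"
        using a(2)[of u] False u by (simp add: M'_def algebra_simps)
      also have "\<dots> = (\<Sum>s\<in>S'. a s * M s u) - (\<Sum>s\<in>S'. a s * M s t) * (M s0 u / M s0 t)"
        by (simp only: sum_subtractf sum_distrib_right)
      finally show ?thesis by (simp add: sum_b c_def)
    qed
    moreover have "\<exists>s\<in>S. b s \<noteq> 0" using a(1) S' by (auto simp: b_def)
    ultimately show ?thesis by blast
  qed
qed

text \<open>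
  \<open>coord_space J\<close> models \<open>\<Oplus>\<^sub>i E\<^bsub>f\<^sub>i,q\<^sub>i\<^esub> \<otimes> J\<^bsub>m\<^sub>i\<^esub>\<close> for \<open>J = {(i, k). k < m\<^sub>i}\<close>, and \<open>coord_nabla\<close> is \<open>x\<nabla>\<close> on it.
\<close>

definition coord_space :: "('i \<times> nat) set \<Rightarrow> ('i \<times> nat \<Rightarrow> 'k::zero fls) set" where
  "coord_space J = {w. \<forall>j. j \<notin> J \<longrightarrow> w j = 0}"

definition coord_scale ::
    "('i \<Rightarrow> nat) \<Rightarrow> 'k::idom fls \<Rightarrow> ('i \<times> nat \<Rightarrow> 'k fls) \<Rightarrow> ('i \<times> nat \<Rightarrow> 'k fls)" where
  "coord_scale q h w = (\<lambda>j. fls_compose_power h (q (fst j)) * w j)"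

definition coord_nabla :: "('i \<Rightarrow> 'k::field fls) \<Rightarrow> ('i \<Rightarrow> nat) \<Rightarrow> ('i \<times> nat) set \<Rightarrow>
    ('i \<times> nat \<Rightarrow> 'k fls) \<Rightarrow> ('i \<times> nat \<Rightarrow> 'k fls)" where
  "coord_nabla f q J w = (\<lambda>j. if j \<in> J
     then log_nabla (f (fst j)) (q (fst j)) (w j) + w (fst j, Suc (snd j)) else 0)"

text \<open>For f in K((x^(1/q))) this is q max(0, -ord f) with the order taken in x, the
  contribution of E_{f,q} to the irregularity. The convention \<open>fls_subdegree 0 = 0\<close>
  gives the right value 0 at f = 0.\<close>

definition pole_order :: "'k::zero fls \<Rightarrow> int" where
  "pole_order f = max 0 (- fls_subdegree f)"

text \<open>
  The lattices \<open>x\<^bsup>-c\<^esup> \<Lambda>\<^sub>n\<close>, where \<open>\<Lambda>\<^sub>0\<close> is the standard lattice and \<open>\<Lambda>\<^bsub>n+1\<^esub> = \<Lambda>\<^sub>n + x\<nabla>(\<Lambda>\<^sub>n)\<close>; the dimension of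
  \<open>\<Lambda>\<^sub>n / \<Lambda>\<^sub>0\<close> is \<open>n\<close> times the irregularity.
\<close>

definition coord_lattice :: "('i \<Rightarrow> 'k::zero fls) \<Rightarrow> ('i \<Rightarrow> nat) \<Rightarrow> ('i \<times> nat) set \<Rightarrow> nat \<Rightarrow> int \<Rightarrow>
    ('i \<times> nat \<Rightarrow> 'k fls) set" where
  "coord_lattice f q J n c = {w \<in> coord_space J. \<forall>j\<in>J.
     fls_vanishes_below (- (int n * pole_order (f (fst j)) + c * int (q (fst j)))) (w j)}"

lemma coord_space_add: "v \<in> coord_space J \<Longrightarrow> w \<in> coord_space J \<Longrightarrow> v + w \<in> coord_space J"
  for v w :: "'i \<times> nat \<Rightarrow> 'k::comm_monoid_add fls"
  by (simp add: coord_space_def)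

lemma coord_space_scale: "w \<in> coord_space J \<Longrightarrow> coord_scale q h w \<in> coord_space J"
  by (simp add: coord_space_def coord_scale_def)

lemma coord_lattice_add:
  fixes v w :: "'i \<times> nat \<Rightarrow> 'k::comm_monoid_add fls"
  assumes "v \<in> coord_lattice f q J n c" "w \<in> coord_lattice f q J n c"
  shows "v + w \<in> coord_lattice f q J n c"
  using assms by (simp add: coord_lattice_def coord_space_def fls_vanishes_below_add)

lemma coord_lattice_zero: "0 \<in> coord_lattice f q J n c"
  by (simp add: coord_lattice_def coord_space_def)

lemma coord_lattice_sum:
  fixes v :: "'b \<Rightarrow> 'i \<times> nat \<Rightarrow> 'k::comm_monoid_add fls"
  shows "(\<And>i. i \<in> S \<Longrightarrow> v i \<in> coord_lattice f q J n c) \<Longrightarrow> (\<Sum>i\<in>S. v i) \<in> coord_lattice f q J n c"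
  by (induction S rule: infinite_finite_induct) (auto simp: coord_lattice_add coord_lattice_zero)

lemma coord_lattice_scale:
  fixes w :: "'i \<times> nat \<Rightarrow> 'k::idom fls"
  assumes "w \<in> coord_lattice f q J n c" "fls_vanishes_below a h" "\<And>j. j \<in> J \<Longrightarrow> 0 < q (fst j)"
  shows "coord_scale q h w \<in> coord_lattice f q J n (c - a)"
proof -
  have "fls_vanishes_below (- (int n * pole_order (f (fst j)) + (c - a) * int (q (fst j))))
      (fls_compose_power h (q (fst j)) * w j)" if "j \<in> J" for j
  proof -
    have "fls_vanishes_below (int (q (fst j)) * a) (fls_compose_power h (q (fst j)))"
      using assms that by (simp add: fls_compose_power_vanishes_below)
    moreover have "fls_vanishes_below (- (int n * pole_order (f (fst j)) + c * int (q (fst j)))) (w j)"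
      using assms that by (simp add: coord_lattice_def)
    ultimately show ?thesis
      by (rule fls_vanishes_below_mono[OF fls_vanishes_below_mult]) (simp add: algebra_simps)
  qed
  then show ?thesis using assms(1) coord_space_scale[of w J q h]
    by (auto simp: coord_lattice_def coord_scale_def)
qed

lemma coord_lattice_exhaust:
  fixes w :: "'i \<times> nat \<Rightarrow> 'k::zero fls"
  assumes "finite J" "w \<in> coord_space J" "\<And>j. j \<in> J \<Longrightarrow> 0 < q (fst j)"
  shows "\<exists>c\<ge>0. w \<in> coord_lattice f q J 0 c"
proof -
  define c where "c = (\<Sum>j\<in>J. \<bar>fls_subdegree (w j)\<bar>)"
  have "fls_vanishes_below (- (c * int (q (fst j)))) (w j)" if "j \<in> J" for j
  proof -
    have "\<bar>fls_subdegree (w j)\<bar> \<le> c"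
      unfolding c_def using assms(1) that by (intro member_le_sum) auto
    also have "c * 1 \<le> c * int (q (fst j))"
      using assms(3)[OF that] by (intro mult_left_mono) (auto simp: c_def sum_nonneg)
    finally show ?thesis by (auto simp: fls_vanishes_below_iff)
  qed
  then show ?thesis using assms(2) by (intro exI[of _ c]) (auto simp: coord_lattice_def c_def sum_nonneg)
qed

lemma coord_lattice_mono:
  assumes "w \<in> coord_lattice f q J n c" "c \<le> c'"
  shows "w \<in> coord_lattice f q J n c'"
  using assms by (auto simp: coord_lattice_def mult_right_mono elim!: fls_vanishes_below_mono)

lemma pole_order_vanishes_below: "fls_vanishes_below (- pole_order f) f"
  by (auto simp: fls_vanishes_below_iff pole_order_def)

text \<open>Multiplication by f lowers the order by at most the pole order; the Euler operator and
  the nilpotent part do not lower it.\<close>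

lemma coord_nabla_lattice:
  fixes w :: "'i \<times> nat \<Rightarrow> 'k::field_char_0 fls"
  assumes "w \<in> coord_lattice f q J n c"
  shows "coord_nabla f q J w \<in> coord_lattice f q J (Suc n) c"
proof -
  have "fls_vanishes_below (- (int (Suc n) * pole_order (f (fst j)) + c * int (q (fst j)))) (coord_nabla f q J w j)"
    if j: "j \<in> J" for j
  proof -
    let ?i = "fst j" and ?a = "- (int n * pole_order (f (fst j)) + c * int (q (fst j)))"
    have w: "fls_vanishes_below ?a (w (?i, k))" for k
    proof (cases "(?i, k) \<in> J")
      case True
      with assms show ?thesis by (force simp: coord_lattice_def)
    next
      case False
      with assms show ?thesis by (auto simp: coord_lattice_def coord_space_def)
    qed
    have *: "- (int (Suc n) * pole_order (f ?i) + c * int (q ?i)) = - pole_order (f ?i) + ?a"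
      by (simp add: algebra_simps)
    have le: "- pole_order (f ?i) + ?a \<le> ?a" "- pole_order (f ?i) + ?a \<le> 0 + ?a"
      by (simp_all add: pole_order_def)
    have "fls_vanishes_below (0 + ?a) (fls_const (1 / of_nat (q ?i)) * fls_theta (w (?i, snd j)))"
      by (intro fls_vanishes_below_mult fls_theta_vanishes_below w)
        (simp add: fls_vanishes_below_def)
    from fls_vanishes_below_mono[OF this le(2)]
    have 1: "fls_vanishes_below (- pole_order (f ?i) + ?a)
        (fls_const (1 / of_nat (q ?i)) * fls_theta (w (?i, snd j)))" .
    have 2: "fls_vanishes_below (- pole_order (f ?i) + ?a) (f ?i * w (?i, snd j))"
      by (intro fls_vanishes_below_mult pole_order_vanishes_below w)
    have "fls_vanishes_below (- pole_order (f ?i) + ?a)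
        (log_nabla (f ?i) (q ?i) (w (?i, snd j)) + w (?i, Suc (snd j)))"
      unfolding log_nabla_def
      by (intro fls_vanishes_below_add 1 2 fls_vanishes_below_mono[OF w le(1)])
    then show ?thesis using j unfolding * coord_nabla_def by simp
  qed
  then show ?thesis by (auto simp: coord_lattice_def coord_space_def coord_nabla_def)
qed

text \<open>
  Multiplication by \<open>f\<close> dominates \<open>x d/dx\<close> on components where \<open>f\<close> has a pole, so dividing by \<open>f\<close>
  inverts \<open>\<nabla>\<close> up to the previous lattice.
\<close>

lemma coord_lattice_Suc_decompose:
  fixes v :: "'i \<times> nat \<Rightarrow> 'k::field_char_0 fls"
  assumes "v \<in> coord_lattice f q J (Suc n) 0"
  shows "\<exists>w \<in> coord_lattice f q J n 0. v - coord_nabla f q J w \<in> coord_lattice f q J n 0"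
proof -
  \<comment> \<open>On components without a pole the lattices for n and n + 1 coincide, so w = 0
    suffices there.\<close>
  define w where "w = (\<lambda>j. if 0 < pole_order (f (fst j)) then v j / f (fst j) else 0)"
  have w: "fls_vanishes_below (- (int n * pole_order (f i))) (w (i, k))" for i k
  proof (cases "0 < pole_order (f i) \<and> v (i, k) \<noteq> 0")
    case True
    then have "f i \<noteq> 0" by (auto simp: pole_order_def)
    have "(i, k) \<in> J" using True assms by (auto simp: coord_lattice_def coord_space_def)
    then have "- (int (Suc n) * pole_order (f i)) \<le> fls_subdegree (v (i, k))"
      using True assms by (force simp: coord_lattice_def fls_vanishes_below_iff)
    moreover have "fls_subdegree (v (i, k) / f i) = fls_subdegree (v (i, k)) + pole_order (f i)"
      using True \<open>f i \<noteq> 0\<close> by (auto simp: fls_divide_subdegree pole_order_def)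
    ultimately show ?thesis using True by (auto simp: w_def fls_vanishes_below_iff algebra_simps)
  qed (auto simp: w_def)
  have w_space: "w \<in> coord_space J"
    using assms by (auto simp: coord_lattice_def coord_space_def w_def)
  then have 1: "w \<in> coord_lattice f q J n 0" using w by (auto simp: coord_lattice_def)
  have "fls_vanishes_below (- (int n * pole_order (f i))) ((v - coord_nabla f q J w) (i, k))"
    if j: "(i, k) \<in> J" for i k
  proof (cases "0 < pole_order (f i)")
    case True
    then have "f i \<noteq> 0" by (auto simp: pole_order_def)
    then have "(v - coord_nabla f q J w) (i, k)
        = 0 - fls_const (1 / of_nat (q i)) * fls_theta (w (i, k)) - w (i, Suc k)"
      using j True by (simp add: coord_nabla_def log_nabla_def w_def)
    moreover have "fls_vanishes_below (0 + - (int n * pole_order (f i)))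
        (fls_const (1 / of_nat (q i)) * fls_theta (w (i, k)))"
      by (intro fls_vanishes_below_mult fls_theta_vanishes_below w)
        (simp add: fls_vanishes_below_def)
    ultimately show ?thesis using w[of i "Suc k"]
      by (simp only:) (intro fls_vanishes_below_diff; simp)
  next
    case False
    then have 0: "pole_order (f i) = 0" by (simp add: pole_order_def)
    then have "(v - coord_nabla f q J w) (i, k) = v (i, k)"
      using j by (simp add: coord_nabla_def w_def log_nabla_def)
    then show ?thesis using assms j 0 by (force simp: coord_lattice_def)
  qed
  moreover have "v - coord_nabla f q J w \<in> coord_space J"
    using assms by (auto simp: coord_lattice_def coord_space_def coord_nabla_def)
  ultimately have "v - coord_nabla f q J w \<in> coord_lattice f q J n 0"
    by (auto simp: coord_lattice_def)
  with 1 show ?thesis by blast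
qed

definition coord_unit :: "'i \<times> nat \<Rightarrow> int \<Rightarrow> ('i \<times> nat \<Rightarrow> 'k::zero_neq_one fls)" where
  "coord_unit j a = (\<lambda>j'. if j' = j then fls_X_intpow a else 0)"

lemma coord_unit_space: "j \<in> J \<Longrightarrow> coord_unit j a \<in> coord_space J"
  by (auto simp: coord_space_def coord_unit_def)

lemma coord_expand:
  fixes w :: "'i \<times> nat \<Rightarrow> 'k::idom fls"
  assumes "finite J" "w \<in> coord_space J" "\<And>j. j \<in> J \<Longrightarrow> 0 < q (fst j)"
  shows "w = (\<Sum>j\<in>J. \<Sum>a<q (fst j).
    coord_scale q (fls_section (q (fst j)) (fls_shift (int a) (w j))) (coord_unit j (int a)))" (is "w = ?R")
proof
  fix j
  have *: "coord_scale q h (coord_unit j' a) j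
      = (if j' = j then fls_compose_power h (q (fst j)) * fls_X_intpow a else 0)" for h :: "'k fls" and j' a
    by (simp add: coord_scale_def coord_unit_def)
  have "?R j = (\<Sum>j'\<in>J. if j' = j then \<Sum>a<q (fst j).
      fls_compose_power (fls_section (q (fst j)) (fls_shift (int a) (w j))) (q (fst j)) * fls_X_intpow (int a) else 0)"
    unfolding sum_apply * by (intro sum.cong) auto
  also have "\<dots> = w j"
  proof (cases "j \<in> J")
    case True
    then show ?thesis using assms fls_split_sections[of "q (fst j)" "w j"]
      by (simp add: mult.commute)
  next
    case False
    then have "w j = 0" using assms(2) unfolding coord_space_def by blast
    with False assms(1) show ?thesis by (simp add: sum.delta)
  qed
  finally show "w j = ?R j" by simp
qed

text \<open>Describes the change of coordinates between two decompositions of one connection: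
  K((x))-linear and compatible with x\<nabla> on \<open>coord_space J\<close>.\<close>

locale coord_map =
  fixes f f' :: "nat \<Rightarrow> 'k::field_char_0 fls" and q q' :: "nat \<Rightarrow> nat" and J J' :: "(nat \<times> nat) set"
    and T :: "(nat \<times> nat \<Rightarrow> 'k fls) \<Rightarrow> (nat \<times> nat \<Rightarrow> 'k fls)"
  assumes finite: "finite J" "finite J'"
    and q_pos: "j \<in> J \<Longrightarrow> 0 < q (fst j)" "j' \<in> J' \<Longrightarrow> 0 < q' (fst j')"
    and T_space: "w \<in> coord_space J \<Longrightarrow> T w \<in> coord_space J'"
    and T_add: "v \<in> coord_space J \<Longrightarrow> w \<in> coord_space J \<Longrightarrow> T (v + w) = T v + T w"
    and T_scale: "w \<in> coord_space J \<Longrightarrow> T (coord_scale q h w) = coord_scale q' h (T w)"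
    and T_nabla: "w \<in> coord_space J \<Longrightarrow> T (coord_nabla f q J w) = coord_nabla f' q' J' (T w)"
begin

lemma zero_space: "0 \<in> coord_space J"
  by (simp add: coord_space_def)

lemma T_zero: "T 0 = 0"
  using T_add[OF zero_space zero_space] by simp

lemma T_sum:
  assumes "finite S" "\<And>s. s \<in> S \<Longrightarrow> v s \<in> coord_space J"
  shows "(\<Sum>s\<in>S. v s) \<in> coord_space J \<and> T (\<Sum>s\<in>S. v s) = (\<Sum>s\<in>S. T (v s))"
  using assms
  by (induction S rule: finite_induct) (auto simp: T_zero zero_space T_add coord_space_add)

text \<open>The standard lattice is generated over K[[x]] by finitely many monomials. Their images
  lie in a common dilate of the other standard lattice, and integral scalars keep combinations
  there.\<close>

lemma lattice_bounded:
  "\<exists>c\<ge>0. \<forall>w\<in>coord_lattice f q J 0 0. T w \<in> coord_lattice f' q' J' 0 c"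
proof -
  define I where "I = (SIGMA j:J. {..<q (fst j)})"
  have "\<forall>ja. \<exists>c. ja \<in> I \<longrightarrow> 0 \<le> c \<and> T (coord_unit (fst ja) (int (snd ja))) \<in> coord_lattice f' q' J' 0 c"
  proof
    fix ja
    show "\<exists>c. ja \<in> I \<longrightarrow> 0 \<le> c \<and> T (coord_unit (fst ja) (int (snd ja))) \<in> coord_lattice f' q' J' 0 c"
    proof (cases "ja \<in> I")
      case True
      then have "T (coord_unit (fst ja) (int (snd ja))) \<in> coord_space J'"
        by (intro T_space coord_unit_space) (auto simp: I_def)
      from coord_lattice_exhaust[where q = q' and f = f', OF finite(2) this] q_pos(2)
      show ?thesis by blast
    qed simp
  qed
  then obtain C where C: "\<And>ja. ja \<in> I \<Longrightarrow> 0 \<le> C ja"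
    "\<And>ja. ja \<in> I \<Longrightarrow> T (coord_unit (fst ja) (int (snd ja))) \<in> coord_lattice f' q' J' 0 (C ja)"
    by metis
  define c where "c = (\<Sum>ja\<in>I. C ja)"
  have "finite I" using finite by (simp add: I_def)
  have T_unit: "T (coord_unit j (int a)) \<in> coord_lattice f' q' J' 0 c" if "j \<in> J" "a < q (fst j)" for j a
  proof -
    have ja: "(j, a) \<in> I" using that by (simp add: I_def)
    have "C (j, a) \<le> c" unfolding c_def
      using \<open>finite I\<close> C(1) ja by (intro member_le_sum) auto
    with C(2)[OF ja] show ?thesis by (auto intro: coord_lattice_mono)
  qed
  have "T w \<in> coord_lattice f' q' J' 0 c" if w: "w \<in> coord_lattice f q J 0 0" for w
  proof -
    have w': "w \<in> coord_space J" using w by (simp add: coord_lattice_def)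
    let ?h = "\<lambda>j a. fls_section (q (fst j)) (fls_shift (int a) (w j))"
    let ?u = "\<lambda>j a. coord_scale q (?h j a) (coord_unit j (int a))"
    have u: "?u j a \<in> coord_space J" if "j \<in> J" for j a
      using that by (intro coord_space_scale coord_unit_space)
    have "T w = T (\<Sum>j\<in>J. \<Sum>a<q (fst j). ?u j a)"
      using coord_expand[where q = q, OF finite(1) w' q_pos(1)] by simp
    also have "\<dots> = (\<Sum>j\<in>J. T (\<Sum>a<q (fst j). ?u j a))"
      by (rule T_sum[THEN conjunct2]) (use finite u in \<open>auto intro!: T_sum[THEN conjunct1]\<close>)
    also have "\<dots> = (\<Sum>j\<in>J. \<Sum>a<q (fst j). T (?u j a))"
      by (intro sum.cong refl T_sum[THEN conjunct2]) (use u in auto)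
    also have "\<dots> = (\<Sum>j\<in>J. \<Sum>a<q (fst j). coord_scale q' (?h j a) (T (coord_unit j (int a))))"
      by (intro sum.cong refl T_scale coord_unit_space)
    also have "\<dots> \<in> coord_lattice f' q' J' 0 c"
    proof (intro coord_lattice_sum)
      fix j a assume ja: "j \<in> J" "a \<in> {..<q (fst j)}"
      have "fls_vanishes_below 0 (w j)" using w ja by (auto simp: coord_lattice_def)
      then have "fls_vanishes_below 0 (?h j a)"
        using fls_section_shift_vanishes_below[of a "q (fst j)"] ja by simp
      from coord_lattice_scale[OF T_unit this q_pos(2)] ja
      show "coord_scale q' (?h j a) (T (coord_unit j (int a))) \<in> coord_lattice f' q' J' 0 c" by simp
    qed
    finally show ?thesis .
  qed
  then show ?thesis using C(1) by (intro exI[of _ c]) (auto simp: c_def sum_nonneg)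
qed

text \<open>The point is that c does not depend on n: T commutes with x\<nabla>, and x\<nabla>
  generates each lattice from the preceding one.\<close>

lemma lattice_growth:
  assumes "\<And>w. w \<in> coord_lattice f q J 0 0 \<Longrightarrow> T w \<in> coord_lattice f' q' J' 0 c"
  shows "w \<in> coord_lattice f q J n 0 \<Longrightarrow> T w \<in> coord_lattice f' q' J' n c"
proof (induction n arbitrary: w)
  case (Suc n)
  obtain u where u: "u \<in> coord_lattice f q J n 0" "w - coord_nabla f q J u \<in> coord_lattice f q J n 0"
    using coord_lattice_Suc_decompose[OF Suc.prems] by blast
  have space: "u \<in> coord_space J" "w - coord_nabla f q J u \<in> coord_space J" "coord_nabla f q J u \<in> coord_space J"
    using u by (auto simp: coord_lattice_def coord_space_def coord_nabla_def)
  define r where "r = w - coord_nabla f q J u"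
  have r: "r \<in> coord_lattice f q J n 0" "r \<in> coord_space J" using u(2) space(2) by (simp_all add: r_def)
  have "w = r + coord_nabla f q J u" by (simp add: r_def)
  then have "T w = T r + coord_nabla f' q' J' (T u)"
    using T_add[OF r(2) space(3)] T_nabla[OF space(1)] by simp
  moreover have "T r \<in> coord_lattice f' q' J' (Suc n) c"
  proof -
    have "- (int (Suc n) * pole_order (f' i) + c * int (q' i)) \<le> - (int n * pole_order (f' i) + c * int (q' i))" for i
      by (simp add: pole_order_def mult_right_mono)
    then show ?thesis
      using Suc.IH[OF r(1)] unfolding coord_lattice_def by (blast intro: fls_vanishes_below_mono)
  qed
  ultimately show ?case
    using coord_lattice_add[OF _ coord_nabla_lattice[OF Suc.IH[OF u(1)]]] by metis
qed (use assms in blast)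

end

text \<open>A dimension count: T maps \<Lambda>_n into x^(-c1) \<Lambda>'_n, and T' maps x^c2
  \<Lambda>'_0 into \<Lambda>_0. Were \<Lambda>_n/\<Lambda>_0 larger than x^(-c1) \<Lambda>'_n /
  x^c2 \<Lambda>'_0, some v outside \<Lambda>_0 would have T v in x^c2 \<Lambda>'_0, and v = T' (T
  v) would lie in \<Lambda>_0.\<close>

lemma coord_map_growth_bound:
  fixes f f' :: "nat \<Rightarrow> 'k::field_char_0 fls"
  assumes T: "coord_map f f' q q' J J' T" and T': "coord_map f' f q' q J' J T'"
    and inv: "\<And>w. w \<in> coord_space J \<Longrightarrow> T' (T w) = w"
  shows "\<exists>B. \<forall>n::nat. int n * (\<Sum>j\<in>J. pole_order (f (fst j)))
    \<le> int n * (\<Sum>j\<in>J'. pole_order (f' (fst j))) + B"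
proof -
  interpret T: coord_map f f' q q' J J' T by fact
  interpret T': coord_map f' f q' q J' J T' by fact
  obtain c1 where c1: "c1 \<ge> 0" "\<And>w. w \<in> coord_lattice f q J 0 0 \<Longrightarrow> T w \<in> coord_lattice f' q' J' 0 c1"
    using T.lattice_bounded by blast
  obtain c2 where c2: "c2 \<ge> 0" "\<And>w. w \<in> coord_lattice f' q' J' 0 0 \<Longrightarrow> T' w \<in> coord_lattice f q J 0 c2"
    using T'.lattice_bounded by blast
  \<comment> \<open>Scale by x^(-c2) into the standard lattice, apply T', and scale back by
    x^c2.\<close>
  have T'_lattice: "T' w \<in> coord_lattice f q J 0 0" if w: "w \<in> coord_lattice f' q' J' 0 (- c2)" for w
  proof -
    have "fls_vanishes_below (- c2) (fls_X_intpow (- c2) :: 'k fls)" "fls_vanishes_below c2 (fls_X_intpow c2 :: 'k fls)"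
      by (simp_all add: fls_vanishes_below_def)
    from coord_lattice_scale[OF w this(1) T'.q_pos(1)]
    have u: "coord_scale q' (fls_X_intpow (- c2)) w \<in> coord_lattice f' q' J' 0 0" (is "?u \<in> _") by simp
    have "fls_X_intpow c2 * fls_X_intpow (- c2) = (1 :: 'k fls)"
      using fls_X_intpow_times_fls_X_intpow[of c2 "- c2", where 'a='k] by simp
    then have *: "fls_compose_power (fls_X_intpow c2) d * fls_compose_power (fls_X_intpow (- c2)) d = (1 :: 'k fls)"
      if "0 < d" for d using that by (simp del: fls_compose_power_X_intpow fls_compose_power_shift flip: fls_compose_power_mult)
    have "coord_scale q' (fls_X_intpow c2) ?u = w"
    proof (intro ext)
      fix j
      show "coord_scale q' (fls_X_intpow c2) ?u j = w j"
      proof (cases "j \<in> J'")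
        case True
        from *[OF T'.q_pos(1)[OF True]] show ?thesis
          unfolding coord_scale_def mult.assoc[symmetric] by (simp only: mult_1)
      next
        case False
        then have "w j = 0" using w unfolding coord_lattice_def coord_space_def by blast
        then show ?thesis by (simp add: coord_scale_def)
      qed
    qed
    then have "T' w = coord_scale q (fls_X_intpow c2) (T' ?u)"
      using T'.T_scale[of ?u "fls_X_intpow c2"] u by (auto simp: coord_lattice_def)
    then show ?thesis
      using coord_lattice_scale[OF c2(2)[OF u] \<open>fls_vanishes_below c2 _\<close> T.q_pos(1)] by simp
  qed
  \<comment> \<open>The dilations by x^(-c1) and x^c2 cost c1 + c2 dimensions for each unit of the
    rank, which is the sum of the q'.\<close>
  define B where "B = (c1 + c2) * (\<Sum>j\<in>J'. int (q' (fst j)))"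
  have "int n * (\<Sum>j\<in>J. pole_order (f (fst j))) \<le> int n * (\<Sum>j\<in>J'. pole_order (f' (fst j))) + B" for n
  proof (rule ccontr)
    assume less: "\<not> ?thesis"
    \<comment> \<open>S indexes the monomial basis of \<Lambda>_n/\<Lambda>_0 and R that of x^(-c1)
      \<Lambda>'_n / x^c2 \<Lambda>'_0: the unknowns are coefficients of v on S, the equations say
      that T v vanishes on R.\<close>
    define S where "S = (SIGMA j:J. {- (int n * pole_order (f (fst j)))..<0})"
    define R where "R = (SIGMA j:J'. {- (int n * pole_order (f' (fst j)) + c1 * int (q' (fst j)))..<c2 * int (q' (fst j))})"
    have fin: "finite S" "finite R" using T.finite by (auto simp: S_def R_def)
    have "int (card S) = int n * (\<Sum>j\<in>J. pole_order (f (fst j)))"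
      using T.finite by (simp add: S_def pole_order_def sum_distrib_left)
    moreover have "int (card R) = int n * (\<Sum>j\<in>J'. pole_order (f' (fst j))) + B"
    proof -
      have "int (card R) = (\<Sum>j\<in>J'. int n * pole_order (f' (fst j)) + (c1 + c2) * int (q' (fst j)))"
        using T.finite c1(1) c2(1) by (simp add: R_def pole_order_def algebra_simps)
      then show ?thesis by (simp add: B_def sum.distrib sum_distrib_left)
    qed
    ultimately have "card R < card S" using less by linarith
    from homogeneous_system_solvable[OF fin(2,1) this, of "\<lambda>s r. T (coord_unit (fst s) (snd s)) (fst r) $$ snd r"]
    obtain a where a: "\<exists>s\<in>S. a s \<noteq> 0"
      "\<And>r. r \<in> R \<Longrightarrow> (\<Sum>s\<in>S. a s * T (coord_unit (fst s) (snd s)) (fst r) $$ snd r) = 0"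
      by blast
    define v where "v = (\<Sum>s\<in>S. coord_scale q (fls_const (a s)) (coord_unit (fst s) (snd s)))"
    have su: "coord_scale q (fls_const (a s)) (coord_unit (fst s) (snd s)) \<in> coord_space J" if "s \<in> S" for s
      using that by (intro coord_space_scale coord_unit_space) (auto simp: S_def)
    have v_space: "v \<in> coord_space J" and "T v = (\<Sum>s\<in>S. T (coord_scale q (fls_const (a s)) (coord_unit (fst s) (snd s))))"
      using T.T_sum[OF fin(1) su] by (auto simp: v_def)
    moreover have "T (coord_scale q (fls_const (a s)) (coord_unit (fst s) (snd s)))
        = coord_scale q' (fls_const (a s)) (T (coord_unit (fst s) (snd s)))" if "s \<in> S" for s
      using that by (intro T.T_scale coord_unit_space) (auto simp: S_def)
    ultimately have Tv: "T v = (\<Sum>s\<in>S. coord_scale q' (fls_const (a s)) (T (coord_unit (fst s) (snd s))))"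
      by simp
    have v_nth: "v j $$ e = (if (j, e) \<in> S then a (j, e) else 0)" if "j \<in> J" for j e
    proof -
      have "v j $$ e = (\<Sum>s\<in>S. if s = (j, e) then a s else 0)"
        unfolding v_def sum_apply fls_nth_sum using that T.q_pos(1)
        by (intro sum.cong refl) (auto simp: coord_scale_def coord_unit_def)
      then show ?thesis using fin(1) by (simp add: sum.delta)
    qed
    have "v \<in> coord_lattice f q J n 0"
      using v_space v_nth by (auto simp: coord_lattice_def fls_vanishes_below_def S_def)
    then have Tv_n: "T v \<in> coord_lattice f' q' J' n c1"
      using T.lattice_growth c1 by blast
    have "fls_vanishes_below (c2 * int (q' (fst j))) (T v j)" if j: "j \<in> J'" for j
      unfolding fls_vanishes_below_def
    proof (intro allI impI)
      fix e assume e: "e < c2 * int (q' (fst j))"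
      show "T v j $$ e = 0"
      proof (cases "(j, e) \<in> R")
        case True
        then show ?thesis using a(2)[OF True] T.q_pos(2)[OF j]
          by (simp add: Tv sum_apply fls_nth_sum coord_scale_def)
      next
        case False
        with e j have "e < - (int n * pole_order (f' (fst j)) + c1 * int (q' (fst j)))" by (auto simp: R_def)
        then show ?thesis using Tv_n j by (auto simp: coord_lattice_def fls_vanishes_below_def)
      qed
    qed
    then have "T v \<in> coord_lattice f' q' J' 0 (- c2)"
      using Tv_n by (auto simp: coord_lattice_def)
    then have "v \<in> coord_lattice f q J 0 0" using T'_lattice inv[OF v_space] by metis
    then have "v j $$ e = 0" if "(j, e) \<in> S" for j e
      using that by (auto simp: coord_lattice_def S_def fls_vanishes_below_def)
    with a(1) v_nth show False by (auto simp: S_def)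
  qed
  then show ?thesis by blast
qed

lemma linear_growth_le:
  fixes a b B :: int
  assumes "\<And>n::nat. int n * a \<le> int n * b + B"
  shows "a \<le> b"
proof (rule ccontr)
  assume "\<not> a \<le> b"
  then have "int (nat (\<bar>B\<bar> + 1)) * 1 \<le> int (nat (\<bar>B\<bar> + 1)) * (a - b)" by (intro mult_left_mono) auto
  then show False using assms[of "nat (\<bar>B\<bar> + 1)"] by (simp add: algebra_simps)
qed

lemma coord_iso_pole_order_sum_eq:
  fixes f f' :: "nat \<Rightarrow> 'k::field_char_0 fls"
  assumes "coord_map f f' q q' J J' T" "coord_map f' f q' q J' J T'"
    and "\<And>w. w \<in> coord_space J \<Longrightarrow> T' (T w) = w" "\<And>w. w \<in> coord_space J' \<Longrightarrow> T (T' w) = w"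
  shows "(\<Sum>j\<in>J. pole_order (f (fst j))) = (\<Sum>j\<in>J'. pole_order (f' (fst j)))"
  using coord_map_growth_bound[OF assms(1,2,3)] coord_map_growth_bound[OF assms(2,1,4)]
    linear_growth_le by (metis order_antisym)

section \<open>Irregularity is well defined\<close>

lemma tensor_J_E_nabla:
  assumes "0 < q" "k < m"
  shows "conn_nabla (tensor_J (E_conn f q) m) w k
    = fls_compose_power fls_X_inv q * (log_nabla f q (w k) + (if Suc k < m then w (Suc k) else 0))"
proof -
  have "(\<Sum>l<m. fls_compose_power (fls_X_inv * jordan_nilp k l) q * w l)
      = (\<Sum>l<m. if l = Suc k then fls_compose_power fls_X_inv q * w l else 0)"
    using assms(1) by (intro sum.cong refl) (auto simp: jordan_nilp_def)
  also have "\<dots> = (if Suc k < m then fls_compose_power fls_X_inv q * w (Suc k) else 0)"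
    by (simp add: sum.delta)
  finally show ?thesis
    using assms by (simp add: tensor_J_def tensor_conn_def E_conn_nabla distrib_left)
qed

lemma tensor_J_E_simps [simp]:
  "conn_space (tensor_J (E_conn f q) m) = {w. \<forall>k\<ge>m. w k = 0}"
  "conn_scale (tensor_J (E_conn f q) m) h w = (\<lambda>k. fls_compose_power h q * w k)"
  by (simp_all add: tensor_J_def tensor_conn_def)

lemma fls_compose_power_X_mult_X_inv:
  "0 < q \<Longrightarrow> fls_compose_power fls_X q * fls_compose_power fls_X_inv q = (1 :: 'a::idom fls)"
proof -
  assume "0 < q"
  have "fls_X * fls_X_inv = (1 :: 'a fls)" by (simp add: fls_X_times_conv_shift)
  with \<open>0 < q\<close> show ?thesis
    by (simp del: fls_compose_power_X fls_compose_power_X_inv flip: fls_compose_power_mult)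
qed

text \<open>What a space has to bring along before a decomposition is known; the remaining structure
  is transported from the models through the isomorphisms in
  \<open>HTL_decomposition\<close>.\<close>

definition linear_space :: "('k::field, 'v::ab_group_add) conn \<Rightarrow> bool" where
  "linear_space C \<longleftrightarrow> vector_space (conn_scale C) \<and> module.subspace (conn_scale C) (conn_space C) \<and>
     (\<forall>v\<in>conn_space C. \<forall>w\<in>conn_space C. conn_nabla C (v + w) = conn_nabla C v + conn_nabla C w)"

text \<open>\<Psi> adds up the inverses of the isomorphisms of the summands. Its injectivity and
  surjectivity are uniqueness and existence of the direct sum representation. The scalar x cancels
  the x^(-1) in the model connections.\<close>

lemma HTL_coordinates:
  fixes C :: "('k::field_char_0, 'v::ab_group_add) conn"
  assumes C: "linear_space C" and HTL: "HTL_decomposition C N f q m"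
  defines "J \<equiv> SIGMA i:{..<N}. {..<m i}"
  shows "\<exists>\<Psi>. bij_betw \<Psi> (coord_space J) (conn_space C) \<and>
    (\<forall>v\<in>coord_space J. \<forall>w\<in>coord_space J. \<Psi> (v + w) = \<Psi> v + \<Psi> w) \<and>
    (\<forall>h. \<forall>w\<in>coord_space J. \<Psi> (coord_scale q h w) = conn_scale C h (\<Psi> w)) \<and>
    (\<forall>w\<in>coord_space J. \<Psi> (coord_nabla f q J w) = conn_scale C fls_X (conn_nabla C (\<Psi> w)))"
proof -
  interpret V: vector_space "conn_scale C" using C by (simp add: linear_space_def)
  have sub: "V.subspace (conn_space C)"
    and nabla_add: "\<And>v w. v \<in> conn_space C \<Longrightarrow> w \<in> conn_space C \<Longrightarrow>
      conn_nabla C (v + w) = conn_nabla C v + conn_nabla C w"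
    using C by (auto simp: linear_space_def)
  obtain U where qm: "\<And>i. i < N \<Longrightarrow> 0 < q i"
    and dsum: "conn_direct_sum C N U"
    and iso: "\<And>i. i < N \<Longrightarrow> conn_isomorphic (C\<lparr>conn_space := U i\<rparr>) (tensor_J (E_conn (f i) (q i)) (m i))"
    using HTL by (auto simp: HTL_decomposition_def)
  have U: "V.subspace (U i)" "U i \<subseteq> conn_space C" "nabla_stable C (U i)" if "i < N" for i
    using dsum that by (auto simp: conn_direct_sum_def conn_subspace_def)
  let ?E = "\<lambda>i. tensor_J (E_conn (f i) (q i)) (m i)"
  have "\<forall>i. \<exists>\<phi>. i < N \<longrightarrow> conn_morphism (C\<lparr>conn_space := U i\<rparr>) (?E i) \<phi> \<and>
      bij_betw \<phi> (U i) {w. \<forall>k\<ge>m i. w k = 0}"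
  proof
    fix i
    show "\<exists>\<phi>. i < N \<longrightarrow> conn_morphism (C\<lparr>conn_space := U i\<rparr>) (?E i) \<phi> \<and>
        bij_betw \<phi> (U i) {w. \<forall>k\<ge>m i. w k = 0}"
    proof (cases "i < N")
      case True
      from iso[OF this] show ?thesis unfolding conn_isomorphic_def by auto
    qed simp
  qed
  from choice[OF this] obtain \<phi> where "\<forall>i. i < N \<longrightarrow> conn_morphism (C\<lparr>conn_space := U i\<rparr>) (?E i) (\<phi> i) \<and>
      bij_betw (\<phi> i) (U i) {w. \<forall>k\<ge>m i. w k = 0}"
    by (elim exE)
  then have \<phi>: "\<And>i. i < N \<Longrightarrow> conn_morphism (C\<lparr>conn_space := U i\<rparr>) (?E i) (\<phi> i)"
    "\<And>i. i < N \<Longrightarrow> bij_betw (\<phi> i) (U i) {w. \<forall>k\<ge>m i. w k = 0}"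
    by auto
  have \<phi>_add: "\<phi> i (v + w) = \<phi> i v + \<phi> i w" and \<phi>_scale: "\<phi> i (conn_scale C h v) = (\<lambda>k. fls_compose_power h (q i) * \<phi> i v k)"
    and \<phi>_nabla: "\<phi> i (conn_nabla C v) = conn_nabla (?E i) (\<phi> i v)"
    if "i < N" "v \<in> U i" "w \<in> U i" for i v w h
    using \<phi>(1)[OF that(1)] that by (auto simp: conn_morphism_def conn_linear_def)
  define g where "g = (\<lambda>i. inv_into (U i) (\<phi> i))"
  have g_in: "g i w \<in> U i" and \<phi>_g: "\<phi> i (g i w) = w" if "i < N" "\<forall>k\<ge>m i. w k = 0" for i w
  proof -
    have "w \<in> \<phi> i ` U i" using \<phi>(2)[OF that(1)] that(2) by (simp add: bij_betw_def)
    then show "g i w \<in> U i" "\<phi> i (g i w) = w"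
      unfolding g_def by (rule inv_into_into, rule f_inv_into_f)
  qed
  have g_\<phi>: "g i (\<phi> i v) = v" if "i < N" "v \<in> U i" for i v
    using \<phi>(2)[OF that(1)] that(2) unfolding g_def by (rule bij_betw_inv_into_left)
  define \<Psi> where "\<Psi> = (\<lambda>w. \<Sum>i<N. g i (\<lambda>k. w (i, k)))"
  have comp: "\<forall>k\<ge>m i. w (i, k) = 0" if "w \<in> coord_space J" for w :: "nat \<times> nat \<Rightarrow> 'k fls" and i
    using that by (auto simp: coord_space_def J_def)
  have gw_in: "g i (\<lambda>k. w (i, k)) \<in> U i" if "i < N" "w \<in> coord_space J" for i w
    by (rule g_in[OF that(1) comp[OF that(2)]])
  have \<Psi>_in: "\<Psi> w \<in> conn_space C" if "w \<in> coord_space J" for w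
    unfolding \<Psi>_def using gw_in[OF _ that] U(2) by (intro V.subspace_sum[OF sub]) auto
  have uniq: "\<exists>!u. (\<forall>i<N. u i \<in> U i) \<and> (\<forall>i\<ge>N. u i = 0) \<and> v = (\<Sum>i<N. u i)" if "v \<in> conn_space C" for v
    using dsum that by (auto simp: conn_direct_sum_def)
  have inj: "inj_on \<Psi> (coord_space J)"
  proof (rule inj_onI)
    fix v w assume v: "v \<in> coord_space J" and w: "w \<in> coord_space J" and eq: "\<Psi> v = \<Psi> w"
    define u where "u = (\<lambda>v i. if i < N then g i (\<lambda>k. v (i, k)) else 0)"
    have 1: "(\<forall>i<N. u v i \<in> U i) \<and> (\<forall>i\<ge>N. u v i = 0) \<and> \<Psi> v = (\<Sum>i<N. u v i)"
      using gw_in[OF _ v] by (auto simp: u_def \<Psi>_def)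
    have 2: "(\<forall>i<N. u w i \<in> U i) \<and> (\<forall>i\<ge>N. u w i = 0) \<and> \<Psi> v = (\<Sum>i<N. u w i)"
      unfolding eq using gw_in[OF _ w] by (auto simp: u_def \<Psi>_def)
    have "u v = u w" using uniq[OF \<Psi>_in[OF v]] 1 2 by blast
    have "v (i, k) = w (i, k)" if i: "i < N" for i k
    proof -
      have "g i (\<lambda>k. v (i, k)) = g i (\<lambda>k. w (i, k))"
        using fun_cong[OF \<open>u v = u w\<close>, of i] i by (simp add: u_def)
      from arg_cong[OF this, of "\<phi> i"] have "(\<lambda>k. v (i, k)) = (\<lambda>k. w (i, k))"
        unfolding \<phi>_g[OF i comp[OF v]] \<phi>_g[OF i comp[OF w]] .
      from fun_cong[OF this, of k] show ?thesis .
    qed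
    moreover have "v (i, k) = w (i, k)" if "\<not> i < N" for i k
      using v w that by (simp add: coord_space_def J_def)
    ultimately show "v = w" by (auto simp: fun_eq_iff)
  qed
  have surj: "\<exists>w\<in>coord_space J. v = \<Psi> w" if v: "v \<in> conn_space C" for v
  proof -
    obtain u where u: "\<forall>i<N. u i \<in> U i" "v = (\<Sum>i<N. u i)" using uniq[OF v] by blast
    define w where "w = (\<lambda>(i, k). if i < N then \<phi> i (u i) k else 0)"
    have "\<forall>k\<ge>m i. \<phi> i (u i) k = 0" if "i < N" for i
      using \<phi>(2)[OF that] u(1) that unfolding bij_betw_def by blast
    then have "w \<in> coord_space J" by (auto simp: w_def coord_space_def J_def)
    moreover have "v = \<Psi> w" unfolding u(2) \<Psi>_def using u(1)
      by (intro sum.cong refl) (simp add: w_def g_\<phi>)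
    ultimately show ?thesis by blast
  qed
  have bij: "bij_betw \<Psi> (coord_space J) (conn_space C)"
    unfolding bij_betw_def using inj \<Psi>_in surj by blast
  have add: "\<Psi> (v + w) = \<Psi> v + \<Psi> w" if v: "v \<in> coord_space J" and w: "w \<in> coord_space J" for v w
  proof -
    have "g i (\<lambda>k. (v + w) (i, k)) = g i (\<lambda>k. v (i, k)) + g i (\<lambda>k. w (i, k))" if i: "i < N" for i
    proof -
      have "\<phi> i (g i (\<lambda>k. v (i, k)) + g i (\<lambda>k. w (i, k))) = (\<lambda>k. v (i, k)) + (\<lambda>k. w (i, k))"
        using \<phi>_add[OF i gw_in[OF i v] gw_in[OF i w]] \<phi>_g[OF i comp[OF v]] \<phi>_g[OF i comp[OF w]] by simp
      also have "\<dots> = (\<lambda>k. (v + w) (i, k))" by (simp add: fun_eq_iff)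
      finally have eq: "\<phi> i (g i (\<lambda>k. v (i, k)) + g i (\<lambda>k. w (i, k))) = (\<lambda>k. (v + w) (i, k))" .
      show ?thesis
        using g_\<phi>[OF i V.subspace_add[OF U(1)[OF i] gw_in[OF i v] gw_in[OF i w]]] unfolding eq .
    qed
    then show ?thesis by (simp add: \<Psi>_def sum.distrib)
  qed
  have scale: "\<Psi> (coord_scale q h w) = conn_scale C h (\<Psi> w)" if w: "w \<in> coord_space J" for h w
  proof -
    have "g i (\<lambda>k. coord_scale q h w (i, k)) = conn_scale C h (g i (\<lambda>k. w (i, k)))" if i: "i < N" for i
    proof -
      have eq: "\<phi> i (conn_scale C h (g i (\<lambda>k. w (i, k)))) = (\<lambda>k. coord_scale q h w (i, k))"
        using \<phi>_scale[OF i gw_in[OF i w] gw_in[OF i w]] \<phi>_g[OF i comp[OF w]] by (simp add: coord_scale_def)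
      show ?thesis
        using g_\<phi>[OF i V.subspace_scale[OF U(1)[OF i] gw_in[OF i w], of h]] unfolding eq .
    qed
    then show ?thesis by (simp add: \<Psi>_def V.scale_sum_right)
  qed
  have nabla_0: "conn_nabla C 0 = 0"
    using nabla_add[of 0 0] V.subspace_0[OF sub] by simp
  have nabla_sum: "(\<Sum>i\<in>S. u i) \<in> conn_space C \<and> conn_nabla C (\<Sum>i\<in>S. u i) = (\<Sum>i\<in>S. conn_nabla C (u i))"
    if "finite S" "\<And>i. i \<in> S \<Longrightarrow> u i \<in> conn_space C" for S :: "nat set" and u
    using that
    by (induction S rule: finite_induct) (auto simp: nabla_0 nabla_add V.subspace_0[OF sub] V.subspace_add[OF sub])
  have nabla: "\<Psi> (coord_nabla f q J w) = conn_scale C fls_X (conn_nabla C (\<Psi> w))" if w: "w \<in> coord_space J" for w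
  proof -
    have *: "g i (\<lambda>k. coord_nabla f q J w (i, k)) = conn_scale C fls_X (conn_nabla C (g i (\<lambda>k. w (i, k))))"
      if i: "i < N" for i
    proof -
      let ?u = "g i (\<lambda>k. w (i, k))"
      have nu: "conn_nabla C ?u \<in> U i" using gw_in[OF i w] U(3)[OF i] by (simp add: nabla_stable_def)
      have "\<phi> i (conn_scale C fls_X (conn_nabla C ?u)) k = coord_nabla f q J w (i, k)" for k
      proof (cases "k < m i")
        case True
        have "w (i, Suc k) = 0" if "\<not> Suc k < m i" using comp[OF w, of i] that by auto
        with True show ?thesis
          using \<phi>_scale[OF i nu nu, of fls_X] \<phi>_nabla[OF i gw_in[OF i w] gw_in[OF i w]] \<phi>_g[OF i comp[OF w]] i
            fls_compose_power_X_mult_X_inv[OF qm[OF i], where 'a = 'k]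
          by (auto simp: tensor_J_E_nabla[OF qm[OF i]] coord_nabla_def J_def
              simp del: fls_compose_power_X fls_compose_power_X_inv simp flip: mult.assoc)
      next
        case False
        have "conn_scale C fls_X (conn_nabla C ?u) \<in> U i" using V.subspace_scale[OF U(1)[OF i] nu] .
        with bij_betwE[OF \<phi>(2)[OF i]]
        have "\<forall>k\<ge>m i. \<phi> i (conn_scale C fls_X (conn_nabla C ?u)) k = 0" by simp
        with False show ?thesis by (simp add: coord_nabla_def J_def)
      qed
      then have eq: "\<phi> i (conn_scale C fls_X (conn_nabla C ?u)) = (\<lambda>k. coord_nabla f q J w (i, k))" by blast
      show ?thesis using g_\<phi>[OF i V.subspace_scale[OF U(1)[OF i] nu, of fls_X]] unfolding eq .
    qed
    have "conn_nabla C (\<Psi> w) = (\<Sum>i<N. conn_nabla C (g i (\<lambda>k. w (i, k))))"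
      unfolding \<Psi>_def by (rule nabla_sum[THEN conjunct2]) (use gw_in[OF _ w] U(2) in auto)
    then show ?thesis by (simp add: \<Psi>_def V.scale_sum_right *)
  qed
  show ?thesis using bij add scale nabla by blast
qed

lemma coord_map_of_coordinates:
  fixes f f' :: "nat \<Rightarrow> 'k::field_char_0 fls"
  assumes "finite J" "finite J'" "\<And>j. j \<in> J \<Longrightarrow> 0 < q (fst j)" "\<And>j. j \<in> J' \<Longrightarrow> 0 < q' (fst j)"
    and \<Psi>: "bij_betw \<Psi> (coord_space J) V"
      "\<And>v w. v \<in> coord_space J \<Longrightarrow> w \<in> coord_space J \<Longrightarrow> \<Psi> (v + w) = \<Psi> v + \<Psi> w"
      "\<And>h w. w \<in> coord_space J \<Longrightarrow> \<Psi> (coord_scale q h w) = s h (\<Psi> w)"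
      "\<And>w. w \<in> coord_space J \<Longrightarrow> \<Psi> (coord_nabla f q J w) = D (\<Psi> w)"
    and \<Psi>': "bij_betw \<Psi>' (coord_space J') V"
      "\<And>v w. v \<in> coord_space J' \<Longrightarrow> w \<in> coord_space J' \<Longrightarrow> \<Psi>' (v + w) = \<Psi>' v + \<Psi>' w"
      "\<And>h w. w \<in> coord_space J' \<Longrightarrow> \<Psi>' (coord_scale q' h w) = s h (\<Psi>' w)"
      "\<And>w. w \<in> coord_space J' \<Longrightarrow> \<Psi>' (coord_nabla f' q' J' w) = D (\<Psi>' w)"
  shows "coord_map f f' q q' J J' (\<lambda>w. inv_into (coord_space J') \<Psi>' (\<Psi> w))"
proof
  let ?T = "\<lambda>w. inv_into (coord_space J') \<Psi>' (\<Psi> w)"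
  have T: "?T w \<in> coord_space J'" "\<Psi>' (?T w) = \<Psi> w" if "w \<in> coord_space J" for w
    using \<Psi>(1) \<Psi>'(1) that by (auto simp: bij_betw_def inv_into_into f_inv_into_f)
  have eqI: "?T w = u" if "u \<in> coord_space J'" "\<Psi> w = \<Psi>' u" for u w
    using \<Psi>'(1) that by (simp add: bij_betw_inv_into_left)
  show "?T w \<in> coord_space J'" if "w \<in> coord_space J" for w by (rule T(1)[OF that])
  show "?T (v + w) = ?T v + ?T w" if "v \<in> coord_space J" "w \<in> coord_space J" for v w
    using that T by (intro eqI coord_space_add) (auto simp: \<Psi>(2) \<Psi>'(2))
  show "?T (coord_scale q h w) = coord_scale q' h (?T w)" if "w \<in> coord_space J" for h w
    using that T by (intro eqI coord_space_scale) (auto simp: \<Psi>(3) \<Psi>'(3))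
  show "?T (coord_nabla f q J w) = coord_nabla f' q' J' (?T w)" if "w \<in> coord_space J" for w
  proof (rule eqI)
    show "coord_nabla f' q' J' (?T w) \<in> coord_space J'" by (simp add: coord_nabla_def coord_space_def)
    show "\<Psi> (coord_nabla f q J w) = \<Psi>' (coord_nabla f' q' J' (?T w))"
      using that T by (simp add: \<Psi>(4) \<Psi>'(4))
  qed
qed (use assms in auto)

lemma HTL_pole_order_sum:
  fixes f :: "nat \<Rightarrow> 'k::field_char_0 fls"
  shows "(\<Sum>j\<in>(SIGMA i:{..<N}. {..<m i}). pole_order (f (fst j))) = (\<Sum>i<N. int (m i) * pole_order (f i))"
  using sum.Sigma[of "{..<N}" "\<lambda>i. {..<m i}" "\<lambda>i k. pole_order (f i)"] by (simp add: case_prod_beta)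

text \<open>The two coordinate systems differ by mutually inverse horizontal maps, and growth is
  compared in both directions.\<close>

theorem HTL_irregularity_unique:
  fixes C :: "('k::field_char_0, 'v::ab_group_add) conn"
  assumes C: "linear_space C"
    and HTL: "HTL_decomposition C N f q m" and HTL': "HTL_decomposition C N' f' q' m'"
  shows "(\<Sum>i<N. int (m i) * pole_order (f i)) = (\<Sum>i<N'. int (m' i) * pole_order (f' i))"
proof -
  define J where "J = (SIGMA i:{..<N}. {..<m i})"
  define J' where "J' = (SIGMA i:{..<N'}. {..<m' i})"
  obtain \<Psi> where \<Psi>: "bij_betw \<Psi> (coord_space J) (conn_space C)"
      "\<forall>v\<in>coord_space J. \<forall>w\<in>coord_space J. \<Psi> (v + w) = \<Psi> v + \<Psi> w"
      "\<forall>h. \<forall>w\<in>coord_space J. \<Psi> (coord_scale q h w) = conn_scale C h (\<Psi> w)"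
      "\<forall>w\<in>coord_space J. \<Psi> (coord_nabla f q J w) = conn_scale C fls_X (conn_nabla C (\<Psi> w))"
    using HTL_coordinates[OF C HTL] unfolding J_def by blast
  obtain \<Psi>' where \<Psi>': "bij_betw \<Psi>' (coord_space J') (conn_space C)"
      "\<forall>v\<in>coord_space J'. \<forall>w\<in>coord_space J'. \<Psi>' (v + w) = \<Psi>' v + \<Psi>' w"
      "\<forall>h. \<forall>w\<in>coord_space J'. \<Psi>' (coord_scale q' h w) = conn_scale C h (\<Psi>' w)"
      "\<forall>w\<in>coord_space J'. \<Psi>' (coord_nabla f' q' J' w) = conn_scale C fls_X (conn_nabla C (\<Psi>' w))"
    using HTL_coordinates[OF C HTL'] unfolding J'_def by blast
  have fin: "finite J" "finite J'"
    and pos: "\<And>j. j \<in> J \<Longrightarrow> 0 < q (fst j)" "\<And>j. j \<in> J' \<Longrightarrow> 0 < q' (fst j)"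
    using HTL HTL' by (auto simp: J_def J'_def HTL_decomposition_def)
  let ?T = "\<lambda>w. inv_into (coord_space J') \<Psi>' (\<Psi> w)" and ?T' = "\<lambda>w. inv_into (coord_space J) \<Psi> (\<Psi>' w)"
  have 1: "coord_map f f' q q' J J' ?T"
    by (rule coord_map_of_coordinates[where s = "conn_scale C" and D = "\<lambda>v. conn_scale C fls_X (conn_nabla C v)"])
      (use fin pos \<Psi> \<Psi>' in auto)
  have 2: "coord_map f' f q' q J' J ?T'"
    by (rule coord_map_of_coordinates[where s = "conn_scale C" and D = "\<lambda>v. conn_scale C fls_X (conn_nabla C v)"])
      (use fin pos \<Psi> \<Psi>' in auto)
  have 3: "?T' (?T w) = w" if "w \<in> coord_space J" for w
    using bij_betwE[OF \<Psi>(1)] that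
    by (simp add: bij_betw_inv_into_left[OF \<Psi>(1)] bij_betw_inv_into_right[OF \<Psi>'(1)])
  have 4: "?T (?T' w) = w" if "w \<in> coord_space J'" for w
    using bij_betwE[OF \<Psi>'(1)] that
    by (simp add: bij_betw_inv_into_left[OF \<Psi>'(1)] bij_betw_inv_into_right[OF \<Psi>(1)])
  from coord_iso_pole_order_sum_eq[OF 1 2 3 4] show ?thesis
    by (simp add: J_def J'_def HTL_pole_order_sum)
qed

text \<open>Uniqueness lets the definite description denote; in each summand q_i cancels the
  denominator of the order and leaves the integer \<open>pole_order\<close>.\<close>

lemma irregularity_eq:
  fixes C :: "('k::field_char_0, 'v::ab_group_add) conn"
  assumes C: "linear_space C" and HTL: "HTL_decomposition C N f q m"
  shows "irregularity C = of_int (\<Sum>i<N. int (m i) * pole_order (f i))"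
proof -
  have *: "(\<Sum>i<N. of_nat (m i) * of_nat (q i) * max 0 (- puiseux_ord (q i) (f i)))
      = (of_int (\<Sum>i<N. int (m i) * pole_order (f i)) :: rat)"
    if "HTL_decomposition C N f q m" for N f q m
  proof -
    have key: "of_nat (m i) * of_nat (q i) * max 0 (- puiseux_ord (q i) (f i)) = (of_int (int (m i) * pole_order (f i)) :: rat)"
      if "i < N" for i
    proof -
      have "0 < q i" using \<open>HTL_decomposition C N f q m\<close> that by (auto simp: HTL_decomposition_def)
      then have "of_nat (q i) * max 0 (- puiseux_ord (q i) (f i)) = (of_int (pole_order (f i)) :: rat)"
        by (auto simp: puiseux_ord_def pole_order_def max_def field_simps)
      then show ?thesis by (simp add: mult.assoc)
    qed
    show ?thesis unfolding of_int_sum by (intro sum.cong refl key) simp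
  qed
  show ?thesis
    unfolding irregularity_def
  proof (rule the_equality)
    show "\<exists>n f' q' m'. HTL_decomposition C n f' q' m' \<and>
        (of_int (\<Sum>i<N. int (m i) * pole_order (f i)) :: rat) =
        (\<Sum>i<n. of_nat (m' i) * of_nat (q' i) * max 0 (- puiseux_ord (q' i) (f' i)))"
      by (intro exI[of _ N] exI[of _ f] exI[of _ q] exI[of _ m] conjI HTL *[OF HTL, symmetric])
  next
    fix r :: rat
    assume "\<exists>n f' q' m'. HTL_decomposition C n f' q' m' \<and>
        r = (\<Sum>i<n. of_nat (m' i) * of_nat (q' i) * max 0 (- puiseux_ord (q' i) (f' i)))"
    then obtain n f' q' m' where HTL': "HTL_decomposition C n f' q' m'"
      and r: "r = (\<Sum>i<n. of_nat (m' i) * of_nat (q' i) * max 0 (- puiseux_ord (q' i) (f' i)))" by blast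
    show "r = of_int (\<Sum>i<N. int (m i) * pole_order (f i))"
      unfolding r *[OF HTL'] HTL_irregularity_unique[OF C HTL HTL'] ..
  qed
qed

section \<open>Decomposition of \<open>E\<^bsub>h,N\<^esub>\<close>\<close>

text \<open>Injections and projections, unlike the subspaces of \<open>conn_direct_sum\<close>,
  compose when a summand is decomposed further. Only additivity is asked of the projections: their
  linearity follows from the injections and the identities between both.\<close>

definition elementary_biproduct ::
    "('k::field, 'v::ab_group_add) conn \<Rightarrow> 'i set \<Rightarrow> ('i \<Rightarrow> 'k fls) \<Rightarrow> ('i \<Rightarrow> nat) \<Rightarrow>
      ('i \<Rightarrow> 'k fls \<Rightarrow> 'v) \<Rightarrow> ('i \<Rightarrow> 'v \<Rightarrow> 'k fls) \<Rightarrow> bool" where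
  "elementary_biproduct C I f q \<iota> \<pi> \<longleftrightarrow>
     finite I \<and> (\<forall>i\<in>I. 0 < q i \<and> conn_morphism (E_conn (f i) (q i)) C (\<iota> i)) \<and>
     (\<forall>i\<in>I. \<forall>v\<in>conn_space C. \<forall>w\<in>conn_space C. \<pi> i (v + w) = \<pi> i v + \<pi> i w) \<and>
     (\<forall>i\<in>I. \<forall>j\<in>I. \<forall>w. \<pi> i (\<iota> j w) = (if i = j then w else 0)) \<and>
     (\<forall>v\<in>conn_space C. v = (\<Sum>i\<in>I. \<iota> i (\<pi> i v)))"

lemma conn_morphismI_E:
  assumes "\<And>v. \<phi> v \<in> conn_space C" "\<And>v w. \<phi> (v + w) = \<phi> v + \<phi> w"
    "\<And>h v. \<phi> (fls_compose_power h q * v) = conn_scale C h (\<phi> v)"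
    "\<And>v. \<phi> (conn_nabla (E_conn f q) v) = conn_nabla C (\<phi> v)"
  shows "conn_morphism (E_conn f q) C \<phi>"
  using assms by (simp add: conn_morphism_def conn_linear_def)

lemma conn_morphism_E_D:
  assumes "conn_morphism (E_conn f q) C \<phi>"
  shows "\<phi> v \<in> conn_space C" "\<phi> (v + w) = \<phi> v + \<phi> w" "\<phi> (fls_compose_power h q * v) = conn_scale C h (\<phi> v)"
    "\<phi> (conn_nabla (E_conn f q) v) = conn_nabla C (\<phi> v)" "\<phi> 0 = 0"
  using assms unfolding conn_morphism_def conn_linear_def by (auto dest: spec[of _ 0])

lemma conn_morphism_E_sum:
  assumes "conn_morphism (E_conn f q) C \<phi>"
  shows "\<phi> (\<Sum>i\<in>S. v i) = (\<Sum>i\<in>S. \<phi> (v i))"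
  by (induction S rule: infinite_finite_induct) (simp_all add: conn_morphism_E_D[OF assms])

lemma elementary_biproduct_trans:
  assumes C: "elementary_biproduct C I f q \<iota> \<pi>"
    and E: "\<And>i. i \<in> I \<Longrightarrow> elementary_biproduct (E_conn (f i) (q i)) (K i) (f' i) (q' i) (\<iota>' i) (\<pi>' i)"
  shows "elementary_biproduct C (Sigma I K) (\<lambda>(i, k). f' i k) (\<lambda>(i, k). q' i k)
    (\<lambda>(i, k). \<iota> i \<circ> \<iota>' i k) (\<lambda>(i, k). \<pi>' i k \<circ> \<pi> i)"
proof -
  have \<iota>: "conn_morphism (E_conn (f i) (q i)) C (\<iota> i)" if "i \<in> I" for i
    using C that by (simp add: elementary_biproduct_def)
  have \<iota>': "conn_morphism (E_conn (f' i k) (q' i k)) (E_conn (f i) (q i)) (\<iota>' i k)" if "i \<in> I" "k \<in> K i" for i k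
    using E[OF that(1)] that by (simp add: elementary_biproduct_def)
  have fin: "finite I" "\<And>i. i \<in> I \<Longrightarrow> finite (K i)"
    using C E by (auto simp: elementary_biproduct_def)
  have \<pi>'_add: "\<pi>' i k (v + w) = \<pi>' i k v + \<pi>' i k w" if "i \<in> I" "k \<in> K i" for i k v w
    using E[OF that(1)] that by (simp add: elementary_biproduct_def)
  have \<pi>'_0: "\<pi>' i k 0 = 0" if "i \<in> I" "k \<in> K i" for i k
    using \<pi>'_add[OF that, of 0 0] by (metis add_0 add_cancel_right_right)
  have "conn_morphism (E_conn (f' i k) (q' i k)) C (\<iota> i \<circ> \<iota>' i k)" if "i \<in> I" "k \<in> K i" for i k
    using conn_morphism_E_D[OF \<iota>[OF that(1)]] conn_morphism_E_D[OF \<iota>'[OF that]]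
    by (intro conn_morphismI_E) auto
  moreover have "v = (\<Sum>(i, k)\<in>Sigma I K. \<iota> i (\<iota>' i k (\<pi>' i k (\<pi> i v))))" if v: "v \<in> conn_space C" for v
  proof -
    have "v = (\<Sum>i\<in>I. \<iota> i (\<pi> i v))" using C v by (simp add: elementary_biproduct_def)
    also have "\<dots> = (\<Sum>i\<in>I. \<iota> i (\<Sum>k\<in>K i. \<iota>' i k (\<pi>' i k (\<pi> i v))))"
    proof (intro sum.cong refl)
      fix i assume "i \<in> I"
      from E[OF this] have "\<pi> i v = (\<Sum>k\<in>K i. \<iota>' i k (\<pi>' i k (\<pi> i v)))"
        by (simp add: elementary_biproduct_def)
      then show "\<iota> i (\<pi> i v) = \<iota> i (\<Sum>k\<in>K i. \<iota>' i k (\<pi>' i k (\<pi> i v)))" by simp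
    qed
    also have "\<dots> = (\<Sum>i\<in>I. \<Sum>k\<in>K i. \<iota> i (\<iota>' i k (\<pi>' i k (\<pi> i v))))"
      by (intro sum.cong refl conn_morphism_E_sum[OF \<iota>])
    also have "\<dots> = (\<Sum>(i, k)\<in>Sigma I K. \<iota> i (\<iota>' i k (\<pi>' i k (\<pi> i v))))"
      by (rule sum.Sigma) (use fin in auto)
    finally show ?thesis .
  qed
  moreover have "\<pi>' i k (\<pi> i (\<iota> j (\<iota>' j l w))) = (if (i, k) = (j, l) then w else 0)"
    if "i \<in> I" "j \<in> I" "k \<in> K i" "l \<in> K j" for i j k l w
    using that C E[OF that(1)] \<pi>'_0 by (auto simp: elementary_biproduct_def)
  moreover have "\<pi>' i k (\<pi> i (v + w)) = \<pi>' i k (\<pi> i v) + \<pi>' i k (\<pi> i w)"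
    if "i \<in> I" "k \<in> K i" "v \<in> conn_space C" "w \<in> conn_space C" for i k v w
    using that C \<pi>'_add[OF that(1,2)] by (simp add: elementary_biproduct_def)
  moreover have "0 < q' i k" if "i \<in> I" "k \<in> K i" for i k
    using E[OF that(1)] that by (simp add: elementary_biproduct_def)
  ultimately show ?thesis
    unfolding elementary_biproduct_def using fin by (auto simp: case_prod_beta')
qed

text \<open>The images of the injections are the summands, all with Jordan blocks of size 1; the
  projections provide the inverse isomorphisms and the uniqueness of components.\<close>

lemma HTL_of_biproduct:
  fixes C :: "('k::field_char_0, 'v::ab_group_add) conn"
  assumes C: "linear_space C" and bi: "elementary_biproduct C I f q \<iota> \<pi>"
    and cls: "\<And>i. i \<in> I \<Longrightarrow> R_class (q i) (f i) \<in> R_o (q i)"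
  shows "irregularity C = of_int (\<Sum>i\<in>I. pole_order (f i))"
proof -
  interpret V: vector_space "conn_scale C" using C by (simp add: linear_space_def)
  have sub: "V.subspace (conn_space C)" using C by (simp add: linear_space_def)
  have fin: "finite I" and qpos: "\<And>i. i \<in> I \<Longrightarrow> 0 < q i"
    and \<iota>: "\<And>i. i \<in> I \<Longrightarrow> conn_morphism (E_conn (f i) (q i)) C (\<iota> i)"
    and \<pi>_add: "\<And>i v w. i \<in> I \<Longrightarrow> v \<in> conn_space C \<Longrightarrow> w \<in> conn_space C \<Longrightarrow> \<pi> i (v + w) = \<pi> i v + \<pi> i w"
    and \<pi>_\<iota>: "\<And>i j w. i \<in> I \<Longrightarrow> j \<in> I \<Longrightarrow> \<pi> i (\<iota> j w) = (if i = j then w else 0)"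
    and expand: "\<And>v. v \<in> conn_space C \<Longrightarrow> v = (\<Sum>i\<in>I. \<iota> i (\<pi> i v))"
    using bi by (auto simp: elementary_biproduct_def)
  define N where "N = card I"
  obtain h where h: "bij_betw h {..<N} I"
    using ex_bij_betw_nat_finite[OF fin] unfolding N_def lessThan_atLeast0 by blast
  have hI: "h n \<in> I" if "n < N" for n using h that by (auto simp: bij_betw_def)
  have h_inj: "h n = h n' \<longleftrightarrow> n = n'" if "n < N" "n' < N" for n n'
    using h that by (auto simp: bij_betw_def inj_on_def)
  have \<pi>_sum: "(\<Sum>s\<in>S. u s) \<in> conn_space C \<and> \<pi> i (\<Sum>s\<in>S. u s) = (\<Sum>s\<in>S. \<pi> i (u s))"
    if "i \<in> I" "finite S" "\<And>s. s \<in> S \<Longrightarrow> u s \<in> conn_space C" for i and S :: "nat set" and u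
    using that(2,3)
  proof (induction S rule: finite_induct)
    case empty
    then show ?case using \<pi>_add[OF that(1), of 0 0] V.subspace_0[OF sub] by simp
  qed (auto simp: \<pi>_add[OF that(1)] V.subspace_add[OF sub])
  define U where "U = (\<lambda>n. range (\<iota> (h n)))"
  note D = conn_morphism_E_D[OF \<iota>]
  have "conn_subspace C (U n) \<and> nabla_stable C (U n)" if n: "n < N" for n
  proof
    have "V.subspace (U n)"
      unfolding V.subspace_def U_def
      using D(5)[OF hI[OF n]] by (auto simp: D(2)[OF hI[OF n], symmetric] D(3)[OF hI[OF n], symmetric] image_iff)
    then show "conn_subspace C (U n)"
      using D(1)[OF hI[OF n]] by (auto simp: conn_subspace_def U_def)
    show "nabla_stable C (U n)"
      using D(4)[OF hI[OF n], symmetric] by (auto simp: nabla_stable_def U_def)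
  qed
  moreover have "\<exists>!u. (\<forall>n<N. u n \<in> U n) \<and> (\<forall>n\<ge>N. u n = 0) \<and> v = (\<Sum>n<N. u n)" if v: "v \<in> conn_space C" for v
  proof (rule ex1I)
    define u where "u = (\<lambda>n. if n < N then \<iota> (h n) (\<pi> (h n) v) else 0)"
    have "v = (\<Sum>n<N. \<iota> (h n) (\<pi> (h n) v))"
      using expand[OF v] sum.reindex_bij_betw[OF h, of "\<lambda>i. \<iota> i (\<pi> i v)"] by simp
    then show "(\<forall>n<N. u n \<in> U n) \<and> (\<forall>n\<ge>N. u n = 0) \<and> v = (\<Sum>n<N. u n)"
      by (simp add: u_def U_def)
  next
    fix u assume u: "(\<forall>n<N. u n \<in> U n) \<and> (\<forall>n\<ge>N. u n = 0) \<and> v = (\<Sum>n<N. u n)"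
    show "u = (\<lambda>n. if n < N then \<iota> (h n) (\<pi> (h n) v) else 0)"
    proof
      fix n
      show "u n = (if n < N then \<iota> (h n) (\<pi> (h n) v) else 0)"
      proof (cases "n < N")
        case True
        obtain w where w: "\<And>n. n < N \<Longrightarrow> u n = \<iota> (h n) (w n)"
          using u unfolding U_def image_iff by metis
        \<comment> \<open>Applying one projection to any representation of v annihilates all
          components but one and so determines that component.\<close>
        have "\<pi> (h n) v = (\<Sum>n'<N. \<pi> (h n) (u n'))"
          using u w D(1)[OF hI] by (auto intro: \<pi>_sum[OF hI[OF True], THEN conjunct2])
        also have "\<dots> = (\<Sum>n'<N. if n' = n then w n else 0)"
          using True by (intro sum.cong refl) (auto simp: w \<pi>_\<iota> hI h_inj)
        also have "\<dots> = w n" using True by simp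
        finally show ?thesis using True w by simp
      qed (use u in auto)
    qed
  qed
  ultimately have "conn_direct_sum C N U" by (auto simp: conn_direct_sum_def)
  moreover have "conn_isomorphic (C\<lparr>conn_space := U n\<rparr>) (tensor_J (E_conn (f (h n)) (q (h n))) 1)" if n: "n < N" for n
    unfolding conn_isomorphic_def
  proof (intro exI conjI)
    \<comment> \<open>The tensor product with J_1 consists of the families supported at index
      0.\<close>
    let ?\<phi> = "\<lambda>v k. if k = (0::nat) then \<pi> (h n) v else 0"
    have \<pi>\<iota>: "\<pi> (h n) (\<iota> (h n) w) = w" for w using \<pi>_\<iota> hI[OF n] by simp
    have nab: "?\<phi> (conn_nabla C (\<iota> (h n) w)) = conn_nabla (tensor_J (E_conn (f (h n)) (q (h n))) 1) (?\<phi> (\<iota> (h n) w))" for w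
    proof
      fix k
      have nil: "conn_nabla (tensor_J (E_conn (f (h n)) (q (h n))) 1) w' k = 0" if "k > 0" for w' k
        using that by (simp add: tensor_J_def tensor_conn_def)
      show "?\<phi> (conn_nabla C (\<iota> (h n) w)) k = conn_nabla (tensor_J (E_conn (f (h n)) (q (h n))) 1) (?\<phi> (\<iota> (h n) w)) k"
      proof (cases "k = 0")
        case True
        then show ?thesis
          using qpos[OF hI[OF n]]
          by (simp add: tensor_J_E_nabla D(4)[OF hI[OF n], symmetric] \<pi>\<iota> E_conn_nabla
              del: fls_compose_power_X_inv)
      qed (use nil in auto)
    qed
    have "conn_linear (C\<lparr>conn_space := U n\<rparr>) (tensor_J (E_conn (f (h n)) (q (h n))) 1) ?\<phi>"
      unfolding conn_linear_def
      using \<pi>_add[OF hI[OF n]] D(1)[OF hI[OF n]]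
      by (auto simp: U_def fun_eq_iff \<pi>\<iota> D(3)[OF hI[OF n], symmetric])
    then show "conn_morphism (C\<lparr>conn_space := U n\<rparr>) (tensor_J (E_conn (f (h n)) (q (h n))) 1) ?\<phi>"
      unfolding conn_morphism_def using nab by (simp add: U_def cong: if_cong)
    show "bij_betw ?\<phi> (conn_space (C\<lparr>conn_space := U n\<rparr>)) (conn_space (tensor_J (E_conn (f (h n)) (q (h n))) 1))"
      unfolding bij_betw_def
    proof
      show "inj_on ?\<phi> (conn_space (C\<lparr>conn_space := U n\<rparr>))"
        by (rule inj_onI) (auto simp: U_def \<pi>\<iota> dest: fun_cong[of _ _ 0])
      have "w \<in> ?\<phi> ` U n" if "\<forall>k\<ge>1. w k = 0" for w :: "nat \<Rightarrow> 'k fls"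
      proof
        show "w = ?\<phi> (\<iota> (h n) (w 0))" using that by (auto simp: \<pi>\<iota> fun_eq_iff)
      qed (simp add: U_def)
      then show "?\<phi> ` conn_space (C\<lparr>conn_space := U n\<rparr>) = conn_space (tensor_J (E_conn (f (h n)) (q (h n))) 1)"
        by auto
    qed
  qed
  ultimately have "HTL_decomposition C N (\<lambda>n. f (h n)) (\<lambda>n. q (h n)) (\<lambda>n. 1)"
    unfolding HTL_decomposition_def using qpos hI cls by auto
  from irregularity_eq[OF C this] show ?thesis
    using sum.reindex_bij_betw[OF h, of "\<lambda>i. pole_order (f i)"] by simp
qed

text \<open>A change of representative does not affect negative exponents, and exponent 0 lies in
  every K((x^(1/r))). Hence only polar exponents can obstruct a representative in a smaller field,
  and n/q is in (1/r)Z exactly if q divides n r.\<close>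

lemma R_o_iff:
  fixes f :: "'k::field_char_0 fls"
  assumes "0 < q"
  shows "R_class q f \<in> R_o q \<longleftrightarrow>
    (\<forall>r. 0 < r \<and> r < q \<longrightarrow> (\<exists>n<0. f $$ n \<noteq> 0 \<and> \<not> int q dvd n * int r))"
proof -
  have sub_iff: "h \<in> puiseux_sub q r \<longleftrightarrow> (\<forall>n. h $$ n \<noteq> 0 \<longrightarrow> int q dvd n * int r)" if "0 < r" for h :: "'k fls" and r
  proof -
    have "rat_of_int n / of_nat q = of_int k / of_nat r \<longleftrightarrow> n * int r = int q * k" for n k
    proof -
      have "rat_of_int n / of_nat q = of_int k / of_nat r \<longleftrightarrow> rat_of_int (n * int r) = of_int (int q * k)"
        using assms that by (simp add: field_simps)
      then show ?thesis by (simp only: of_int_eq_iff)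
    qed
    then show ?thesis by (simp add: puiseux_sub_def dvd_def)
  qed
  have "R_class q f \<in> UNIV // R_rel q" by (auto simp: R_class_def quotient_def)
  moreover have "R_class q f \<inter> puiseux_sub q r = {} \<longleftrightarrow> (\<exists>n<0. f $$ n \<noteq> 0 \<and> \<not> int q dvd n * int r)"
    if r: "0 < r" for r
  proof
    assume *: "\<exists>n<0. f $$ n \<noteq> 0 \<and> \<not> int q dvd n * int r"
    have "g $$ n = f $$ n" if "g \<in> R_class q f" "n < 0" for g n
    proof -
      have "(f, g) \<in> R_rel q" using that(1) by (simp add: R_class_def)
      then obtain u m where "f - g = fls_X * fps_to_fls u + fls_const (of_int m / of_nat q)"
        unfolding R_rel_def by blast
      from arg_cong[OF this, of "\<lambda>h. h $$ n"] that(2) show ?thesis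
        by (simp add: fls_X_times_conv_shift)
    qed
    with * show "R_class q f \<inter> puiseux_sub q r = {}" using sub_iff[OF r] by (metis IntE equals0I)
  next
    assume *: "R_class q f \<inter> puiseux_sub q r = {}"
    \<comment> \<open>The truncation g of f to exponents at most 0 is the representative with the
      fewest possible obstructions.\<close>
    define u where "u = fps_shift 1 (fls_regpart f)"
    define g where "g = f - fls_X * fps_to_fls u"
    have "f - g = fls_X * fps_to_fls u + fls_const (of_int 0 / of_nat q)" by (simp add: g_def)
    then have "g \<in> R_class q f" unfolding R_class_def R_rel_def by blast
    with * have "g \<notin> puiseux_sub q r" by blast
    then obtain n where n: "g $$ n \<noteq> 0" "\<not> int q dvd n * int r" using sub_iff[OF r] by blast
    have g_nth: "g $$ n = (if n \<le> 0 then f $$ n else 0)" for n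
      by (simp add: g_def u_def fls_X_times_conv_shift)
    have "n \<noteq> 0" using n(2) by auto
    moreover have "n \<le> 0" "f $$ n \<noteq> 0" using n(1) unfolding g_nth by (auto split: if_splits)
    ultimately show "\<exists>n<0. f $$ n \<noteq> 0 \<and> \<not> int q dvd n * int r"
      using n(2) by (intro exI[of _ n]) auto
  qed
  ultimately show ?thesis unfolding R_o_def by auto
qed

text \<open>
  If \<open>s\<close> is the greatest common divisor of \<open>N\<close> and the pole exponents of \<open>h\<close>, then a unit \<open>e\<close> removes the
  part of positive order of \<open>h\<close> and \<open>K((u)) = \<Oplus>\<^bsub>k<s\<^esub> e u\<^sup>k K((u\<^sup>s))\<close> splits \<open>E\<^bsub>h,N\<^esub>\<close> into connections
  \<open>E\<^bsub>h' + k/N, N/s\<^esub>\<close>, each of which is irreducible.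
\<close>

lemma E_conn_biproduct:
  fixes h :: "'k::field_char_0 fls"
  assumes N: "0 < N"
  shows "\<exists>s r f \<iota> \<pi>. elementary_biproduct (E_conn h N) {..<s::nat} f (\<lambda>_. r) \<iota> \<pi> \<and>
    (\<forall>k<s. R_class r (f k) \<in> R_o r) \<and> (\<Sum>k<s. pole_order (f k)) = pole_order h"
proof -
  \<comment> \<open>Including N makes s divide N; if h has no pole, it gives s = N and summands with
    r = 1.\<close>
  define A where "A = insert (int N) {n. n < 0 \<and> h $$ n \<noteq> 0}"
  define s where "s = nat (Gcd A)"
  have Gcd_pos: "0 < Gcd A"
  proof -
    have "Gcd A \<noteq> 0" using N by (auto simp: A_def Gcd_0_iff)
    then show ?thesis using Gcd_int_greater_eq_0[of A] by linarith
  qed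
  then have s_pos: "0 < s" and int_s: "int s = Gcd A" by (simp_all add: s_def)
  have "int s dvd int N" unfolding int_s by (rule Gcd_dvd) (simp add: A_def)
  then have "s dvd N" by simp
  then obtain r where r: "N = s * r" by blast
  have r_pos: "0 < r" using N r by auto
  \<comment> \<open>The unit e removes hp. In the remaining h0 all exponents are divisible by s, so
    it is a series in u^s.\<close>
  define hp where "hp = fls_X * fps_to_fls (fps_shift 1 (fls_regpart h))"
  define h0 where "h0 = h - hp"
  have hp_nth: "hp $$ n = (if 0 < n then h $$ n else 0)" for n
    by (auto simp: hp_def fls_X_times_conv_shift)
  have h0_nth: "h0 $$ n = (if n \<le> 0 then h $$ n else 0)" for n by (simp add: h0_def hp_nth)
  have "int s dvd n" if "h0 $$ n \<noteq> 0" for n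
  proof (cases "n = 0")
    case False
    with that have "n \<in> A" by (auto simp: A_def h0_nth split: if_splits)
    then show ?thesis unfolding int_s by (rule Gcd_dvd)
  qed simp
  define g where "g = fls_section s h0"
  have g: "fls_compose_power g s = h0"
    unfolding g_def by (rule fls_compose_power_section) fact+
  have "fls_vanishes_below 1 (- hp)" by (auto simp: fls_vanishes_below_def hp_nth)
  from exists_exponential[OF N this] obtain e where e: "e \<noteq> 0"
    "fls_const (1 / of_nat N) * fls_theta e = - hp * e" by blast
  \<comment> \<open>The constant k/N is the eigenvalue of x d/dx on u^k = x^(k/N).\<close>
  define f where "f = (\<lambda>k. g + fls_const (of_nat k / of_nat N))"
  define \<iota> where "\<iota> = (\<lambda>k w. e * (fls_X_intpow (int k) * fls_compose_power w s))"
  define \<pi> where "\<pi> = (\<lambda>k v. fls_section s (fls_X_intpow (- int k) * (v / e)))"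
  have log: "log_nabla h N (\<iota> k w) = \<iota> k (log_nabla (f k) r w)" for k w
  proof -
    let ?c = "fls_const (1 / of_nat N) :: 'k fls" and ?u = "fls_X_intpow (int k) :: 'k fls"
    let ?w = "fls_compose_power w s"
    have 1: "?c * fls_theta ?u = fls_const (of_nat k / of_nat N) * ?u"
      unfolding fls_theta_X_intpow by (simp add: fls_of_nat mult.assoc flip: mult.assoc)
    have 2: "?c * fls_theta ?w = fls_compose_power (fls_const (1 / of_nat r) * fls_theta w) s"
    proof -
      have "?c * of_nat s = (fls_const (1 / of_nat r) :: 'k fls)"
        using r s_pos r_pos by (simp add: fls_of_nat)
      then show ?thesis using s_pos by (simp add: fls_theta_compose_power mult.assoc flip: mult.assoc)
    qed
    have "log_nabla h N (\<iota> k w)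
        = (?c * fls_theta e) * (?u * ?w) + e * ((?c * fls_theta ?u) * ?w + ?u * (?c * fls_theta ?w)) + h * (e * (?u * ?w))"
      by (simp add: log_nabla_def \<iota>_def fls_theta_mult algebra_simps)
    also have "\<dots> = e * (?u * (fls_compose_power (fls_const (1 / of_nat r) * fls_theta w) s
        + (h0 + fls_const (of_nat k / of_nat N)) * ?w))"
      unfolding e(2) 1 2 h0_def by (simp add: algebra_simps)
    also have "h0 + fls_const (of_nat k / of_nat N) = fls_compose_power (f k) s"
      using s_pos by (simp add: f_def g)
    finally show ?thesis by (simp add: \<iota>_def log_nabla_def)
  qed
  have \<iota>_scale: "\<iota> k (fls_compose_power a r * w) = fls_compose_power a N * \<iota> k w" for k a w
    using r_pos s_pos
    by (simp add: \<iota>_def r fls_compose_power_compose_power mult.commute mult.left_commute)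
  have "conn_morphism (E_conn (f k) r) (E_conn h N) (\<iota> k)" for k
  proof (rule conn_morphismI_E)
    show "\<iota> k (conn_nabla (E_conn (f k) r) v) = conn_nabla (E_conn h N) (\<iota> k v)" for v
      unfolding E_conn_nabla[OF N] E_conn_nabla[OF r_pos] \<iota>_scale log ..
  qed (use \<iota>_scale in \<open>auto simp: \<iota>_def distrib_left\<close>)
  moreover have "\<pi> k (v + w) = \<pi> k v + \<pi> k w" for k v w
    using s_pos by (simp add: \<pi>_def add_divide_distrib distrib_left fls_section_add)
  moreover have "\<pi> k (\<iota> l w) = (if k = l then w else 0)" if "k < s" "l < s" for k l w
  proof -
    have "fls_X_intpow (- int k) * (\<iota> l w / e) = fls_compose_power w s * fls_X_intpow (int l - int k)"
    proof -
      have 1: "\<iota> l w / e = fls_X_intpow (int l) * fls_compose_power w s" using e(1) by (simp add: \<iota>_def)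
      have 2: "fls_X_intpow (- int k) * fls_X_intpow (int l) = (fls_X_intpow (int l - int k) :: 'k fls)"
        unfolding fls_X_intpow_times_fls_X_intpow by simp
      show ?thesis unfolding 1 mult.assoc[symmetric] 2 by (rule mult.commute)
    qed
    then have "\<pi> k (\<iota> l w) = w * fls_section s (fls_X_intpow (int l - int k))"
      using s_pos by (simp only: \<pi>_def fls_section_mult)
    moreover have "int s dvd int l - int k \<longleftrightarrow> k = l"
    proof -
      have "int s dvd int l - int k \<longleftrightarrow> int l mod int s = int k mod int s" by (simp add: mod_eq_dvd_iff)
      then show ?thesis using that by auto
    qed
    ultimately have "fls_section s (fls_X_intpow (int l - int k)) = (if k = l then 1 else (0 :: 'k fls))"
      unfolding fls_section_X_intpow[OF s_pos] by simp
    with \<open>\<pi> k (\<iota> l w) = _\<close> show ?thesis by simp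
  qed
  moreover have "v = (\<Sum>k<s. \<iota> k (\<pi> k v))" for v
  proof -
    have "v = e * (v / e)" using e(1) by simp
    also have "v / e = (\<Sum>k<s. fls_X_intpow (int k) * fls_compose_power (fls_section s (fls_shift (int k) (v / e))) s)"
      by (rule fls_split_sections[OF s_pos])
    also have "e * \<dots> = (\<Sum>k<s. \<iota> k (\<pi> k v))"
      unfolding sum_distrib_left \<iota>_def \<pi>_def fls_shifted_times_simps mult_1_left minus_minus ..
    finally show ?thesis .
  qed
  ultimately have "elementary_biproduct (E_conn h N) {..<s} f (\<lambda>_. r) \<iota> \<pi>"
    using r_pos by (simp add: elementary_biproduct_def)
  moreover have f_nth: "f k $$ n = h $$ (n * int s)" if "n < 0" for k n
    using that s_pos by (simp add: f_def g_def h0_nth mult_le_0_iff)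
  have "R_class r (f k) \<in> R_o r" for k
    unfolding R_o_iff[OF r_pos]
  proof (intro allI impI, rule ccontr)
    fix r' assume r': "0 < r' \<and> r' < r" and neg: "\<not> (\<exists>n<0. f k $$ n \<noteq> 0 \<and> \<not> int r dvd n * int r')"
    \<comment> \<open>If r divided n r' for every polar exponent n of f k, then N would divide a r'
      for all a in A, hence also s r'; since N = s r, this means that r divides r'.\<close>
    have "int N dvd a * int r'" if "a \<in> A" for a
    proof (cases "a = int N")
      case False
      with that have a: "a < 0" "h $$ a \<noteq> 0" by (auto simp: A_def)
      have "int s dvd a" unfolding int_s using that by (rule Gcd_dvd)
      then obtain n where n: "a = n * int s" by (metis dvdE mult.commute)
      have "n < 0" using a(1) by (auto simp: n mult_less_0_iff)
      then have "int r dvd n * int r'" using neg a(2) f_nth by (auto simp: n)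
      then show ?thesis by (auto simp: n r elim!: dvdE)
    qed simp
    then have "int N dvd Gcd ((\<lambda>a. int r' * a) ` A)" by (intro Gcd_greatest) (auto simp: mult.commute)
    also have "Gcd ((\<lambda>a. int r' * a) ` A) = int r' * int s"
      using Gcd_mult[of "int r'" A] by (simp add: int_s)
    finally have "s * r dvd s * r'" by (simp add: r mult.commute flip: of_nat_mult)
    then have "r dvd r'" using s_pos by simp
    then show False using r' by (auto dest: dvd_imp_le)
  qed
  \<comment> \<open>A polar order of h is divided by s in each of the s summands.\<close>
  moreover have "(\<Sum>k<s. pole_order (f k)) = pole_order h"
  proof (cases "fls_subdegree h < 0")
    case True
    then have hne: "h \<noteq> 0" by auto
    let ?d = "fls_subdegree h"
    have "?d \<in> A" using True hne by (simp add: A_def)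
    then have "int s dvd ?d" unfolding int_s by (rule Gcd_dvd)
    then obtain n where n: "?d = n * int s" by (metis dvdE mult.commute)
    have n_neg: "n < 0" using True by (auto simp: n mult_less_0_iff)
    have "fls_subdegree (f k) = n" for k
    proof (rule fls_subdegree_eqI)
      show "f k $$ n \<noteq> 0" using f_nth[OF n_neg, of k] hne by (simp flip: n)
      show "f k $$ l = 0" if "l < n" for l
        using f_nth[of l k] n_neg that s_pos by (simp add: n fls_eq0_below_subdegree)
    qed
    then show ?thesis using True n_neg by (simp add: pole_order_def n)
  next
    case False
    have "f k $$ n = 0" if "n < 0" for k n
    proof -
      have "n * int s < fls_subdegree h" using False that s_pos mult_neg_pos[of n "int s"] by linarith
      with f_nth[OF that, of k] show ?thesis by simp
    qed
    then have "0 \<le> fls_subdegree (f k)" for k by (intro fls_subdegree_ge0I)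
    then show ?thesis using False by (simp add: pole_order_def)
  qed
  ultimately show ?thesis by blast
qed

text \<open>The class of h i need not lie in \<open>R_o N\<close>, so each E_{h_i,N} is refined by
  \<open>E_conn_biproduct\<close>, which keeps the total pole order.\<close>

lemma irregularity_of_biproduct:
  fixes C :: "('k::field_char_0, 'v::ab_group_add) conn" and I :: "nat set"
  assumes C: "linear_space C" and bi: "elementary_biproduct C I h (\<lambda>_. N) \<iota> \<pi>" and N: "0 < N"
  shows "irregularity C = of_int (\<Sum>i\<in>I. pole_order (h i))"
proof -
  let ?Q = "\<lambda>i (s, r, f, \<iota>, \<pi>).
    elementary_biproduct (E_conn (h i) N) {..<s::nat} f (\<lambda>_. r) \<iota> \<pi> \<and>
    (\<forall>k<s. R_class r (f k) \<in> R_o r) \<and> (\<Sum>k<s. pole_order (f k)) = pole_order (h i)"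
  have "\<forall>i. \<exists>Y. ?Q i Y"
  proof
    fix i
    from E_conn_biproduct[OF N, of "h i"] obtain s r f \<iota> \<pi> where "?Q i (s, r, f, \<iota>, \<pi>)" by auto
    then show "\<exists>Y. ?Q i Y" by blast
  qed
  from choice[OF this] obtain Y where Y: "\<forall>i. ?Q i (Y i)" by (elim exE)
  define s where "s = (\<lambda>i. fst (Y i))"
  define r where "r = (\<lambda>i. fst (snd (Y i)))"
  define f where "f = (\<lambda>i. fst (snd (snd (Y i))))"
  define \<iota>' where "\<iota>' = (\<lambda>i. fst (snd (snd (snd (Y i)))))"
  define \<pi>' where "\<pi>' = (\<lambda>i. snd (snd (snd (snd (Y i)))))"
  have "Y i = (s i, r i, f i, \<iota>' i, \<pi>' i)" for i
    by (simp add: s_def r_def f_def \<iota>'_def \<pi>'_def)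
  then have E: "\<And>i. elementary_biproduct (E_conn (h i) N) {..<s i} (f i) (\<lambda>_. r i) (\<iota>' i) (\<pi>' i)"
    "\<And>i k. k < s i \<Longrightarrow> R_class (r i) (f i k) \<in> R_o (r i)" "\<And>i. (\<Sum>k<s i. pole_order (f i k)) = pole_order (h i)"
    using Y by auto
  have fin: "finite I" using bi by (simp add: elementary_biproduct_def)
  have "irregularity C = of_int (\<Sum>ik\<in>Sigma I (\<lambda>i. {..<s i}). pole_order ((\<lambda>(i, k). f i k) ik))"
    by (rule HTL_of_biproduct[OF C elementary_biproduct_trans[OF bi E(1)]]) (use E(2) in auto)
  also have "(\<Sum>ik\<in>Sigma I (\<lambda>i. {..<s i}). pole_order ((\<lambda>(i, k). f i k) ik)) = (\<Sum>i\<in>I. \<Sum>k<s i. pole_order (f i k))"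
    using sum.Sigma[of I "\<lambda>i. {..<s i}" "\<lambda>i k. pole_order (f i k)"] fin by (simp add: case_prod_beta)
  finally show ?thesis by (simp add: E(3))
qed

section \<open>Decomposition of \<open>Hom(E\<^bsub>f,q\<^esub>, E\<^bsub>g,q'\<^esub>)\<close>\<close>

lemma primitive_root_nonzero:
  assumes "primitive_root_of_unity q z" "0 < q" shows "z \<noteq> 0"
  using assms by (auto simp: primitive_root_of_unity_def zero_power)

lemma primitive_root_powi_eq_1_iff:
  fixes z :: "'k::field"
  assumes z: "primitive_root_of_unity q z" and q: "0 < q"
  shows "z powi n = 1 \<longleftrightarrow> int q dvd n"
proof -
  have z0: "z \<noteq> 0" using primitive_root_nonzero[OF assms] .
  define k where "k = nat (n mod int q)"
  have k: "int k = n mod int q" "k < q" using q by (simp_all add: k_def nat_less_iff)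
  have "n = int q * (n div int q) + int k" using k(1) by simp
  then have "z powi n = (z powi int q) powi (n div int q) * z powi int k"
    using z0 by (metis power_int_add power_int_mult)
  also have "z powi int q = 1" using z by (simp add: primitive_root_of_unity_def)
  finally have "z powi n = z ^ k" by simp
  moreover have "z ^ k = 1 \<longleftrightarrow> k = 0" using z k(2) by (auto simp: primitive_root_of_unity_def)
  ultimately show ?thesis using k(1) by (auto simp: dvd_eq_mod_eq_0)
qed

lemma sum_powers_root_of_unity:
  fixes x :: "'k::field"
  assumes "x ^ d = 1"
  shows "(\<Sum>l<d. x ^ l) = (if x = 1 then of_nat d else 0)"
  using assms by (simp add: geometric_sum)

text \<open>
  Write \<open>q = M' d\<close>, \<open>q' = M d\<close> with \<open>M\<close>, \<open>M'\<close> coprime. The maps below identify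
  \<open>Hom(K((x\<^bsup>1/q\<^esup>)), K((x\<^bsup>1/q'\<^esup>)))\<close> with \<open>d\<close> copies of \<open>K((x\<^bsup>1/N\<^esup>))\<close>, \<open>N = M M' d\<close>: up to a scalar,
  \<open>hom_embed\<close> sends \<open>a\<close> to the map \<open>v \<mapsto> Tr(a v)\<close> into the \<open>j\<close>-th conjugate of \<open>K((x\<^bsup>1/q'\<^esup>))\<close>.
\<close>

definition twisted_section :: "'k::field \<Rightarrow> nat \<Rightarrow> nat \<Rightarrow> 'k fls \<Rightarrow> 'k fls" where
  "twisted_section z M' j b = fls_rescale (z ^ j) (fls_section M' b)"

definition twisted_embed :: "'k::field \<Rightarrow> nat \<Rightarrow> nat \<Rightarrow> 'k fls \<Rightarrow> 'k fls" where
  "twisted_embed z M' j g = fls_compose_power (fls_rescale (inverse z ^ j) g) M'"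

definition hom_embed :: "'k::field \<Rightarrow> nat \<Rightarrow> nat \<Rightarrow> nat \<Rightarrow> 'k fls \<Rightarrow> ('k fls \<Rightarrow> 'k fls)" where
  "hom_embed z M M' j a = (\<lambda>v. twisted_section z M' j (a * fls_compose_power v M))"

text \<open>Recovers a from v -> Tr(a v) by trace duality: in t = x^(1/q) the basis t^m, m < q = M'
  d, has the dual basis t^(-m) up to a scalar. \<open>twisted_embed\<close> undoes the j-th
  conjugation, and the scalar is 1/d.\<close>

definition hom_coord :: "'k::field \<Rightarrow> nat \<Rightarrow> nat \<Rightarrow> nat \<Rightarrow> nat \<Rightarrow> ('k fls \<Rightarrow> 'k fls) \<Rightarrow> 'k fls" where
  "hom_coord z d M M' j \<phi> = fls_const (1 / of_nat d) *
     (\<Sum>m<M' * d. fls_X_intpow (- int (M * m)) * twisted_embed z M' j (\<phi> (fls_X_intpow (int m))))"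

lemma
  assumes "z \<noteq> 0" "0 < M'"
  shows twisted_section_nth: "twisted_section z M' j b $$ n = b $$ (n * int M') * (z ^ j) powi n"
    and twisted_section_add: "twisted_section z M' j (a + b) = twisted_section z M' j a + twisted_section z M' j b"
    and twisted_section_sum: "twisted_section z M' j (\<Sum>i\<in>S. F i) = (\<Sum>i\<in>S. twisted_section z M' j (F i))"
    and twisted_section_mult: "twisted_section z M' j (twisted_embed z M' j g * b) = g * twisted_section z M' j b"
    and twisted_section_theta: "twisted_section z M' j (fls_theta b) = of_nat M' * fls_theta (twisted_section z M' j b)"
    and twisted_embed_add: "twisted_embed z M' j (g + h) = twisted_embed z M' j g + twisted_embed z M' j h"
proof -
  have zj: "z ^ j \<noteq> 0" "inverse z ^ j \<noteq> 0" using assms by auto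
  show "twisted_section z M' j b $$ n = b $$ (n * int M') * (z ^ j) powi n"
    using zj assms by (simp add: twisted_section_def fls_rescale_nth)
  show "twisted_section z M' j (a + b) = twisted_section z M' j a + twisted_section z M' j b"
    using zj assms by (simp add: twisted_section_def fls_rescale_add fls_section_add)
  show "twisted_section z M' j (\<Sum>i\<in>S. F i) = (\<Sum>i\<in>S. twisted_section z M' j (F i))"
    using zj assms by (simp add: twisted_section_def fls_rescale_sum fls_section_sum)
  have "fls_rescale (z ^ j) (fls_rescale (inverse z ^ j) g) = g"
    using zj assms by (simp add: fls_rescale_rescale power_inverse)
  then show "twisted_section z M' j (twisted_embed z M' j g * b) = g * twisted_section z M' j b"
    using zj assms
    by (simp add: twisted_section_def twisted_embed_def fls_section_mult fls_rescale_mult)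
  have "fls_rescale (z ^ j) (of_nat M' * u) = of_nat M' * fls_rescale (z ^ j) u" for u
    using zj by (simp add: fls_of_nat fls_rescale_mult)
  then show "twisted_section z M' j (fls_theta b) = of_nat M' * fls_theta (twisted_section z M' j b)"
    using zj assms by (simp add: twisted_section_def fls_section_theta fls_rescale_theta)
  show "twisted_embed z M' j (g + h) = twisted_embed z M' j g + twisted_embed z M' j h"
    using zj by (simp add: twisted_embed_def fls_rescale_add)
qed

lemma twisted_embed_compose_power:
  assumes "z \<noteq> 0" "0 < M'" "0 < q'" "z ^ q' = 1"
  shows "twisted_embed z M' j (fls_compose_power h q') = fls_compose_power h (q' * M')"
proof -
  have "(inverse z ^ j) ^ q' = inverse ((z ^ q') ^ j)"
    by (simp add: power_inverse mult.commute flip: power_mult)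
  then have "fls_rescale (inverse z ^ j) (fls_compose_power h q') = fls_compose_power h q'"
    using assms by (simp add: fls_rescale_compose_power)
  then show ?thesis using assms by (simp add: twisted_embed_def fls_compose_power_compose_power)
qed

lemma Hom_conn_E_simps:
  "\<phi> \<in> conn_space (Hom_conn (E_conn f q) (E_conn g q')) \<longleftrightarrow>
     (\<forall>v w. \<phi> (v + w) = \<phi> v + \<phi> w) \<and> (\<forall>h v. \<phi> (fls_compose_power h q * v) = fls_compose_power h q' * \<phi> v)"
  "conn_scale (Hom_conn (E_conn f q) (E_conn g q')) h \<phi> = (\<lambda>v. fls_compose_power h q' * \<phi> v)"
  "conn_nabla (Hom_conn (E_conn f q) (E_conn g q')) \<phi>
     = (\<lambda>v. conn_nabla (E_conn g q') (\<phi> v) - \<phi> (conn_nabla (E_conn f q) v))"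
  by (simp_all add: Hom_conn_def conn_linear_def)

lemma linear_space_Hom_E:
  fixes f g :: "'k::field_char_0 fls"
  assumes "0 < q" "0 < q'"
  shows "linear_space (Hom_conn (E_conn f q) (E_conn g q'))"
proof -
  let ?C = "Hom_conn (E_conn f q) (E_conn g q')"
  interpret V: vector_space "conn_scale ?C"
    using assms by unfold_locales (auto simp: Hom_conn_E_simps fun_eq_iff algebra_simps)
  have "V.subspace (conn_space ?C)"
    unfolding V.subspace_def by (auto simp: Hom_conn_E_simps algebra_simps)
  moreover have "conn_nabla ?C (v + w) = conn_nabla ?C v + conn_nabla ?C w" for v w
    using assms by (auto simp: Hom_conn_E_simps E_conn_nabla log_nabla_add fun_eq_iff algebra_simps
        simp del: fls_compose_power_X_inv)
  ultimately show ?thesis using V.vector_space_axioms by (simp add: linear_space_def)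
qed

context
  fixes z :: "'k::field_char_0" and d M M' q q' :: nat
  assumes pos: "0 < d" "0 < M" "0 < M'" and coprime: "coprime M M'"
    and q: "q = M' * d" and q': "q' = M * d"
    and z: "primitive_root_of_unity q' z"
begin

lemma hom_index_pos: "0 < q" "0 < q'" "0 < M * q" "q' * M' = M * q"
  using pos by (auto simp: q q')

lemma hom_root_nonzero: "z \<noteq> 0"
  using primitive_root_nonzero[OF z hom_index_pos(2)] .

lemma hom_root_power: "z ^ q' = 1"
  using z by (simp add: primitive_root_of_unity_def)

lemma hom_embed_in_space: "hom_embed z M M' j a \<in> conn_space (Hom_conn (E_conn f q) (E_conn g q'))"
proof -
  have "hom_embed z M M' j a (fls_compose_power h q * v) = fls_compose_power h q' * hom_embed z M M' j a v" for h v
  proof -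
    have "fls_compose_power (fls_compose_power h q) M = twisted_embed z M' j (fls_compose_power h q')"
      using pos hom_index_pos hom_root_nonzero hom_root_power
      by (simp add: twisted_embed_compose_power fls_compose_power_compose_power mult.commute)
    then have "a * fls_compose_power (fls_compose_power h q * v) M
        = twisted_embed z M' j (fls_compose_power h q') * (a * fls_compose_power v M)"
      by (simp add: mult.left_commute)
    then show ?thesis
      unfolding hom_embed_def by (simp only: twisted_section_mult[OF hom_root_nonzero pos(3)])
  qed
  then show ?thesis
    using pos hom_root_nonzero
    by (simp add: Hom_conn_E_simps hom_embed_def distrib_left twisted_section_add)
qed

lemma hom_embed_scale:
  "hom_embed z M M' j (fls_compose_power h (M * q) * a) v = fls_compose_power h q' * hom_embed z M M' j a v"
proof -
  have "fls_compose_power h (M * q) = twisted_embed z M' j (fls_compose_power h q')"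
    using pos hom_index_pos hom_root_nonzero hom_root_power by (simp add: twisted_embed_compose_power)
  then show ?thesis
    unfolding hom_embed_def mult.assoc by (simp only: twisted_section_mult[OF hom_root_nonzero pos(3)])
qed

text \<open>\<open>twisted_section\<close> intertwines the operators x d/dx and turns multiplication
  by the conjugate of g into multiplication by g. The Leibniz rule for the product of a and v then
  leaves the difference of that conjugate and f acting on a.\<close>

lemma hom_embed_log_nabla:
  "hom_embed z M M' j (log_nabla (twisted_embed z M' j g - fls_compose_power f M) (M * q) a) v
    = log_nabla g q' (hom_embed z M M' j a v) - hom_embed z M M' j a (log_nabla f q v)"
proof -
  let ?S = "twisted_section z M' j" and ?c = "\<lambda>v. fls_compose_power v M"
  let ?k = "fls_const (1 / of_nat (M * q)) :: 'k fls"
  note S = twisted_section_add[OF hom_root_nonzero pos(3)] twisted_section_mult[OF hom_root_nonzero pos(3)]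
  have S_const: "?S (fls_const c * b) = fls_const c * ?S b" for c b
    using twisted_section_mult[OF hom_root_nonzero pos(3), of j "fls_const c" b] pos
    by (simp add: twisted_embed_def)
  have 1: "?c (fls_const (1 / of_nat q) * fls_theta v) = ?k * fls_theta (?c v)"
    using pos hom_index_pos by (simp add: fls_theta_compose_power fls_of_nat flip: mult.assoc)
  have 2: "fls_const (1 / of_nat q') * fls_theta (?S b) = ?S (?k * fls_theta b)" for b
  proof -
    have "?S (?k * fls_theta b) = (?k * of_nat M') * fls_theta (?S b)"
      unfolding S_const twisted_section_theta[OF hom_root_nonzero pos(3)] by (simp add: mult.assoc)
    also have "?k * of_nat M' = fls_const (1 / of_nat q')"
      using pos by (simp add: fls_of_nat q q')
    finally show ?thesis by simp
  qed
  have "log_nabla g q' (hom_embed z M M' j a v) = ?S (?k * fls_theta (a * ?c v) + twisted_embed z M' j g * (a * ?c v))"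
    unfolding log_nabla_def hom_embed_def 2 S ..
  also have "\<dots> = ?S (log_nabla (twisted_embed z M' j g - ?c f) (M * q) a * ?c v + a * ?c (log_nabla f q v))"
    unfolding log_nabla_def fls_compose_power_add 1 fls_theta_mult
    by (rule arg_cong[where f = ?S]) (simp add: algebra_simps)
  finally show ?thesis unfolding S hom_embed_def by simp
qed

lemma hom_embed_morphism:
  "conn_morphism (E_conn (twisted_embed z M' j g - fls_compose_power f M) (M * q))
     (Hom_conn (E_conn f q) (E_conn g q')) (hom_embed z M M' j)"
proof (rule conn_morphismI_E)
  fix a
  let ?h = "twisted_embed z M' j g - fls_compose_power f M"
  have "hom_embed z M M' j (conn_nabla (E_conn ?h (M * q)) a) v
      = fls_compose_power fls_X_inv q' * (log_nabla g q' (hom_embed z M M' j a v) - hom_embed z M M' j a (log_nabla f q v))" for v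
    unfolding E_conn_nabla[OF hom_index_pos(3)] hom_embed_scale hom_embed_log_nabla ..
  moreover have "hom_embed z M M' j a (fls_compose_power h q * v) = fls_compose_power h q' * hom_embed z M M' j a v" for h v
    using hom_embed_in_space[of j a] by (simp add: Hom_conn_E_simps)
  ultimately show "hom_embed z M M' j (conn_nabla (E_conn ?h (M * q)) a)
      = conn_nabla (Hom_conn (E_conn f q) (E_conn g q')) (hom_embed z M M' j a)"
    by (intro ext) (simp only: Hom_conn_E_simps E_conn_nabla[OF hom_index_pos(1)] E_conn_nabla[OF hom_index_pos(2)] right_diff_distrib)
next
  show "hom_embed z M M' j a \<in> conn_space (Hom_conn (E_conn f q) (E_conn g q'))" for a
    by (rule hom_embed_in_space)
  show "hom_embed z M M' j (a + b) = hom_embed z M M' j a + hom_embed z M M' j b" for a b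
    unfolding hom_embed_def distrib_right twisted_section_add[OF hom_root_nonzero pos(3)]
    by (simp add: fun_eq_iff)
  show "hom_embed z M M' j (fls_compose_power h (M * q) * a)
      = conn_scale (Hom_conn (E_conn f q) (E_conn g q')) h (hom_embed z M M' j a)" for h a
    unfolding Hom_conn_E_simps(2) by (intro ext hom_embed_scale)
qed

text \<open>M is invertible modulo M', so the congruence e + M m = 0 modulo M' has exactly one
  residue class of solutions m.\<close>

lemma admissible_exponents:
  "\<exists>m0 n0. m0 < M' \<and> e + int (M * m0) = n0 * int M' \<and>
    (\<forall>m. int M' dvd e + int (M * m) \<longleftrightarrow> m mod M' = m0)"
proof -
  obtain u v where uv: "u * int M + v * int M' = 1"
    using bezout_int[of "int M" "int M'"] coprime by auto
  \<comment> \<open>By the Bezout identity u is the inverse of M modulo M', so -e u solves the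
    congruence.\<close>
  define m0 where "m0 = nat ((- e * u) mod int M')"
  have m0: "int m0 = - e * u - int M' * ((- e * u) div int M')" "m0 < M'"
    using pos by (simp_all add: m0_def nat_less_iff minus_mult_div_eq_mod)
  have "e + int (M * m0) = e * (1 - u * int M) - int M * int M' * ((- e * u) div int M')"
    by (simp add: m0(1) algebra_simps)
  also have "1 - u * int M = v * int M'" using uv by simp
  finally have "e + int (M * m0) = int M' * (e * v - int M * ((- e * u) div int M'))"
    by (simp add: algebra_simps)
  then have dvd: "int M' dvd e + int (M * m0)" by simp
  then obtain n0 where n0: "e + int (M * m0) = n0 * int M'" by (metis dvdE mult.commute)
  have "int M' dvd e + int (M * m) \<longleftrightarrow> m mod M' = m0" for m
  proof -
    have "e + int (M * m) = (e + int (M * m0)) + int M * (int m - int m0)" by (simp add: algebra_simps)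
    then have "int M' dvd e + int (M * m) \<longleftrightarrow> int M' dvd int M * (int m - int m0)"
      by (simp only: dvd_add_right_iff[OF dvd])
    also have "\<dots> \<longleftrightarrow> int M' dvd int m - int m0"
      using coprime by (simp add: coprime_dvd_mult_right_iff coprime_commute)
    also have "\<dots> \<longleftrightarrow> int m mod int M' = int m0 mod int M'"
      by (simp add: mod_eq_dvd_iff)
    also have "\<dots> \<longleftrightarrow> m mod M' = m0 mod M'" by (simp flip: zmod_int)
    finally show ?thesis using m0(2) by simp
  qed
  then show ?thesis using m0(2) n0 by blast
qed

text \<open>The admissible m are m0 + M' l with l < d, and each step in l raises the exponent of w
  by M. This is a full geometric sum in w^M, a d-th root of unity because q' = M d.\<close>

lemma sum_admissible_exponents:
  fixes w :: 'k
  assumes w: "w \<noteq> 0" "w ^ q' = 1" "w ^ M = 1 \<Longrightarrow> w = 1"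
  shows "(\<Sum>m<q. if int M' dvd e + int (M * m) then w powi ((e + int (M * m)) div int M') else 0)
    = (if w = 1 then of_nat d else 0)"
proof -
  obtain m0 n0 where m0: "m0 < M'" "e + int (M * m0) = n0 * int M'"
    "\<And>m. int M' dvd e + int (M * m) \<longleftrightarrow> m mod M' = m0"
    using admissible_exponents[of e] by blast
  have set_eq: "{m\<in>{..<q}. m mod M' = m0} = (\<lambda>l. m0 + M' * l) ` {..<d}"
  proof (intro equalityI subsetI)
    fix m assume m: "m \<in> {m\<in>{..<q}. m mod M' = m0}"
    then have "m = m0 + M' * (m div M')" by (metis (mono_tags, lifting) mem_Collect_eq mod_mult_div_eq)
    moreover have "m div M' < d" using m pos by (simp add: q less_mult_imp_div_less mult.commute)
    ultimately show "m \<in> (\<lambda>l. m0 + M' * l) ` {..<d}" by blast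
  next
    fix m assume "m \<in> (\<lambda>l. m0 + M' * l) ` {..<d}"
    then obtain l where l: "l < d" "m = m0 + M' * l" by blast
    have "m < M' * Suc l" using m0(1) l by simp
    also have "\<dots> \<le> q" unfolding q using l(1) by (intro mult_le_mono2) simp
    finally show "m \<in> {m\<in>{..<q}. m mod M' = m0}" using m0(1) l(2) by simp
  qed
  have ex: "(e + int (M * (m0 + M' * l))) div int M' = n0 + int (M * l)" for l
  proof -
    have "e + int (M * (m0 + M' * l)) = (n0 + int (M * l)) * int M'"
      using m0(2) by (simp add: algebra_simps)
    then show ?thesis using pos by simp
  qed
  have "(\<Sum>m<q. if int M' dvd e + int (M * m) then w powi ((e + int (M * m)) div int M') else 0)
      = (\<Sum>m\<in>{m\<in>{..<q}. m mod M' = m0}. w powi ((e + int (M * m)) div int M'))"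
    unfolding m0(3) by (rule sum.inter_filter[symmetric]) simp
  also have "\<dots> = (\<Sum>l<d. w powi n0 * (w ^ M) ^ l)"
    unfolding set_eq using pos w(1)
    by (subst sum.reindex) (auto simp: inj_on_def ex power_int_add power_mult simp del: of_nat_mult of_nat_add)
  also have "\<dots> = w powi n0 * (if w ^ M = 1 then of_nat d else 0)"
    using w(2) unfolding sum_distrib_left[symmetric]
    by (subst sum_powers_root_of_unity) (simp_all add: q' power_mult)
  finally show ?thesis using w(3) by auto
qed

text \<open>Here w = z^(j - i) with |j - i| < d, and w^M = 1 means that d divides j - i.\<close>

lemma z_quotient:
  assumes "i < d" "j < d"
  defines "w \<equiv> z ^ j * inverse z ^ i"
  shows "w \<noteq> 0" "w ^ q' = 1" "w ^ M = 1 \<Longrightarrow> w = 1" "w = 1 \<longleftrightarrow> i = j"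
proof -
  have w: "w = z powi (int j - int i)"
    using hom_root_nonzero by (simp add: w_def power_int_diff divide_inverse power_inverse)
  show "w \<noteq> 0" using hom_root_nonzero by (simp add: w_def)
  have wn: "w ^ n = 1 \<longleftrightarrow> int q' dvd (int j - int i) * int n" for n
    unfolding w primitive_root_powi_eq_1_iff[OF z hom_index_pos(2), symmetric] power_int_mult by simp
  show "w ^ q' = 1" by (simp add: wn)
  have small: "i = j" if "int d dvd int j - int i"
  proof -
    have "int j mod int d = int i mod int d" using that by (simp add: mod_eq_dvd_iff)
    then show ?thesis using assms by simp
  qed
  show "w = 1" if "w ^ M = 1"
  proof -
    have "int d dvd int j - int i" using that pos by (simp add: wn q' mult.commute)
    then show ?thesis using small hom_root_nonzero by (auto simp: w)
  qed
  show "w = 1 \<longleftrightarrow> i = j"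
    using wn[of 1] small hom_root_nonzero by (auto simp: w q' dest: dvd_mult_right)
qed

text \<open>At exponent e the m-th term is the coefficient of a times w^n with n = (e + M m)/M', if
  this is an integer, and 0 otherwise. Orthogonality of the powers of w therefore separates i from
  j.\<close>

lemma hom_coord_embed:
  assumes ij: "i < d" "j < d"
  shows "hom_coord z d M M' i (hom_embed z M M' j a) = (if i = j then a else 0)"
proof (rule fls_eqI)
  fix e
  let ?w = "z ^ j * inverse z ^ i"
  have coeff: "(fls_X_intpow (- int (M * m)) * twisted_embed z M' i (hom_embed z M M' j a (fls_X_intpow (int m)))) $$ e
      = a $$ e * (if int M' dvd e + int (M * m) then ?w powi ((e + int (M * m)) div int M') else 0)" for m
  proof (cases "int M' dvd e + int (M * m)")
    case True
    then obtain n where n: "e + int (M * m) = n * int M'" by (metis dvdE mult.commute)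
    have e: "n * int M' - int M * int m = e" using n by simp
    have zi: "inverse z ^ i \<noteq> 0" using hom_root_nonzero by simp
    have "(fls_X_intpow (- int (M * m)) * twisted_embed z M' i (hom_embed z M M' j a (fls_X_intpow (int m)))) $$ e
        = hom_embed z M M' j a (fls_X_intpow (int m)) $$ n * (inverse z ^ i) powi n"
      using pos n zi
      by (simp add: fls_shifted_times_simps twisted_embed_def fls_nth_compose_power fls_rescale_nth)
    also have "hom_embed z M M' j a (fls_X_intpow (int m)) $$ n = a $$ e * (z ^ j) powi n"
      unfolding hom_embed_def twisted_section_nth[OF hom_root_nonzero pos(3)]
      using pos e by (simp add: fls_shifted_times_simps)
    finally show ?thesis using n pos by (simp add: power_int_mult_distrib)
  qed (use pos in \<open>simp add: fls_shifted_times_simps twisted_embed_def fls_nth_compose_power\<close>)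
  have "hom_coord z d M M' i (hom_embed z M M' j a) $$ e
      = 1 / of_nat d * (a $$ e * (\<Sum>m<q. if int M' dvd e + int (M * m) then ?w powi ((e + int (M * m)) div int M') else 0))"
    unfolding hom_coord_def fls_mult_const_nth fls_nth_sum coeff sum_distrib_left[symmetric] q ..
  also have "(\<Sum>m<q. if int M' dvd e + int (M * m) then ?w powi ((e + int (M * m)) div int M') else 0)
      = (if ?w = 1 then of_nat d else 0)"
    by (rule sum_admissible_exponents) (use z_quotient[OF ij] in auto)
  also have "1 / of_nat d * (a $$ e * \<dots>) = (if i = j then a $$ e else 0)"
    unfolding z_quotient(4)[OF ij]
    using pos by simp
  finally show "hom_coord z d M M' i (hom_embed z M M' j a) $$ e = (if i = j then a else 0) $$ e" by simp
qed

text \<open>The completeness relation dual to \<open>hom_coord_embed\<close>. A nonzero section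
  requires l - m = M' c; the sum over j is then geometric in the d-th root of unity z^(M c), which
  equals 1 exactly if d divides c, that is, if q divides l - m.\<close>

lemma sum_twisted_section_X_intpow:
  assumes lm: "l < q" "m < q"
  shows "(\<Sum>j<d. twisted_section z M' j (fls_X_intpow (int M * (int l - int m)))) = (if l = m then of_nat d else 0)"
proof (cases "int M' dvd int M * (int l - int m)")
  case True
  then have "int M' dvd int l - int m"
    using coprime by (simp add: coprime_dvd_mult_right_iff coprime_commute)
  then obtain c where c: "int l - int m = int M' * c" by blast
  have e: "int M * (int l - int m) = (int M * c) * int M'" by (simp add: c)
  have "twisted_section z M' j (fls_X_intpow (int M * (int l - int m)))
      = fls_const ((z powi (int M * c)) ^ j) * fls_X_intpow (int M * c)" for j
  proof (rule fls_eqI)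
    fix n
    have "(z ^ j) powi n = (z powi n) ^ j"
      by (metis mult.commute power_int_mult power_int_of_nat)
    then show "twisted_section z M' j (fls_X_intpow (int M * (int l - int m))) $$ n
        = (fls_const ((z powi (int M * c)) ^ j) * fls_X_intpow (int M * c)) $$ n"
      unfolding twisted_section_nth[OF hom_root_nonzero pos(3)] e using pos by auto
  qed
  then have "(\<Sum>j<d. twisted_section z M' j (fls_X_intpow (int M * (int l - int m))))
      = fls_const (\<Sum>j<d. (z powi (int M * c)) ^ j) * fls_X_intpow (int M * c)"
    by (intro fls_eqI) (simp add: fls_nth_sum sum_distrib_right)
  moreover have "(z powi (int M * c)) ^ d = 1"
  proof -
    have "(z powi (int M * c)) ^ d = z powi (int q' * c)"
      by (simp add: q' mult.commute mult.left_commute flip: power_int_of_nat power_int_mult)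
    then show ?thesis by (simp add: primitive_root_powi_eq_1_iff[OF z hom_index_pos(2)])
  qed
  moreover have "z powi (int M * c) = 1 \<longleftrightarrow> l = m"
  proof -
    have "z powi (int M * c) = 1 \<longleftrightarrow> int d dvd c"
      using pos by (simp add: primitive_root_powi_eq_1_iff[OF z hom_index_pos(2)] q')
    also have "\<dots> \<longleftrightarrow> int q dvd int l - int m" using pos by (simp add: q c)
    also have "\<dots> \<longleftrightarrow> int l mod int q = int m mod int q" by (simp add: mod_eq_dvd_iff)
    also have "\<dots> \<longleftrightarrow> l = m" using lm by simp
    finally show ?thesis .
  qed
  moreover have "c = 0" if "l = m" using c that pos by simp
  ultimately show ?thesis by (auto simp: sum_powers_root_of_unity fls_of_nat)
next
  case False
  then have "l \<noteq> m" by auto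
  moreover have "twisted_section z M' j (fls_X_intpow (int M * (int l - int m))) = 0" for j
  proof (rule fls_zero_eqI)
    fix n
    have "n * int M' \<noteq> int M * (int l - int m)" using False by (metis dvd_triv_right)
    then show "twisted_section z M' j (fls_X_intpow (int M * (int l - int m))) $$ n = 0"
      by (simp add: twisted_section_nth[OF hom_root_nonzero pos(3)])
  qed
  ultimately show ?thesis by simp
qed

text \<open>Both sides are K((x))-linear, so it is enough to compare them on the basis t^l, l < q,
  where the completeness relation selects m = l.\<close>

lemma hom_expand:
  assumes \<phi>: "\<phi> \<in> conn_space (Hom_conn (E_conn f q) (E_conn g q'))"
  shows "\<phi> = (\<Sum>j<d. hom_embed z M M' j (hom_coord z d M M' j \<phi>))"
proof -
  let ?\<psi> = "\<Sum>j<d. hom_embed z M M' j (hom_coord z d M M' j \<phi>)"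
  let ?S = "twisted_section z M'"
  have lin: "\<theta> v = (\<Sum>k<q. fls_compose_power (fls_section q (fls_shift (int k) v)) q' * \<theta> (fls_X_intpow (int k)))"
    if "\<theta> \<in> conn_space (Hom_conn (E_conn f q) (E_conn g q'))" for \<theta> v
  proof -
    have add: "\<And>v w. \<theta> (v + w) = \<theta> v + \<theta> w"
      and scale: "\<And>h v. \<theta> (fls_compose_power h q * v) = fls_compose_power h q' * \<theta> v"
      using that by (simp_all add: Hom_conn_E_simps)
    have "\<theta> 0 = 0" using scale[of 0 0] by simp
    then have sum: "\<theta> (\<Sum>k\<in>S. F k) = (\<Sum>k\<in>S. \<theta> (F k))" for S and F :: "nat \<Rightarrow> 'k fls"
      by (induction S rule: infinite_finite_induct) (simp_all add: add)
    have "\<theta> v = \<theta> (\<Sum>k<q. fls_compose_power (fls_section q (fls_shift (int k) v)) q * fls_X_intpow (int k))"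
      using fls_split_sections[OF hom_index_pos(1), of v] by (simp only: mult.commute)
    then show ?thesis by (simp only: sum scale)
  qed
  have \<psi>_apply: "?\<psi> v = (\<Sum>j<d. hom_embed z M M' j (hom_coord z d M M' j \<phi>) v)" for v
    by (rule sum_apply)
  have "hom_embed z M M' j a \<in> conn_space (Hom_conn (E_conn f q) (E_conn g q'))" for j a
    by (rule hom_embed_in_space)
  then have \<psi>: "?\<psi> \<in> conn_space (Hom_conn (E_conn f q) (E_conn g q'))"
    unfolding Hom_conn_E_simps \<psi>_apply by (simp add: sum.distrib sum_distrib_left)
  have "?\<psi> (fls_X_intpow (int l)) = \<phi> (fls_X_intpow (int l))" if l: "l < q" for l
  proof -
    let ?c = "fls_const (1 / of_nat d) :: 'k fls"
    have "hom_coord z d M M' j \<phi> * fls_compose_power (fls_X_intpow (int l)) M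
        = (\<Sum>m<q. twisted_embed z M' j (?c * \<phi> (fls_X_intpow (int m))) * fls_X_intpow (int M * (int l - int m)))" for j
    proof -
      have 1: "twisted_embed z M' j (?c * u) = ?c * twisted_embed z M' j u" for u
        using hom_root_nonzero pos by (simp add: twisted_embed_def fls_rescale_mult)
      have 2: "fls_X_intpow (- int (M * m)) * fls_compose_power (fls_X_intpow (int l)) M
          = (fls_X_intpow (int M * (int l - int m)) :: 'k fls)" for m
        unfolding fls_compose_power_X_intpow[OF pos(2)] fls_X_intpow_times_fls_X_intpow
        by (simp add: algebra_simps)
      have "hom_coord z d M M' j \<phi> * fls_compose_power (fls_X_intpow (int l)) M
          = (\<Sum>m<q. ?c * (twisted_embed z M' j (\<phi> (fls_X_intpow (int m)))
              * (fls_X_intpow (- int (M * m)) * fls_compose_power (fls_X_intpow (int l)) M)))"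
        unfolding hom_coord_def q sum_distrib_left sum_distrib_right
        by (intro sum.cong refl) (simp only: mult.assoc mult.left_commute)
      then show ?thesis unfolding 1 2 mult.assoc .
    qed
    then have "hom_embed z M M' j (hom_coord z d M M' j \<phi>) (fls_X_intpow (int l))
        = (\<Sum>m<q. ?c * \<phi> (fls_X_intpow (int m)) * ?S j (fls_X_intpow (int M * (int l - int m))))" for j
      unfolding hom_embed_def
      by (simp only: twisted_section_sum[OF hom_root_nonzero pos(3)] twisted_section_mult[OF hom_root_nonzero pos(3)])
    then have "?\<psi> (fls_X_intpow (int l))
        = (\<Sum>j<d. \<Sum>m<q. ?c * \<phi> (fls_X_intpow (int m)) * ?S j (fls_X_intpow (int M * (int l - int m))))"
      unfolding \<psi>_apply by (simp only:)
    also have "\<dots> = (\<Sum>m<q. ?c * \<phi> (fls_X_intpow (int m)) * (\<Sum>j<d. ?S j (fls_X_intpow (int M * (int l - int m)))))"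
      by (subst sum.swap) (simp only: sum_distrib_left)
    also have "\<dots> = (\<Sum>m<q. if l = m then \<phi> (fls_X_intpow (int m)) else 0)"
    proof (intro sum.cong refl)
      fix m assume "m \<in> {..<q}"
      then have m: "m < q" by simp
      show "?c * \<phi> (fls_X_intpow (int m)) * (\<Sum>j<d. ?S j (fls_X_intpow (int M * (int l - int m))))
          = (if l = m then \<phi> (fls_X_intpow (int m)) else 0)"
        unfolding sum_twisted_section_X_intpow[OF l m] using pos
        by (auto simp: fls_of_nat mult.commute[of _ "fls_const (of_nat d)"] simp flip: mult.assoc)
    qed
    also have "\<dots> = \<phi> (fls_X_intpow (int l))" using l by (simp add: sum.delta)
    finally show ?thesis .
  qed
  then have "?\<psi> v = \<phi> v" for v
    unfolding lin[OF \<psi>, of v] lin[OF \<phi>, of v] by (intro sum.cong refl) simp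
  then have "?\<psi> = \<phi>" by (rule ext)
  then show ?thesis by (rule sym)
qed

theorem irregularity_Hom_coprime_index:
  "irregularity (Hom_conn (E_conn f q) (E_conn g q'))
    = of_int (\<Sum>j<d. pole_order (twisted_embed z M' j g - fls_compose_power f M))"
proof (rule irregularity_of_biproduct[OF linear_space_Hom_E[OF hom_index_pos(1,2)] _ hom_index_pos(3)])
  show "elementary_biproduct (Hom_conn (E_conn f q) (E_conn g q')) {..<d}
      (\<lambda>j. twisted_embed z M' j g - fls_compose_power f M) (\<lambda>_. M * q) (hom_embed z M M') (hom_coord z d M M')"
    unfolding elementary_biproduct_def
    using hom_index_pos(3) hom_embed_morphism hom_coord_embed hom_expand pos hom_root_nonzero
    by (auto simp: hom_coord_def twisted_embed_add distrib_left sum.distrib)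
qed

end

section \<open>Intersection numbers via a parametrization\<close>

lemma ring_of_type_algebra_simps [simp]:
  "carrier ring_of_type_algebra = UNIV"
  "x \<otimes>\<^bsub>ring_of_type_algebra\<^esub> y = x * y" "x \<oplus>\<^bsub>ring_of_type_algebra\<^esub> y = x + y"
  "\<one>\<^bsub>ring_of_type_algebra\<^esub> = 1" "\<zero>\<^bsub>ring_of_type_algebra\<^esub> = 0"
  by (simp_all add: ring_of_type_algebra_def)

lemma Idl_pair:
  fixes F G :: "'a::comm_ring_1"
  shows "Idl\<^bsub>ring_of_type_algebra\<^esub> {F, G} = {a * F + b * G |a b. True}" (is "_ = ?I")
proof -
  let ?R = "ring_of_type_algebra :: 'a ring"
  interpret R: ring ?R by (rule ring_from_type_algebra)
  have "ideal ?I ?R"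
  proof (rule idealI)
    show "subgroup ?I (add_monoid ?R)"
    proof (rule group.subgroupI)
      show "Group.group (add_monoid ?R)" by (rule R.a_group)
      show "?I \<noteq> {}" by blast
      show "inv\<^bsub>add_monoid ?R\<^esub> x \<in> ?I" if x: "x \<in> ?I" for x
      proof -
        obtain a b where ab: "x = a * F + b * G" using x by blast
        have "inv\<^bsub>add_monoid ?R\<^esub> x = - x"
          by (rule group.inv_equality[OF R.a_group]) (simp_all add: ring_of_type_algebra_def)
        also have "\<dots> = (- a) * F + (- b) * G" by (simp add: ab)
        finally show ?thesis by blast
      qed
      show "x \<otimes>\<^bsub>add_monoid ?R\<^esub> y \<in> ?I" if x: "x \<in> ?I" and y: "y \<in> ?I" for x y
      proof -
        obtain a b where ab: "x = a * F + b * G" using x by blast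
        obtain a' b' where ab': "y = a' * F + b' * G" using y by blast
        have "x \<otimes>\<^bsub>add_monoid ?R\<^esub> y = (a + a') * F + (b + b') * G"
          by (simp add: ab ab' distrib_right)
        then show ?thesis by blast
      qed
    qed simp
    show "x \<otimes>\<^bsub>?R\<^esub> y \<in> ?I" "y \<otimes>\<^bsub>?R\<^esub> x \<in> ?I" if y: "y \<in> ?I" for x y
    proof -
      obtain a b where ab: "y = a * F + b * G" using y by blast
      have "x * y = (x * a) * F + (x * b) * G" by (simp add: ab algebra_simps)
      moreover have "y * x = (x * a) * F + (x * b) * G" by (simp add: ab algebra_simps)
      ultimately show "x \<otimes>\<^bsub>?R\<^esub> y \<in> ?I" "y \<otimes>\<^bsub>?R\<^esub> x \<in> ?I" by auto
    qed
  qed (rule R.ring_axioms)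
  moreover have "F \<in> ?I" "G \<in> ?I"
  proof -
    have "F = 1 * F + 0 * G" "G = 0 * F + 1 * G" by simp_all
    then show "F \<in> ?I" "G \<in> ?I" by blast+
  qed
  ultimately have "Idl\<^bsub>?R\<^esub> {F, G} \<subseteq> ?I" by (intro R.genideal_minimal) auto
  moreover have "?I \<subseteq> Idl\<^bsub>?R\<^esub> {F, G}"
  proof -
    interpret J: ideal "Idl\<^bsub>?R\<^esub> {F, G}" ?R by (rule R.genideal_ideal) simp
    have "F \<in> Idl\<^bsub>?R\<^esub> {F, G}" "G \<in> Idl\<^bsub>?R\<^esub> {F, G}" using R.genideal_self[of "{F, G}"] by auto
    then show ?thesis using J.I_l_closed J.a_closed by fastforce
  qed
  ultimately show ?thesis by blast
qed

locale intersection_ring =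
  fixes F G :: "'k::field fps fps"
begin

abbreviation "R \<equiv> ring_of_type_algebra :: 'k fps fps ring"
abbreviation "I \<equiv> Idl\<^bsub>R\<^esub> {F, G}"
abbreviation "Q \<equiv> intersection_quotient F G"
abbreviation "cls x \<equiv> I +>\<^bsub>R\<^esub> x"

lemma mem_I: "x \<in> I \<longleftrightarrow> (\<exists>a b. x = a * F + b * G)"
  unfolding Idl_pair by blast

sublocale R: ring R by (rule ring_from_type_algebra)
sublocale I: ideal I R by (rule R.genideal_ideal) simp
sublocale cls: ring_hom_ring R Q "\<lambda>x. cls x"
  unfolding intersection_quotient_def by (rule I.rcos_ring_hom_ring)

lemma carrier_Q: "carrier Q = range (\<lambda>x. cls x)"
  by (auto simp: intersection_quotient_def FactRing_def A_RCOSETS_def' )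

lemma cls_eq_iff: "cls x = cls y \<longleftrightarrow> x - y \<in> I"
proof
  assume "cls x = cls y"
  then have "x \<in> cls y" using I.a_repr_independenceD[of x y] by simp
  then show "x - y \<in> I" by (auto simp: a_r_coset_def')
next
  assume "x - y \<in> I"
  then have "cls (x - y) = I" by (rule I.a_rcos_const)
  then have "cls (x - y) = \<zero>\<^bsub>Q\<^esub>" by (simp add: intersection_quotient_def FactRing_def)
  moreover have "cls ((x - y) + y) = cls (x - y) \<oplus>\<^bsub>Q\<^esub> cls y"
    using cls.hom_add[of "x - y" y] by simp
  ultimately show "cls x = cls y" by simp
qed

lemma scalars: "quotient_scalars F G = range (\<lambda>c. cls (fps_const (fps_const c)))"
  by (simp add: quotient_scalars_def)

lemma trivial_dimension:
  assumes "1 \<in> I"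
  shows "has_intersection_number F G n \<longleftrightarrow> n = 0"
proof -
  have "x \<in> I" for x using I.I_l_closed[OF assms, of x] by simp
  then have "cls x = cls 0" for x by (simp add: cls_eq_iff)
  then have carrier: "carrier Q = {\<zero>\<^bsub>Q\<^esub>}"
    using cls.hom_zero unfolding carrier_Q by auto
  have sc: "quotient_scalars F G = {\<zero>\<^bsub>Q\<^esub>}"
    using \<open>\<And>x. cls x = cls 0\<close> cls.hom_zero unfolding scalars by auto
  have "n = 0 \<and> E = {\<zero>\<^bsub>Q\<^esub>}" if "cls.S.dimension n (quotient_scalars F G) E" for n E
    using that
  proof (induction rule: cls.S.dimension.induct)
    case (Suc_dim v E n K)
    then show ?case using carrier by auto
  qed simp
  moreover have "cls.S.dimension 0 (quotient_scalars F G) {\<zero>\<^bsub>Q\<^esub>}" by simp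
  ultimately show ?thesis unfolding has_intersection_number_def carrier by metis
qed

lemma scalars_subfield:
  assumes "1 \<notin> I"
  shows "subfield (quotient_scalars F G) Q"
proof -
  let ?K = "ring_of_type_algebra :: 'k ring"
  interpret K: field ?K by (rule field_from_type_algebra)
  have "ring_hom_ring ?K Q (\<lambda>c. cls (fps_const (fps_const c)))"
  proof (rule ring_hom_ringI)
    show "Ring.ring ?K" by (rule K.ring_axioms)
    show "Ring.ring Q" by (rule cls.S.ring_axioms)
    show "cls (fps_const (fps_const (x \<otimes>\<^bsub>?K\<^esub> y))) = cls (fps_const (fps_const x)) \<otimes>\<^bsub>Q\<^esub> cls (fps_const (fps_const y))" for x y
      using cls.hom_mult[of "fps_const (fps_const x)" "fps_const (fps_const y)"] by simp
    show "cls (fps_const (fps_const (x \<oplus>\<^bsub>?K\<^esub> y))) = cls (fps_const (fps_const x)) \<oplus>\<^bsub>Q\<^esub> cls (fps_const (fps_const y))" for x y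
      using cls.hom_add[of "fps_const (fps_const x)" "fps_const (fps_const y)"] by simp
    show "cls (fps_const (fps_const \<one>\<^bsub>?K\<^esub>)) = \<one>\<^bsub>Q\<^esub>" using cls.hom_one by simp
  qed (use cls.hom_closed in simp)
  moreover have "\<one>\<^bsub>Q\<^esub> \<noteq> \<zero>\<^bsub>Q\<^esub>"
    using assms cls_eq_iff[of 1 0] cls.hom_one cls.hom_zero by simp
  ultimately have "subfield ((\<lambda>c. cls (fps_const (fps_const c))) ` carrier ?K) Q"
    using ring_hom_ring.img_is_subfield(2)[OF _ K.carrier_is_subfield] by blast
  then show ?thesis unfolding scalars by simp
qed

lemma intersection_number_eqI:
  assumes "has_intersection_number F G n"
  shows "intersection_number F G = enat n"
proof -
  have "m = n" if "has_intersection_number F G m" for m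
  proof (cases "1 \<in> I")
    case True
    then show ?thesis using trivial_dimension assms that by simp
  next
    case False
    show ?thesis
      using cls.S.dimension_is_inj[OF scalars_subfield[OF False]] assms that
      unfolding has_intersection_number_def by blast
  qed
  then have "(THE n. has_intersection_number F G n) = n" using assms by blast
  then show ?thesis using assms by (auto simp: intersection_number_def)
qed

end

lemma intersection_number_unit:
  fixes F G :: "'k::field fps fps"
  assumes "F dvd 1"
  shows "intersection_number F G = enat 0"
proof -
  interpret intersection_ring F G .
  obtain H where "1 = F * H" using assms by (elim dvdE)
  then have "1 = H * F + 0 * G" by (simp add: mult.commute)
  then have "1 \<in> I" unfolding mem_I by blast
  then show ?thesis using intersection_number_eqI trivial_dimension by blast
qed

text \<open>
  Comparing coefficients of \<open>y\<^bsup>j+q\<^esup>\<close> in \<open>H = A F + B\<close> expresses the coefficient of \<open>x\<^sup>m\<close> in \<open>A\<^sub>j\<close> by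
  coefficients of lower powers of \<open>x\<close>, because the lower coefficients of \<open>F\<close> are divisible by \<open>x\<close>.
\<close>

function weierstrass_coeff ::
    "nat \<Rightarrow> (nat \<Rightarrow> nat \<Rightarrow> 'k::comm_ring) \<Rightarrow> (nat \<Rightarrow> nat \<Rightarrow> 'k) \<Rightarrow> nat \<Rightarrow> nat \<Rightarrow> 'k" where
  "weierstrass_coeff q h p m j = h (j + q) m
     - (\<Sum>l<q. \<Sum>i\<in>{1..m}. p l i * weierstrass_coeff q h p (m - i) (j + q - l))"
  by pat_completeness auto
termination by (relation "measure (\<lambda>(q, h, p, m, j). m)") auto

declare weierstrass_coeff.simps [simp del]

lemma monic_mult_nth:
  fixes H :: "'a::comm_ring_1 fps fps"
  assumes "coeff F0 q = 1" "degree F0 = q"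
  shows "(H * fps_of_poly F0) $ (j + q) = H $ j + (\<Sum>l<q. coeff F0 l * H $ (j + q - l))"
proof -
  have "(H * fps_of_poly F0) $ (j + q) = (\<Sum>l\<in>{0..j + q}. coeff F0 l * H $ (j + q - l))"
    by (subst mult.commute) (simp add: fps_mult_nth)
  also have "\<dots> = (\<Sum>l\<in>{0..q}. coeff F0 l * H $ (j + q - l))"
    using assms(2) by (intro sum.mono_neutral_right) (auto simp: coeff_eq_0)
  also have "{0..q} = insert q {..<q}" by auto
  finally show ?thesis using assms(1) by simp
qed

text \<open>The recursion makes A F0 agree with H from y^q on; what is left is a polynomial in
  y.\<close>

theorem weierstrass_division:
  fixes F0 :: "'k::comm_ring_1 fps poly"
  assumes F0: "coeff F0 q = 1" "degree F0 = q" "\<And>j. j < q \<Longrightarrow> coeff F0 j $ 0 = 0" and q: "0 < q"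
  shows "\<exists>A B. H = A * fps_of_poly F0 + fps_of_poly B \<and> degree B < q"
proof -
  let ?c = "weierstrass_coeff q (\<lambda>j m. H $ j $ m) (\<lambda>l i. coeff F0 l $ i)"
  define A where "A = Abs_fps (\<lambda>j. Abs_fps (\<lambda>m. ?c m j))"
  have "(A * fps_of_poly F0) $ (j + q) = H $ (j + q)" for j
    unfolding monic_mult_nth[OF F0(1,2)]
  proof (rule fps_ext)
    fix m
    have "(coeff F0 l * A $ (j + q - l)) $ m = (\<Sum>i\<in>{1..m}. coeff F0 l $ i * ?c (m - i) (j + q - l))" if "l < q" for l
    proof -
      have "{0..m} = insert 0 {1..m}" by auto
      then show ?thesis using F0(3)[OF that] by (simp add: fps_mult_nth A_def)
    qed
    then have "(\<Sum>l<q. coeff F0 l * A $ (j + q - l)) $ m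
        = (\<Sum>l<q. \<Sum>i\<in>{1..m}. coeff F0 l $ i * ?c (m - i) (j + q - l))"
      by (simp add: fps_sum_nth)
    then show "(A $ j + (\<Sum>l<q. coeff F0 l * A $ (j + q - l))) $ m = H $ (j + q) $ m"
      using weierstrass_coeff.simps[of q "\<lambda>j m. H $ j $ m" "\<lambda>l i. coeff F0 l $ i" m j]
      by (simp add: A_def)
  qed
  then have high: "(H - A * fps_of_poly F0) $ n = 0" if "q \<le> n" for n
    using that by (metis fps_sub_nth le_add_diff_inverse2 right_minus_eq)
  define B where "B = (\<Sum>j<q. monom ((H - A * fps_of_poly F0) $ j) j)"
  have B: "coeff B n = (if n < q then (H - A * fps_of_poly F0) $ n else 0)" for n
    by (simp add: B_def coeff_sum)
  have "fps_of_poly B = H - A * fps_of_poly F0"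
    by (rule fps_ext) (use high in \<open>auto simp: B not_less\<close>)
  moreover have "degree B < q"
  proof -
    have "degree B \<le> q - 1" by (rule degree_le) (use q in \<open>auto simp: B\<close>)
    then show ?thesis using q by simp
  qed
  ultimately show ?thesis by (metis add.commute diff_add_cancel)
qed

text \<open>The same triangular recursion, now with zero input, kills the coefficients of A by
  induction on the power of x.\<close>

lemma weierstrass_unique:
  fixes F0 :: "'k::comm_ring_1 fps poly"
  assumes F0: "coeff F0 q = 1" "degree F0 = q" "\<And>j. j < q \<Longrightarrow> coeff F0 j $ 0 = 0"
    and eq: "A * fps_of_poly F0 = fps_of_poly B" and deg: "degree B < q"
  shows "B = 0"
proof -
  have "A $ j $ m = 0" for j m
  proof (induction m arbitrary: j rule: less_induct)
    case (less m)
    have "A $ j + (\<Sum>l<q. coeff F0 l * A $ (j + q - l)) = coeff B (j + q)"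
      using arg_cong[OF eq, of "\<lambda>H. H $ (j + q)"] unfolding monic_mult_nth[OF F0(1,2)] by simp
    also have "\<dots> = 0" using deg by (intro coeff_eq_0) simp
    finally have "A $ j $ m + (\<Sum>l<q. (coeff F0 l * A $ (j + q - l)) $ m) = 0"
      by (metis fps_add_nth fps_sum_nth fps_zero_nth)
    moreover have "(coeff F0 l * A $ (j + q - l)) $ m = 0" if "l < q" for l
      unfolding fps_mult_nth
    proof (intro sum.neutral ballI)
      fix i assume "i \<in> {0..m}"
      then show "coeff F0 l $ i * A $ (j + q - l) $ (m - i) = 0"
        using F0(3)[OF that] less.IH[of "m - i" "j + q - l"] by (cases "i = 0") auto
    qed
    ultimately show ?case by simp
  qed
  then have "A = 0" by (simp add: fps_eq_iff)
  then have "fps_of_poly B = fps_of_poly 0" using eq by simp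
  then show ?thesis by (simp only: fps_of_poly_eq_iff)
qed

text \<open>Pseudo-division is honest division when the leading coefficient is 1.\<close>

lemma monic_division:
  fixes F0 :: "'a::idom poly"
  assumes "coeff F0 q = 1" "degree F0 = q" "0 < q"
  shows "\<exists>A B. P = A * F0 + B \<and> degree B < q"
proof -
  obtain A B where AB: "pseudo_divmod P F0 = (A, B)" by fastforce
  have "F0 \<noteq> 0" using assms by auto
  from pseudo_divmod[OF this AB] assms show ?thesis
    by (intro exI[of _ A] exI[of _ B]) (auto simp: mult.commute)
qed

text \<open>\<open>ev\<close> is the parametrization \<open>K[[x]][y] \<rightarrow> K((t))\<close>, \<open>x \<mapsto> t\<^sup>q\<close>, \<open>y \<mapsto> 1/f\<close> of the curve \<open>F0 = 0\<close>.\<close>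

locale curve_eval =
  fixes F0 :: "'k::field fps poly" and q :: nat and ev :: "'k fps poly \<Rightarrow> 'k fls"
  assumes q_pos: "0 < q" and monic: "coeff F0 q = 1" "degree F0 = q"
    and distinguished: "\<And>j. j < q \<Longrightarrow> coeff F0 j $ 0 = 0"
    and ev_add: "ev (P + P') = ev P + ev P'" and ev_mult: "ev (P * P') = ev P * ev P'"
    and ev_const: "ev [:fps_const c:] = fls_const c"
    and ev_F0: "ev F0 = 0" and ev_integral: "fls_vanishes_below 0 (ev P)"
    and ev_kernel: "degree B < q \<Longrightarrow> ev B = 0 \<Longrightarrow> B = 0"
    and conductor: "\<exists>c::nat. \<forall>b. fls_vanishes_below (int c) b \<longrightarrow> (\<exists>P. ev P = b)"
begin

lemma ev_zero: "ev 0 = 0"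
  using ev_const[of 0] by simp

lemma ev_diff: "ev (P - P') = ev P - ev P'"
  using ev_add[of "P - P'" P'] by simp

lemma ev_eq_0_iff: "ev P = 0 \<longleftrightarrow> (\<exists>A. P = A * F0)"
proof
  assume 0: "ev P = 0"
  obtain A B where AB: "P = A * F0 + B" "degree B < q"
    using monic_division[OF monic q_pos] by blast
  have "ev B = 0" using 0 by (simp add: AB(1) ev_add ev_mult ev_F0)
  then have "B = 0" by (rule ev_kernel[OF AB(2)])
  then show "\<exists>A. P = A * F0" using AB(1) by auto
qed (auto simp: ev_mult ev_F0)

text \<open>Weierstrass division replaces the power series multiplier of G0 by a polynomial B. The
  remainder of P - B G0 modulo F0 is then a power series multiple of F0 of degree below q in y, and
  hence 0.\<close>

lemma ideal_mem_iff:
  "(\<exists>a b. fps_of_poly P = a * fps_of_poly F0 + b * fps_of_poly G0) \<longleftrightarrow> (\<exists>B. ev P = ev B * ev G0)"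
proof
  assume "\<exists>a b. fps_of_poly P = a * fps_of_poly F0 + b * fps_of_poly G0"
  then obtain a b where ab: "fps_of_poly P = a * fps_of_poly F0 + b * fps_of_poly G0" by blast
  obtain A B where AB: "b = A * fps_of_poly F0 + fps_of_poly B"
    using weierstrass_division[OF monic distinguished q_pos] by blast
  obtain A' B' where AB': "P - B * G0 = A' * F0 + B'" "degree B' < q"
    using monic_division[OF monic q_pos] by blast
  have "fps_of_poly B' = fps_of_poly P - fps_of_poly B * fps_of_poly G0 - fps_of_poly A' * fps_of_poly F0"
    using arg_cong[OF AB'(1), of fps_of_poly]
    by (simp add: fps_of_poly_add fps_of_poly_diff fps_of_poly_mult)
  also have "\<dots> = (a + A * fps_of_poly G0 - fps_of_poly A') * fps_of_poly F0"
    by (simp add: ab AB algebra_simps)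
  finally have "B' = 0"
    using weierstrass_unique[OF monic distinguished _ AB'(2)] by metis
  with AB'(1) have "ev (P - B * G0) = 0" by (simp add: ev_mult ev_F0)
  then show "\<exists>B. ev P = ev B * ev G0" by (auto simp: ev_diff ev_mult)
next
  assume "\<exists>B. ev P = ev B * ev G0"
  then obtain B where "ev (P - B * G0) = 0" by (auto simp: ev_diff ev_mult)
  then obtain A where "P = A * F0 + B * G0" unfolding ev_eq_0_iff by (metis diff_add_cancel)
  then show "\<exists>a b. fps_of_poly P = a * fps_of_poly F0 + b * fps_of_poly G0"
    by (metis fps_of_poly_add fps_of_poly_mult)
qed

text \<open>The value semigroup of the branch.\<close>

definition orders :: "int set" where
  "orders = {fls_subdegree (ev P) |P. ev P \<noteq> 0}"

lemma orders_nonneg: "s \<in> orders \<Longrightarrow> 0 \<le> s"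
  using ev_integral by (force simp: orders_def fls_vanishes_below_iff)

text \<open>
  With \<open>u = ev G0\<close> and \<open>n = ord u\<close>, the quotient is \<open>A / u A\<close> for the image \<open>A\<close> of \<open>ev\<close>. Filtered by the order in
  \<open>t\<close>, its graded pieces have dimension at most one, and the jumps are the \<open>n\<close> elements of \<open>S - (n + S)\<close>, where
  \<open>S\<close> is the set of orders of elements of \<open>A\<close>.
\<close>

theorem has_intersection_number_ev:
  assumes G0: "ev G0 \<noteq> 0"
  shows "has_intersection_number (fps_of_poly F0) (fps_of_poly G0) (nat (fls_subdegree (ev G0)))"
proof -
  define u where "u = ev G0"
  define n where "n = fls_subdegree u"
  have u: "u \<noteq> 0" using G0 by (simp add: u_def)
  have n_order: "n \<in> orders" using G0 by (auto simp: orders_def n_def u_def)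
  have n0: "0 \<le> n" using orders_nonneg[OF n_order] .
  interpret intersection_ring "fps_of_poly F0" "fps_of_poly G0" .
  let ?K = "quotient_scalars (fps_of_poly F0) (fps_of_poly G0)"
  obtain c :: nat where c: "\<And>b. fls_vanishes_below (int c) b \<Longrightarrow> \<exists>P. ev P = b" using conductor by blast
  have mem: "fps_of_poly P \<in> I \<longleftrightarrow> (\<exists>B. ev P = ev B * u)" for P
    unfolding mem_I ideal_mem_iff u_def ..
  have orders_add: "n + s \<in> orders" if "s \<in> orders" for s
  proof -
    obtain P where P: "s = fls_subdegree (ev P)" "ev P \<noteq> 0" using \<open>s \<in> orders\<close> by (auto simp: orders_def)
    then have "ev (G0 * P) \<noteq> 0" "fls_subdegree (ev (G0 * P)) = n + s"
      using G0 by (simp_all add: ev_mult n_def u_def)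
    then show ?thesis unfolding orders_def by (metis (mono_tags, lifting) mem_Collect_eq)
  qed
  have orders_large: "s \<in> orders" if "int c \<le> s" for s
  proof -
    have "fls_vanishes_below (int c) (fls_X_intpow s :: 'k fls)" using that by (auto simp: fls_vanishes_below_def)
    then obtain P where P: "ev P = fls_X_intpow s" using c by blast
    then show ?thesis unfolding orders_def by (metis (mono_tags, lifting) fls_X_intpow_nonzero fls_subdegree_fls_X_intpow mem_Collect_eq)
  qed
  define D where "D = orders - (\<lambda>s. n + s) ` orders"
  define E where "E = (\<lambda>k. (\<lambda>P. cls (fps_of_poly P)) ` {P. fls_vanishes_below k (ev P)})"
  have scal: "cls (fps_of_poly ([:fps_const a:] * P)) = cls (fps_const (fps_const a)) \<otimes>\<^bsub>Q\<^esub> cls (fps_of_poly P)" for a P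
    using cls.hom_mult[of "fps_const (fps_const a)" "fps_of_poly P"]
    by (simp add: fps_of_poly_mult fps_of_poly_const del: mult_pCons_left)
  have cls_add: "cls (fps_of_poly (P + P')) = cls (fps_of_poly P) \<oplus>\<^bsub>Q\<^esub> cls (fps_of_poly P')" for P P'
    using cls.hom_add[of "fps_of_poly P" "fps_of_poly P'"] by (simp add: fps_of_poly_add)
  have E_step_eq: "E k = E (k + 1)"
    if "\<And>P. fls_vanishes_below k (ev P) \<Longrightarrow> \<exists>P'. fls_vanishes_below (k + 1) (ev P') \<and> cls (fps_of_poly P) = cls (fps_of_poly P')" for k
  proof
    show "E k \<subseteq> E (k + 1)" using that unfolding E_def by blast
    show "E (k + 1) \<subseteq> E k" unfolding E_def
      by (rule image_mono) (auto intro: fls_vanishes_below_mono[of "k + 1"])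
  qed
  have cancel: "fls_vanishes_below (k + 1) (ev (P - [:fps_const (ev P $$ k / ev A $$ k):] * A))"
    if "fls_vanishes_below k (ev P)" "ev A \<noteq> 0" "fls_subdegree (ev A) = k" for k P A
    unfolding fls_vanishes_below_def
  proof (intro allI impI)
    fix i assume "i < k + 1"
    then consider "i = k" | "i < k" by linarith
    then show "ev (P - [:fps_const (ev P $$ k / ev A $$ k):] * A) $$ i = 0"
    proof cases
      case 1
      then show ?thesis
        using nth_fls_subdegree_nonzero[OF that(2)] that(3) unfolding ev_diff ev_mult ev_const by simp
    next
      case 2
      then show ?thesis
        using that(1,3) unfolding ev_diff ev_mult ev_const by (simp add: fls_vanishes_below_def)
    qed
  qed
  \<comment> \<open>Descending induction on the order, starting at n + c: there every value is a
    multiple of u, because its quotient by u has order at least c and is again a value.\<close>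
  have dim: "cls.S.dimension (card (D \<inter> {n + int c - int t..<n + int c})) ?K (E (n + int c - int t))" for t
  proof (induction t)
    case 0
    have "cls (fps_of_poly P) = \<zero>\<^bsub>Q\<^esub>" if "fls_vanishes_below (n + int c) (ev P)" for P
    proof -
      have "fls_vanishes_below (int c) (ev P / u)"
        using that u by (cases "ev P = 0") (auto simp: fls_vanishes_below_iff fls_divide_subdegree n_def)
      from c[OF this] obtain B where "ev B = ev P / u" by blast
      then have "ev P = ev B * u" using u by simp
      then have "fps_of_poly P - 0 \<in> I" using mem by auto
      then show ?thesis using cls_eq_iff[of "fps_of_poly P" 0] cls.hom_zero by simp
    qed
    moreover have "fls_vanishes_below (n + int c) (ev 0)" by (simp add: ev_zero)
    ultimately have "E (n + int c) = {\<zero>\<^bsub>Q\<^esub>}" unfolding E_def by force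
    then show ?case by simp
  next
    case (Suc t)
    define k where "k = n + int c - int (Suc t)"
    have k: "n + int c - int t = k + 1" by (simp add: k_def)
    let ?D = "D \<inter> {k + 1..<n + int c}"
    have IH: "cls.S.dimension (card ?D) ?K (E (k + 1))" using Suc.IH by (simp only: k)
    have interval: "{k..<n + int c} = insert k {k + 1..<n + int c}" by (auto simp: k_def)
    show ?case
      unfolding k_def[symmetric]
    proof (cases "k \<in> D")
      case True
      then obtain A where A: "ev A \<noteq> 0" "fls_subdegree (ev A) = k" by (auto simp: D_def orders_def)
      \<comment> \<open>Otherwise some A - P would lie in the ideal; it still has order k, so k
        would be n plus a value order, contrary to k in D.\<close>
      have new: "cls (fps_of_poly A) \<notin> E (k + 1)"
      proof
        assume "cls (fps_of_poly A) \<in> E (k + 1)"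
        then obtain P where P: "fls_vanishes_below (k + 1) (ev P)" "cls (fps_of_poly A) = cls (fps_of_poly P)"
          by (auto simp: E_def)
        then have "fps_of_poly (A - P) \<in> I" by (simp add: cls_eq_iff fps_of_poly_diff)
        then obtain B where B: "ev (A - P) = ev B * u" unfolding mem by blast
        have "fls_subdegree (ev (A - P)) = k"
        proof (rule fls_subdegree_eqI)
          show "ev (A - P) $$ k \<noteq> 0" using A P(1) nth_fls_subdegree_nonzero[OF A(1)]
            by (auto simp: ev_diff fls_vanishes_below_def)
          show "ev (A - P) $$ i = 0" if "i < k" for i
            using that A P(1) by (auto simp: ev_diff fls_vanishes_below_def)
        qed
        moreover have "ev (A - P) \<noteq> 0"
          using A P(1) nth_fls_subdegree_nonzero[OF A(1)] by (auto simp: ev_diff fls_vanishes_below_def)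
        ultimately have "ev B \<noteq> 0" "k = n + fls_subdegree (ev B)" using u B by (auto simp: n_def)
        then have "k \<in> (\<lambda>s. n + s) ` orders" by (auto simp: orders_def)
        then show False using True by (simp add: D_def)
      qed
      have "E k = cls.S.line_extension ?K (cls (fps_of_poly A)) (E (k + 1))"
      proof (intro equalityI subsetI)
        fix x assume "x \<in> E k"
        then obtain P where P: "fls_vanishes_below k (ev P)" "x = cls (fps_of_poly P)" by (auto simp: E_def)
        let ?a = "ev P $$ k / ev A $$ k"
        let ?P' = "P - [:fps_const ?a:] * A"
        have "P = [:fps_const ?a:] * A + ?P'" by (simp del: mult_pCons_left)
        from arg_cong[OF this, of "\<lambda>P. cls (fps_of_poly P)"]
        have "x = cls (fps_const (fps_const ?a)) \<otimes>\<^bsub>Q\<^esub> cls (fps_of_poly A) \<oplus>\<^bsub>Q\<^esub> cls (fps_of_poly ?P')"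
          unfolding P(2) cls_add scal .
        moreover have "cls (fps_of_poly ?P') \<in> E (k + 1)"
          using cancel[OF P(1) A] by (auto simp: E_def)
        moreover have "cls (fps_const (fps_const ?a)) \<in> ?K" by (simp add: scalars)
        ultimately show "x \<in> cls.S.line_extension ?K (cls (fps_of_poly A)) (E (k + 1))"
          unfolding cls.S.line_extension_mem_iff by blast
      next
        fix x assume "x \<in> cls.S.line_extension ?K (cls (fps_of_poly A)) (E (k + 1))"
        then obtain a P where "fls_vanishes_below (k + 1) (ev P)"
          and x: "x = cls (fps_const (fps_const a)) \<otimes>\<^bsub>Q\<^esub> cls (fps_of_poly A) \<oplus>\<^bsub>Q\<^esub> cls (fps_of_poly P)"
          unfolding cls.S.line_extension_mem_iff by (auto simp: scalars E_def)
        then have "fls_vanishes_below k (ev ([:fps_const a:] * A + P))"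
          using A by (auto simp: ev_add ev_mult ev_const fls_vanishes_below_def simp del: mult_pCons_left)
        then show "x \<in> E k" unfolding x scal[symmetric] cls_add[symmetric] E_def by blast
      qed
      moreover have "D \<inter> {k..<n + int c} = insert k ?D" using True by (auto simp: interval)
      then have "card (D \<inter> {k..<n + int c}) = Suc (card ?D)" by simp
      ultimately show "cls.S.dimension (card (D \<inter> {k..<n + int c})) ?K (E k)"
        using cls.S.dimension.Suc_dim[OF _ new IH] cls.hom_closed by simp
    next
      case False
      have "\<exists>P'. fls_vanishes_below (k + 1) (ev P') \<and> cls (fps_of_poly P) = cls (fps_of_poly P')"
        if P: "fls_vanishes_below k (ev P)" for P
      proof (cases "k \<in> orders")
        case False
        then have "\<not> (ev P \<noteq> 0 \<and> fls_subdegree (ev P) = k)" by (auto simp: orders_def)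
        with P have "fls_vanishes_below (k + 1) (ev P)" by (auto simp: fls_vanishes_below_iff)
        then show ?thesis by blast
      next
        case True
        with \<open>k \<notin> D\<close> obtain B where B: "ev B \<noteq> 0" "k = n + fls_subdegree (ev B)"
          by (auto simp: D_def orders_def)
        \<comment> \<open>A multiple of B G0, which lies in the ideal, removes the leading term of
          P, so the filtration does not jump at k.\<close>
        have A: "ev (B * G0) \<noteq> 0" "fls_subdegree (ev (B * G0)) = k"
          using B G0 by (auto simp: ev_mult n_def u_def)
        let ?a = "ev P $$ k / ev (B * G0) $$ k"
        let ?P' = "P - [:fps_const ?a:] * (B * G0)"
        have "fps_of_poly (P - ?P') \<in> I"
          unfolding mem by (rule exI[of _ "[:fps_const ?a:] * B"]) (simp add: ev_diff ev_mult u_def mult.assoc del: mult_pCons_left)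
        then have "cls (fps_of_poly P) = cls (fps_of_poly ?P')"
          by (simp add: cls_eq_iff fps_of_poly_diff del: mult_pCons_left)
        then show ?thesis using cancel[OF P A] by blast
      qed
      from E_step_eq[OF this] have "E k = E (k + 1)" .
      moreover have "D \<inter> {k..<n + int c} = ?D" using False by (auto simp: interval)
      ultimately show "cls.S.dimension (card (D \<inter> {k..<n + int c})) ?K (E k)" using IH by simp
    qed
  qed
  have "E 0 = carrier Q"
  proof
    show "E 0 \<subseteq> carrier Q" unfolding E_def carrier_Q by blast
    show "carrier Q \<subseteq> E 0"
    proof
      fix x assume "x \<in> carrier Q"
      then obtain H where H: "x = cls H" unfolding carrier_Q by blast
      obtain A B where AB: "H = A * fps_of_poly F0 + fps_of_poly B"
        using weierstrass_division[OF monic distinguished q_pos] by blast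
      have "H - fps_of_poly B = A * fps_of_poly F0 + 0 * fps_of_poly G0" using AB by simp
      then have "cls H = cls (fps_of_poly B)" unfolding cls_eq_iff mem_I by blast
      then show "x \<in> E 0" using ev_integral H unfolding E_def by blast
    qed
  qed
  \<comment> \<open>From c on every integer is a value order. Below n + c there are thus exactly n
    more value orders than below c, and the shifts of the latter are the ones removed.\<close>
  moreover have "card (D \<inter> {0..<n + int c}) = nat n"
  proof -
    let ?O = "orders \<inter> {0..<n + int c}" and ?O' = "orders \<inter> {0..<int c}"
    have "D \<inter> {0..<n + int c} = ?O - (\<lambda>s. n + s) ` ?O'"
      using orders_nonneg n0 by (auto simp: D_def)
    moreover have "(\<lambda>s. n + s) ` ?O' \<subseteq> ?O" using orders_add n0 by auto
    ultimately have "card (D \<inter> {0..<n + int c}) = card ?O - card ((\<lambda>s. n + s) ` ?O')"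
      by (simp add: card_Diff_subset)
    also have "card ((\<lambda>s. n + s) ` ?O') = card ?O'" by (rule card_image) simp
    also have "?O = ?O' \<union> {int c..<n + int c}" using orders_large n0 by auto
    also have "card \<dots> = card ?O' + card {int c..<n + int c}" by (rule card_Un_disjoint) auto
    finally show ?thesis by simp
  qed
  ultimately show ?thesis
    using dim[of "nat (n + int c)"] n0 unfolding has_intersection_number_def by (simp add: n_def u_def)
qed

end

section \<open>The curve of \<open>f\<close>\<close>

lemma
  fixes \<phi> :: "'a::idom \<Rightarrow> 'b::idom"
  assumes add: "\<And>a b. \<phi> (a + b) = \<phi> a + \<phi> b" and mult: "\<And>a b. \<phi> (a * b) = \<phi> a * \<phi> b"
    and one: "\<phi> 1 = 1"
  shows map_poly_hom_add: "map_poly \<phi> (P + P') = map_poly \<phi> P + map_poly \<phi> P'"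
    and map_poly_hom_mult: "map_poly \<phi> (P * P') = map_poly \<phi> P * map_poly \<phi> P'"
    and map_poly_hom_pderiv: "map_poly \<phi> (pderiv P) = pderiv (map_poly \<phi> P)"
    and map_poly_hom_prod: "map_poly \<phi> (\<Prod>i\<in>A. F i) = (\<Prod>i\<in>A. map_poly \<phi> (F i))"
    and map_poly_hom_poly: "\<phi> (poly P x) = poly (map_poly \<phi> P) (\<phi> x)"
proof -
  have zero: "\<phi> 0 = 0" using add[of 0 0] by (metis add_0 add_cancel_right_right)
  have sum: "\<phi> (\<Sum>i\<in>S. F i) = (\<Sum>i\<in>S. \<phi> (F i))" for S and F :: "nat \<Rightarrow> 'a"
    by (induction S rule: infinite_finite_induct) (simp_all add: zero add)
  have nat: "\<phi> (of_nat n) = of_nat n" for n by (induction n) (simp_all add: zero add one)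
  show "map_poly \<phi> (P + P') = map_poly \<phi> P + map_poly \<phi> P'"
    by (rule poly_eqI) (simp add: coeff_map_poly zero add)
  show m: "map_poly \<phi> (P * P') = map_poly \<phi> P * map_poly \<phi> P'" for P P'
    by (rule poly_eqI) (simp add: coeff_map_poly zero coeff_mult sum mult)
  show "map_poly \<phi> (pderiv P) = pderiv (map_poly \<phi> P)"
    by (rule poly_eqI) (simp add: coeff_map_poly zero coeff_pderiv mult nat add one)
  show "map_poly \<phi> (\<Prod>i\<in>A. F i) = (\<Prod>i\<in>A. map_poly \<phi> (F i))"
    by (induction A rule: infinite_finite_induct) (simp_all add: m one zero map_poly_1')
  show "\<phi> (poly P x) = poly (map_poly \<phi> P) (\<phi> x)"
    by (induction P) (simp_all add: zero add mult map_poly_pCons)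
qed

section \<open>Evaluation of K[[x]][y] at Puiseux series\<close>

definition fps_embed :: "nat \<Rightarrow> 'k::field fps \<Rightarrow> 'k fls" where
  "fps_embed q a = fls_compose_power (fps_to_fls a) q"

lemma
  assumes "0 < q"
  shows fps_embed_add: "fps_embed q (a + b) = fps_embed q a + fps_embed q b"
    and fps_embed_mult: "fps_embed q (a * b) = fps_embed q a * fps_embed q b"
    and fps_embed_1: "fps_embed q 1 = 1" and fps_embed_0: "fps_embed q 0 = 0"
    and fps_embed_const: "fps_embed q (fps_const c) = fls_const c"
    and fps_embed_eq_iff: "fps_embed q a = fps_embed q b \<longleftrightarrow> a = b"
    and fps_embed_integral: "fls_vanishes_below 0 (fps_embed q a)"
proof -
  show "fls_vanishes_below 0 (fps_embed q a)"
    using fls_compose_power_vanishes_below[OF assms, of 0 "fps_to_fls a"]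
    by (simp add: fps_embed_def fls_vanishes_below_def)
qed (use assms in \<open>auto simp: fps_embed_def fls_times_fps_to_fls fls_compose_power_eq_iff\<close>)

lemmas fps_embed_map_poly =
  map_poly_hom_add[of "fps_embed q" for q, OF fps_embed_add fps_embed_mult fps_embed_1]
  map_poly_hom_mult[of "fps_embed q" for q, OF fps_embed_add fps_embed_mult fps_embed_1]
  map_poly_hom_pderiv[of "fps_embed q" for q, OF fps_embed_add fps_embed_mult fps_embed_1]

definition puiseux_eval :: "nat \<Rightarrow> 'k::field fls \<Rightarrow> 'k fps poly \<Rightarrow> 'k fls" where
  "puiseux_eval q Y P = poly (map_poly (fps_embed q) P) Y"

lemma
  assumes "0 < q"
  shows puiseux_eval_add: "puiseux_eval q Y (P + P') = puiseux_eval q Y P + puiseux_eval q Y P'"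
    and puiseux_eval_mult: "puiseux_eval q Y (P * P') = puiseux_eval q Y P * puiseux_eval q Y P'"
    and puiseux_eval_const: "puiseux_eval q Y [:a:] = fps_embed q a"
  using assms by (simp_all add: puiseux_eval_def fps_embed_map_poly map_poly_pCons fps_embed_0)

lemma puiseux_eval_sum:
  "0 < q \<Longrightarrow> puiseux_eval q Y (\<Sum>i\<in>S. P i) = (\<Sum>i\<in>S. puiseux_eval q Y (P i))"
  by (induction S rule: infinite_finite_induct) (simp_all add: puiseux_eval_add, simp_all add: puiseux_eval_def)

lemma puiseux_eval_integral:
  assumes "0 < q" "fls_vanishes_below 0 Y"
  shows "fls_vanishes_below 0 (puiseux_eval q Y P)"
proof -
  have *: "fls_vanishes_below 0 (a * b)" if "fls_vanishes_below 0 a" "fls_vanishes_below 0 b" for a b :: "'a fls"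
    using fls_vanishes_below_mult[OF that] by simp
  have "fls_vanishes_below 0 (Y ^ i)" for i
  proof (induction i)
    case 0
    show ?case by (simp add: fls_vanishes_below_def)
  next
    case (Suc i)
    from *[OF assms(2) this] show ?case by simp
  qed
  then show ?thesis
    unfolding puiseux_eval_def poly_altdef using assms(1)
    by (intro fls_vanishes_below_sum *) (auto simp: coeff_map_poly fps_embed_0 fps_embed_integral)
qed

text \<open>Each coefficient below the leading one is a sum of nonempty products of the roots, up to
  sign, so it contains at least one factor of order e or more.\<close>

lemma coeff_prod_linear_factors:
  fixes a :: "'i \<Rightarrow> 'k::field fls"
  assumes "finite A" "\<And>i. i \<in> A \<Longrightarrow> fls_vanishes_below e (a i)" "0 \<le> e"
  shows "(\<forall>j. fls_vanishes_below 0 (coeff (\<Prod>i\<in>A. [:- a i, 1:]) j)) \<and>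
    (\<forall>j<card A. fls_vanishes_below e (coeff (\<Prod>i\<in>A. [:- a i, 1:]) j))"
  using assms(1,2)
proof (induction A rule: finite_induct)
  case empty
  then show ?case by (auto simp: fls_vanishes_below_def)
next
  case (insert x A)
  let ?P = "\<Prod>i\<in>A. [:- a i, 1:]"
  have IH: "\<And>j. fls_vanishes_below 0 (coeff ?P j)" "\<And>j. j < card A \<Longrightarrow> fls_vanishes_below e (coeff ?P j)"
    using insert by auto
  have ax: "fls_vanishes_below e (a x)" using insert.prems by simp
  have 1: "fls_vanishes_below e (a x * coeff ?P j)" for j
    using fls_vanishes_below_mult[OF ax IH(1)[of j]] by simp
  have co: "coeff (\<Prod>i\<in>insert x A. [:- a i, 1:]) j = (case j of 0 \<Rightarrow> 0 | Suc i \<Rightarrow> coeff ?P i) - a x * coeff ?P j" for j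
    using insert.hyps by (simp add: coeff_pCons split: nat.split)
  have 2: "fls_vanishes_below 0 (case j of 0 \<Rightarrow> 0 | Suc i \<Rightarrow> coeff ?P i)" for j
    using IH(1) by (simp split: nat.split)
  have 3: "fls_vanishes_below e (case j of 0 \<Rightarrow> 0 | Suc i \<Rightarrow> coeff ?P i)" if "j < card (insert x A)" for j
    using IH(2) that insert.hyps by (simp split: nat.split)
  show ?case
    unfolding co using 1 2 3 assms(3) by (auto intro!: fls_vanishes_below_diff intro: fls_vanishes_below_mono)
qed

text \<open>An explicit candidate for the definite description in \<open>curve\<close>: the
  coefficients of the product turn out to be power series in t^q and are rewritten in x.\<close>

definition curve_poly :: "'k::field \<Rightarrow> 'k fls \<Rightarrow> nat \<Rightarrow> 'k fps poly" where
  "curve_poly z f q = map_poly (\<lambda>c. fls_regpart (fls_section q c)) (curve_product z f q)"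

lemma curve_product_rescale:
  "curve_product z f q = (\<Prod>i=1..q. [:- (1 / fls_rescale (z ^ i) f), 1:])"
  by (simp add: curve_product_def conjugate_eq_rescale)

lemma curve_product_monic:
  fixes f :: "'k::field fls"
  shows "degree (curve_product z f q) = q" "coeff (curve_product z f q) q = 1"
proof -
  show deg: "degree (curve_product z f q) = q"
    unfolding curve_product_def by (subst degree_prod_eq_sum_degree) auto
  have "lead_coeff (curve_product z f q) = 1"
    unfolding curve_product_def by (simp add: lead_coeff_prod)
  then show "coeff (curve_product z f q) q = 1" by (simp add: deg)
qed

context
  fixes z :: "'k::field_char_0" and q :: nat and f :: "'k fls"
  assumes q: "0 < q" and z: "primitive_root_of_unity q z"
    and f: "f \<noteq> 0" "fls_subdegree f \<le> 0"
begin

lemma root_nonzero: "z \<noteq> 0"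
  using primitive_root_nonzero[OF z q] .

lemma root_power: "(z ^ i) ^ q = 1"
proof -
  have "(z ^ i) ^ q = (z ^ q) ^ i" by (simp add: mult.commute flip: power_mult)
  then show ?thesis using z by (simp add: primitive_root_of_unity_def)
qed

lemma inverse_conjugate_vanishes: "fls_vanishes_below (- fls_subdegree f) (1 / fls_rescale (z ^ i) f)"
  using f root_nonzero by (simp add: fls_vanishes_below_iff fls_rescale_subdegree fls_divide_subdegree fls_rescale_eq_0_iff)

lemma curve_product_coeff_vanishes:
  "fls_vanishes_below 0 (coeff (curve_product z f q) j)"
  "j < q \<Longrightarrow> fls_vanishes_below (- fls_subdegree f) (coeff (curve_product z f q) j)"
  using coeff_prod_linear_factors[of "{1..q}" "- fls_subdegree f" "\<lambda>i. 1 / fls_rescale (z ^ i) f"]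
    inverse_conjugate_vanishes f(2)
  unfolding curve_product_rescale by auto

text \<open>The coefficients are invariant under \<open>t \<mapsto> \<zeta> t\<close>, which permutes the conjugates.\<close>

lemma curve_product_coeff_dvd:
  assumes "coeff (curve_product z f q) j $$ n \<noteq> 0"
  shows "int q dvd n"
proof -
  let ?\<rho> = "fls_rescale z :: 'k fls \<Rightarrow> 'k fls"
  note \<rho> = fls_rescale_add[OF root_nonzero] fls_rescale_mult[OF root_nonzero] fls_rescale_1_right
  have "?\<rho> (1 / fls_rescale (z ^ i) f) = 1 / fls_rescale (z ^ Suc i) f" for i
    using root_nonzero by (simp add: fls_rescale_divide fls_rescale_rescale)
  then have "map_poly ?\<rho> [:- (1 / fls_rescale (z ^ i) f), 1:] = [:- (1 / fls_rescale (z ^ Suc i) f), 1:]" for i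
    using fls_rescale_diff[OF root_nonzero, of 0 "1 / fls_rescale (z ^ i) f"]
    by (simp add: map_poly_pCons)
  then have "map_poly ?\<rho> (curve_product z f q) = (\<Prod>i=1..q. [:- (1 / fls_rescale (z ^ Suc i) f), 1:])"
    unfolding curve_product_rescale map_poly_hom_prod[of ?\<rho>, OF \<rho>] by simp
  also have "\<dots> = (\<Prod>i=2..Suc q. [:- (1 / fls_rescale (z ^ i) f), 1:])"
    by (rule prod.reindex_bij_witness[of _ "\<lambda>i. i - 1" Suc]) auto
  also have "{2..Suc q} = insert (Suc q) {2..q}" using q by auto
  also have "(\<Prod>i\<in>\<dots>. [:- (1 / fls_rescale (z ^ i) f), 1:])
      = [:- (1 / fls_rescale (z ^ Suc q) f), 1:] * (\<Prod>i=2..q. [:- (1 / fls_rescale (z ^ i) f), 1:])"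
    by (subst prod.insert) auto
  also have "z ^ Suc q = z ^ 1" using root_power[of 1] by simp
  also have "[:- (1 / fls_rescale (z ^ 1) f), 1:] * (\<Prod>i=2..q. [:- (1 / fls_rescale (z ^ i) f), 1:])
      = (\<Prod>i\<in>insert 1 {2..q}. [:- (1 / fls_rescale (z ^ i) f), 1:])"
    by (subst prod.insert) auto
  also have "insert 1 {2..q} = {1..q}" using q by auto
  also have "(\<Prod>i=1..q. [:- (1 / fls_rescale (z ^ i) f), 1:]) = curve_product z f q"
    by (rule curve_product_rescale[symmetric])
  finally have "coeff (map_poly ?\<rho> (curve_product z f q)) j $$ n = coeff (curve_product z f q) j $$ n"
    by (simp only:)
  then have "coeff (curve_product z f q) j $$ n * z powi n = coeff (curve_product z f q) j $$ n"
    by (simp add: coeff_map_poly fls_rescale_nth root_nonzero)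
  then have "z powi n = 1" using assms by simp
  then show ?thesis by (simp add: primitive_root_powi_eq_1_iff[OF z q])
qed

lemma fps_embed_coeff_curve_poly: "fps_embed q (coeff (curve_poly z f q) j) = coeff (curve_product z f q) j"
proof -
  let ?c = "coeff (curve_product z f q) j"
  have "fls_section q 0 = (0 :: 'k fls)" using q by (intro fls_eqI) simp
  then have "coeff (curve_poly z f q) j = fls_regpart (fls_section q ?c)"
    unfolding curve_poly_def by (subst coeff_map_poly) auto
  moreover have "0 \<le> fls_subdegree (fls_section q ?c)"
    using fls_section_shift_vanishes_below[OF q curve_product_coeff_vanishes(1)[of j]]
    by (auto simp: fls_vanishes_below_iff)
  ultimately show ?thesis
    using fls_compose_power_section[OF q curve_product_coeff_dvd] by (simp add: fps_embed_def)
qed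

lemma map_poly_curve_poly: "map_poly (fps_embed q) (curve_poly z f q) = curve_product z f q"
  using q by (intro poly_eqI) (simp add: coeff_map_poly fps_embed_0 fps_embed_coeff_curve_poly)

lemma curve_eq_curve_poly: "curve z f q = fps_of_poly (curve_poly z f q)"
  unfolding curve_def
proof (rule the_equality)
  show "\<forall>j. fls_compose_power (fps_to_fls (fps_of_poly (curve_poly z f q) $ j)) q = coeff (curve_product z f q) j"
    using fps_embed_coeff_curve_poly by (simp add: fps_embed_def)
  show "C = fps_of_poly (curve_poly z f q)"
    if "\<forall>j. fls_compose_power (fps_to_fls (C $ j)) q = coeff (curve_product z f q) j" for C
  proof (rule fps_ext)
    fix j
    have "fps_embed q (C $ j) = fps_embed q (coeff (curve_poly z f q) j)"
      using that by (simp only: fps_embed_coeff_curve_poly) (simp add: fps_embed_def)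
    then show "C $ j = fps_of_poly (curve_poly z f q) $ j" using q by (simp add: fps_embed_eq_iff)
  qed
qed

lemma curve_poly_monic: "coeff (curve_poly z f q) q = 1" "degree (curve_poly z f q) = q"
proof -
  have 1: "coeff (curve_poly z f q) j = a \<longleftrightarrow> coeff (curve_product z f q) j = fps_embed q a" for j a
    using q by (simp add: fps_embed_eq_iff flip: fps_embed_coeff_curve_poly)
  show c: "coeff (curve_poly z f q) q = 1" using q by (simp add: 1 fps_embed_1 curve_product_monic)
  show "degree (curve_poly z f q) = q"
  proof (rule antisym)
    show "degree (curve_poly z f q) \<le> q"
      using q by (intro degree_le) (auto simp: 1 fps_embed_0 curve_product_monic coeff_eq_0)
    show "q \<le> degree (curve_poly z f q)" by (rule le_degree) (simp add: c)
  qed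
qed

lemma puiseux_eval_curve_poly: "puiseux_eval q (1 / f) (curve_poly z f q) = 0"
proof -
  have "z ^ q = 1" using root_power[of 1] by simp
  have "poly (curve_product z f q) (1 / f) = (\<Prod>i=1..q. 1 / f - 1 / fls_rescale (z ^ i) f)"
    by (simp add: curve_product_rescale poly_prod)
  also have "\<dots> = 0"
    by (rule prod_zero) (use q \<open>z ^ q = 1\<close> in \<open>auto intro!: bexI[of _ q]\<close>)
  finally show ?thesis by (simp add: puiseux_eval_def map_poly_curve_poly)
qed

end

text \<open>K((t)) has dimension q over K((t^q)), so q + 1 elements satisfy a nontrivial relation;
  the equations are those of their q coordinates.\<close>

lemma homogeneous_sections:
  fixes v :: "nat \<Rightarrow> 'k::field_char_0 fls"
  assumes q: "0 < q"
  shows "\<exists>a. (\<exists>s\<le>q. a s \<noteq> 0) \<and> (\<Sum>s\<le>q. fls_compose_power (a s) q * v s) = 0"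
proof -
  obtain a where a: "\<exists>s\<in>{..q}. a s \<noteq> 0"
    "\<forall>k\<in>{..<q}. (\<Sum>s\<in>{..q}. a s * fls_section q (fls_shift (int k) (v s))) = 0"
    using homogeneous_system_solvable[of "{..<q}" "{..q}" "\<lambda>s k. fls_section q (fls_shift (int k) (v s))"]
    by auto
  have "(\<Sum>s\<le>q. fls_compose_power (a s) q * v s)
      = (\<Sum>s\<le>q. fls_compose_power (a s) q
          * (\<Sum>k<q. fls_X_intpow (int k) * fls_compose_power (fls_section q (fls_shift (int k) (v s))) q))"
  proof (intro sum.cong refl)
    fix s
    show "fls_compose_power (a s) q * v s = fls_compose_power (a s) q
        * (\<Sum>k<q. fls_X_intpow (int k) * fls_compose_power (fls_section q (fls_shift (int k) (v s))) q)"
      using arg_cong[OF fls_split_sections[OF q, of "v s"], of "\<lambda>x. fls_compose_power (a s) q * x"] .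
  qed
  also have "\<dots> = (\<Sum>s\<le>q. \<Sum>k<q. fls_X_intpow (int k)
      * fls_compose_power (a s * fls_section q (fls_shift (int k) (v s))) q)"
    unfolding sum_distrib_left by (intro sum.cong refl) (simp only: fls_compose_power_mult mult.left_commute)
  also have "\<dots> = (\<Sum>k<q. fls_X_intpow (int k)
      * fls_compose_power (\<Sum>s\<le>q. a s * fls_section q (fls_shift (int k) (v s))) q)"
    by (subst sum.swap) (simp only: sum_distrib_left fls_compose_power_sum)
  also have "\<dots> = 0" using a(2) by (intro sum.neutral) simp
  finally show ?thesis using a(1) by blast
qed

section \<open>Faithfulness and conductor of the parametrization by 1/f\<close>

context
  fixes z :: "'k::field_char_0" and q :: nat and f :: "'k fls"
  assumes q: "0 < q" and z: "primitive_root_of_unity q z"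
    and f: "fls_subdegree f < 0"
    and prim: "\<And>r. 0 < r \<Longrightarrow> r < q \<Longrightarrow> \<exists>n<0. f $$ n \<noteq> 0 \<and> \<not> int q dvd n * int r"
begin

lemma f_nonzero: "f \<noteq> 0"
  using f by auto

lemma conj_root_nonzero: "z \<noteq> 0"
  using primitive_root_nonzero[OF z q] .

text \<open>Primitivity with r = y - x yields a polar exponent n of f with q not dividing n (y - x);
  the two conjugates differ at t^n.\<close>

lemma rescale_diff_has_pole:
  assumes "x < y" "y < x + q"
  shows "\<exists>n<0. (fls_rescale (z ^ y) f - fls_rescale (z ^ x) f) $$ n \<noteq> 0"
proof -
  obtain n where n: "n < 0" "f $$ n \<noteq> 0" "\<not> int q dvd n * int (y - x)"
    using prim[of "y - x"] assms by (metis add.commute less_diff_conv2 less_imp_le_nat zero_less_diff)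
  have "(z ^ y) powi n \<noteq> (z ^ x) powi n"
  proof
    assume eq: "(z ^ y) powi n = (z ^ x) powi n"
    have "z ^ y = z ^ x * z ^ (y - x)" using assms by (simp flip: power_add)
    then have "(z ^ (y - x)) powi n = 1"
      using eq conj_root_nonzero by (simp add: power_int_mult_distrib)
    then have "z powi (int (y - x) * n) = 1" by (simp only: power_int_mult power_int_of_nat)
    then show False using n(3) by (simp add: primitive_root_powi_eq_1_iff[OF z q] mult.commute)
  qed
  then show ?thesis using n(1,2) conj_root_nonzero by (intro exI[of _ n]) (simp add: fls_rescale_nth)
qed

lemma conjugates_inj: "inj_on (\<lambda>i. 1 / fls_rescale (z ^ i) f) {1..q}"
proof (rule linorder_inj_onI)
  fix x y assume xy: "x < y" "x \<in> {1..q}" "y \<in> {1..q}"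
  then obtain n where "(fls_rescale (z ^ y) f - fls_rescale (z ^ x) f) $$ n \<noteq> 0"
    using rescale_diff_has_pole[of x y] by auto
  then have "fls_rescale (z ^ y) f \<noteq> fls_rescale (z ^ x) f" by auto
  then show "1 / fls_rescale (z ^ x) f \<noteq> 1 / fls_rescale (z ^ y) f"
    by (simp add: divide_inverse)
qed auto

text \<open>T has coefficients in K((x)), so all q distinct conjugates of 1/f are roots: 1/f has
  degree q over K((x)).\<close>

lemma inverse_f_independent:
  fixes T :: "'k fls poly"
  assumes deg: "degree T < q" and root: "poly (map_poly (\<lambda>h. fls_compose_power h q) T) (1 / f) = 0"
  shows "T = 0"
proof (rule ccontr)
  assume "T \<noteq> 0"
  let ?T = "map_poly (\<lambda>h. fls_compose_power h q) T"
  have "?T \<noteq> 0"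
  proof
    assume "?T = 0"
    then have "coeff ?T j = 0" for j by (simp only: coeff_0)
    then have "coeff T j = 0" for j
      using q by (simp add: coeff_map_poly fls_compose_power_eq_0_iff)
    then show False using \<open>T \<noteq> 0\<close> by (simp add: poly_eq_iff)
  qed
  have "poly ?T (1 / fls_rescale (z ^ i) f) = 0" for i
  proof -
    have zi: "z ^ i \<noteq> 0" using conj_root_nonzero by simp
    have "(z ^ i) ^ q = (z ^ q) ^ i" by (simp add: mult.commute flip: power_mult)
    then have ziq: "(z ^ i) ^ q = 1" using z by (simp add: primitive_root_of_unity_def)
    have "map_poly (fls_rescale (z ^ i)) ?T = ?T"
      using zi ziq q by (intro poly_eqI) (simp add: coeff_map_poly fls_rescale_compose_power)
    moreover have "fls_rescale (z ^ i) (poly ?T (1 / f)) = poly (map_poly (fls_rescale (z ^ i)) ?T) (fls_rescale (z ^ i) (1 / f))"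
      by (rule map_poly_hom_poly) (use zi in \<open>auto simp: fls_rescale_add fls_rescale_mult\<close>)
    ultimately show ?thesis using root zi by (simp add: fls_rescale_divide)
  qed
  then have "(\<lambda>i. 1 / fls_rescale (z ^ i) f) ` {1..q} \<subseteq> {x. poly ?T x = 0}" by auto
  then have "card ((\<lambda>i. 1 / fls_rescale (z ^ i) f) ` {1..q}) \<le> card {x. poly ?T x = 0}"
    using poly_roots_finite[OF \<open>?T \<noteq> 0\<close>] by (intro card_mono) auto
  also have "\<dots> \<le> degree ?T" by (rule card_poly_roots_bound) fact
  also have "\<dots> \<le> degree T" by (rule degree_le) (simp add: coeff_map_poly coeff_eq_0)
  finally show False using deg unfolding card_image[OF conjugates_inj] by simp
qed

lemma puiseux_eval_kernel:
  assumes "degree B < q" "puiseux_eval q (1 / f) B = 0"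
  shows "B = 0"
proof -
  let ?T = "map_poly fps_to_fls B"
  have "map_poly (\<lambda>h. fls_compose_power h q) ?T = map_poly (fps_embed q) B"
    by (intro poly_eqI) (simp add: coeff_map_poly fps_embed_def)
  then have "?T = 0"
  proof (intro inverse_f_independent)
    have "degree ?T \<le> degree B" by (rule degree_le) (simp add: coeff_map_poly coeff_eq_0)
    then show "degree ?T < q" using assms(1) by simp
  qed (use assms(2) in \<open>simp add: puiseux_eval_def\<close>)
  then have "coeff ?T j = 0" for j by (simp only: coeff_0)
  then have "coeff B j = 0" for j by (simp add: coeff_map_poly)
  then show ?thesis by (simp add: poly_eq_iff)
qed

text \<open>The q + 1 elements 1, 1/f, ..., (1/f)^(q-1), t^m are dependent over K((x)). By
  independence of the powers the coefficient of t^m is nonzero and can be divided out.\<close>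

lemma X_intpow_in_puiseux_span:
  "\<exists>h. fls_X_intpow (int m) = (\<Sum>j<q. fls_compose_power (h j) q * (1 / f) ^ j)"
proof -
  define v where "v = (\<lambda>s. if s < q then (1 / f) ^ s else fls_X_intpow (int m))"
  obtain a where a: "\<exists>s\<le>q. a s \<noteq> 0" "(\<Sum>s\<le>q. fls_compose_power (a s) q * v s) = 0"
    using homogeneous_sections[OF q, of v] by blast
  have split: "(\<Sum>s\<le>q. fls_compose_power (a s) q * v s)
      = (\<Sum>s<q. fls_compose_power (a s) q * (1 / f) ^ s) + fls_compose_power (a q) q * fls_X_intpow (int m)"
    by (simp add: v_def flip: lessThan_Suc_atMost)
  have aq: "a q \<noteq> 0"
  proof
    assume aq: "a q = 0"
    define T where "T = (\<Sum>j<q. monom (a j) j)"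
    have coeff_T: "coeff T j = (if j < q then a j else 0)" for j by (simp add: T_def coeff_sum)
    have "degree T \<le> q - 1" by (rule degree_le) (use q in \<open>auto simp: coeff_T\<close>)
    then have deg: "degree T < q" using q by simp
    have "map_poly (\<lambda>h. fls_compose_power h q) T = (\<Sum>j<q. monom (fls_compose_power (a j) q) j)"
      by (rule poly_eqI) (simp add: coeff_map_poly coeff_T coeff_sum)
    then have "poly (map_poly (\<lambda>h. fls_compose_power h q) T) (1 / f) = 0"
      using a(2) by (simp add: poly_sum poly_monom split aq)
    from inverse_f_independent[OF deg this] have "a j = 0" if "j < q" for j
      using coeff_T[of j] that by simp
    then show False using a(1) aq by (metis le_neq_implies_less)
  qed
  let ?c = "fls_compose_power (a q) q"
  have c: "?c \<noteq> 0" using aq q by (simp add: fls_compose_power_eq_0_iff)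
  have "?c * fls_X_intpow (int m) = - (\<Sum>j<q. fls_compose_power (a j) q * (1 / f) ^ j)"
    using a(2) unfolding split by (simp only: eq_neg_iff_add_eq_0 add.commute)
  also have "\<dots> = ?c * (\<Sum>j<q. fls_compose_power (- (a j / a q)) q * (1 / f) ^ j)"
    unfolding sum_distrib_left sum_negf[symmetric]
  proof (intro sum.cong refl)
    fix j
    have "fls_compose_power (a q) q * fls_compose_power (- (a j / a q)) q = fls_compose_power (- a j) q"
      using aq by (simp flip: fls_compose_power_mult del: fls_compose_power_uminus)
    then show "- (fls_compose_power (a j) q * (1 / f) ^ j) = ?c * (fls_compose_power (- (a j / a q)) q * (1 / f) ^ j)"
      by (simp only: mult.assoc[symmetric]) simp
  qed
  finally have "fls_X_intpow (int m) = (\<Sum>j<q. fls_compose_power (- (a j / a q)) q * (1 / f) ^ j)"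
    using c by (simp only: mult_cancel_left) simp
  then show ?thesis by (intro exI[of _ "\<lambda>j. - (a j / a q)"])
qed

text \<open>A factor x^N = t^(q N) clears the poles of the finitely many coefficients h_j, which
  then lie in K[[x]].\<close>

lemma X_intpow_eventually_in_image:
  "eventually (\<lambda>N. \<exists>P. puiseux_eval q (1 / f) P = fls_X_intpow (int (q * N + m))) sequentially"
proof -
  obtain h where h: "fls_X_intpow (int m) = (\<Sum>j<q. fls_compose_power (h j) q * (1 / f) ^ j)"
    using X_intpow_in_puiseux_span by blast
  define N0 where "N0 = nat (\<Sum>j<q. \<bar>fls_subdegree (h j)\<bar>)"
  have "\<exists>P. puiseux_eval q (1 / f) P = fls_X_intpow (int (q * N + m))" if N: "N0 \<le> N" for N
  proof -
    define P where "P = (\<Sum>j<q. monom (fls_regpart (fls_shift (- int N) (h j))) j)"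
    have emb: "fps_embed q (fls_regpart (fls_shift (- int N) (h j))) = fls_X_intpow (int (q * N)) * fls_compose_power (h j) q"
      if j: "j < q" for j
    proof -
      have "\<bar>fls_subdegree (h j)\<bar> \<le> (\<Sum>j<q. \<bar>fls_subdegree (h j)\<bar>)"
        using j by (intro member_le_sum) auto
      then have "0 \<le> fls_subdegree (fls_shift (- int N) (h j))"
        using N by (cases "h j = 0") (auto simp: N0_def)
      then show ?thesis
        using q by (simp add: fps_embed_def fls_shifted_times_simps)
    qed
    have "map_poly (fps_embed q) P = (\<Sum>j<q. monom (fls_X_intpow (int (q * N)) * fls_compose_power (h j) q) j)"
      using q by (intro poly_eqI) (simp add: coeff_map_poly P_def coeff_sum fps_embed_0 emb)
    then have "puiseux_eval q (1 / f) P = (\<Sum>j<q. fls_X_intpow (int (q * N)) * fls_compose_power (h j) q * (1 / f) ^ j)"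
      unfolding puiseux_eval_def by (simp only: poly_sum poly_monom)
    also have "\<dots> = fls_X_intpow (int (q * N)) * fls_X_intpow (int m)"
      unfolding h sum_distrib_left mult.assoc ..
    also have "\<dots> = fls_X_intpow (int (q * N + m))"
      unfolding fls_X_intpow_times_fls_X_intpow by simp
    finally show ?thesis by blast
  qed
  then show ?thesis unfolding eventually_sequentially by blast
qed

text \<open>One N serves all residues m < q. A series of order at least q N is a combination of the
  t^(q N + m) with coefficients in K[[x]], so it is a value.\<close>

lemma puiseux_eval_conductor:
  "\<exists>c::nat. \<forall>b. fls_vanishes_below (int c) b \<longrightarrow> (\<exists>P. puiseux_eval q (1 / f) P = b)"
proof -
  have "eventually (\<lambda>N. \<forall>m\<in>{..<q}. \<exists>P. puiseux_eval q (1 / f) P = fls_X_intpow (int (q * N + m))) sequentially"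
    by (rule eventually_ball_finite) (use X_intpow_eventually_in_image in auto)
  then obtain N where "\<forall>m\<in>{..<q}. \<exists>P. puiseux_eval q (1 / f) P = fls_X_intpow (int (q * N + m))"
    unfolding eventually_sequentially by blast
  from bchoice[OF this] obtain T where T: "\<And>m. m < q \<Longrightarrow> puiseux_eval q (1 / f) (T m) = fls_X_intpow (int (q * N + m))"
    by auto
  have "\<exists>P. puiseux_eval q (1 / f) P = b" if b: "fls_vanishes_below (int (q * N)) b" for b
  proof -
    define b' where "b' = fls_shift (int (q * N)) b"
    have b': "b = fls_X_intpow (int (q * N)) * b'"
      by (simp add: b'_def fls_shifted_times_simps)
    have b'0: "fls_vanishes_below 0 b'" using b by (simp add: b'_def fls_vanishes_below_def)
    define e where "e = (\<lambda>m. fls_section q (fls_shift (int m) b'))"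
    have "0 \<le> fls_subdegree (e m)" if "m < q" for m
      using fls_section_shift_vanishes_below[OF that b'0] by (auto simp: e_def fls_vanishes_below_iff)
    then have emb: "fps_embed q (fls_regpart (e m)) = fls_compose_power (e m) q" if "m < q" for m
      using that by (simp add: fps_embed_def)
    define P where "P = (\<Sum>m<q. [:fls_regpart (e m):] * T m)"
    have "puiseux_eval q (1 / f) P = (\<Sum>m<q. fls_compose_power (e m) q * fls_X_intpow (int (q * N + m)))"
      using q by (simp add: P_def puiseux_eval_sum puiseux_eval_mult puiseux_eval_const emb T del: mult_pCons_left)
    also have "\<dots> = fls_X_intpow (int (q * N)) * (\<Sum>m<q. fls_X_intpow (int m) * fls_compose_power (e m) q)"
    proof -
      have "fls_X_intpow (int (q * N + m)) = fls_X_intpow (int (q * N)) * (fls_X_intpow (int m) :: 'k fls)" for m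
        unfolding fls_X_intpow_times_fls_X_intpow by simp
      then show ?thesis unfolding sum_distrib_left by (simp only: mult.commute mult.left_commute)
    qed
    also have "\<dots> = b" unfolding b' e_def using fls_split_sections[OF q, of b'] by (simp only:)
    finally show ?thesis by blast
  qed
  then show ?thesis by blast
qed

theorem intersection_number_curve:
  assumes G: "puiseux_eval q (1 / f) G \<noteq> 0"
  shows "intersection_number (curve z f q) (fps_of_poly G) = enat (nat (fls_subdegree (puiseux_eval q (1 / f) G)))"
proof -
  have f': "fls_subdegree f \<le> 0" using f by simp
  note C = curve_poly_monic[OF q z f_nonzero f'] fps_embed_coeff_curve_poly[OF q z f_nonzero f']
    curve_eq_curve_poly[OF q z f_nonzero f'] puiseux_eval_curve_poly[OF q z f_nonzero f']
  \<comment> \<open>A pole of f gives 1/f positive order, so the lower coefficients of the curve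
    vanish at x = 0.\<close>
  have "coeff (curve_poly z f q) j $ 0 = 0" if "j < q" for j
  proof -
    have "fps_embed q (coeff (curve_poly z f q) j) $$ 0 = 0"
      unfolding C using curve_product_coeff_vanishes(2)[OF q z f_nonzero f' that] f
      by (simp add: fls_vanishes_below_def)
    then show ?thesis using q by (simp add: fps_embed_def fls_nth_compose_power)
  qed
  moreover have "fls_vanishes_below 0 (1 / f)"
    using f f_nonzero by (simp add: fls_vanishes_below_iff fls_divide_subdegree)
  ultimately interpret curve_eval "curve_poly z f q" q "puiseux_eval q (1 / f)"
    using q C puiseux_eval_kernel puiseux_eval_conductor
    by unfold_locales (auto simp: puiseux_eval_add puiseux_eval_mult puiseux_eval_const fps_embed_const puiseux_eval_integral)
  show ?thesis
    unfolding C by (rule intersection_ring.intersection_number_eqI[OF has_intersection_number_ev[OF G]])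
qed

end

section \<open>Intersection numbers and irregularity\<close>

text \<open>A series of positive order represents the zero class, so f has order at most 0. In order
  0 there is no polar exponent, and primitivity with r = 1 then excludes q > 1.\<close>

lemma R_class_nonzero_pole:
  fixes f :: "'k::field_char_0 fls"
  assumes q: "0 < q" and f: "R_class q f \<in> R_o q - {R_class q 0}"
  shows "f \<noteq> 0" "fls_subdegree f \<le> 0" "fls_subdegree f = 0 \<Longrightarrow> q = 1"
    and "\<And>r. 0 < r \<Longrightarrow> r < q \<Longrightarrow> \<exists>n<0. f $$ n \<noteq> 0 \<and> \<not> int q dvd n * int r"
proof -
  show prim: "\<exists>n<0. f $$ n \<noteq> 0 \<and> \<not> int q dvd n * int r" if "0 < r" "r < q" for r
    using f that R_o_iff[OF q, of f] by blast
  have "\<not> fls_vanishes_below 1 f"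
  proof
    assume *: "fls_vanishes_below 1 f"
    define u where "u = fps_shift 1 (fls_regpart f)"
    have fu: "f = fls_X * fps_to_fls u"
      using * by (intro fls_eqI) (auto simp: u_def fls_X_times_conv_shift fls_vanishes_below_def)
    have "g \<in> R_class q f \<longleftrightarrow> g \<in> R_class q 0" for g
    proof -
      have "(\<exists>v n. f - g = fls_X * fps_to_fls v + fls_const (of_int n / of_nat q))
          \<longleftrightarrow> (\<exists>v n. 0 - g = fls_X * fps_to_fls v + fls_const (of_int n / of_nat q))"
        (is "?A \<longleftrightarrow> ?B")
      proof
        assume ?A
        then obtain v n where "f - g = fls_X * fps_to_fls v + fls_const (of_int n / of_nat q)" by blast
        then have "0 - g = fls_X * fps_to_fls (v - u) + fls_const (of_int n / of_nat q)"
          by (simp add: fu algebra_simps)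
        then show ?B by blast
      next
        assume ?B
        then obtain v n where v: "0 - g = fls_X * fps_to_fls v + fls_const (of_int n / of_nat q)" by blast
        have "f - g = fls_X * fps_to_fls u + (0 - g)" by (simp add: fu)
        then have "f - g = fls_X * fps_to_fls (v + u) + fls_const (of_int n / of_nat q)"
          unfolding v by (simp add: algebra_simps)
        then show ?A by blast
      qed
      then show ?thesis by (simp add: R_class_def R_rel_def)
    qed
    then show False using f by blast
  qed
  then show "f \<noteq> 0" "fls_subdegree f \<le> 0" by (auto simp: fls_vanishes_below_iff)
  show "q = 1" if "fls_subdegree f = 0"
  proof (rule ccontr)
    assume "q \<noteq> 1"
    then obtain n where "n < 0" "f $$ n \<noteq> 0" using prim[of 1] q by auto
    then show False using that by simp
  qed
qed

lemma puiseux_ord_eq_iff: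
  "0 < q \<Longrightarrow> puiseux_ord q f = - of_int p / of_nat q \<longleftrightarrow> p = - fls_subdegree f"
  by (auto simp: puiseux_ord_def field_simps simp flip: of_int_minus)

text \<open>
  Terms of positive order in \<open>f\<close> and conjugation do not matter: the isomorphism is multiplication by \<open>exp(\<integral> (f - g) dx/x)\<close> followed by \<open>t \<mapsto> c\<^sup>-\<^sup>1 t\<close>.
\<close>

lemma E_conn_isomorphic:
  fixes f g :: "'k::field_char_0 fls"
  assumes q: "0 < q" and c: "c ^ q = 1" and fg: "fls_vanishes_below 1 (f - fls_rescale c g)"
  shows "conn_isomorphic (E_conn f q) (E_conn g q)"
proof -
  have c0: "c \<noteq> 0" using c q by (auto simp: zero_power)
  obtain e where e: "e \<noteq> 0" "fls_const (1 / of_nat q) * fls_theta e = (f - fls_rescale c g) * e"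
    using exists_exponential[OF q fg] by blast
  define \<phi> where "\<phi> = (\<lambda>v. fls_rescale (inverse c) (e * v))"
  have ci: "inverse c \<noteq> 0" "inverse c ^ q = 1" using c c0 by (simp_all add: power_inverse)
  have scale: "\<phi> (fls_compose_power h q * v) = fls_compose_power h q * \<phi> v" for h v
    using ci q by (simp add: \<phi>_def fls_rescale_mult fls_rescale_compose_power)
  have log: "log_nabla g q (\<phi> v) = \<phi> (log_nabla f q v)" for v
  proof -
    have g: "g = fls_rescale (inverse c) (fls_rescale c g)"
      using c0 by (simp add: fls_rescale_rescale)
    have k: "fls_const (1 / of_nat q) * fls_rescale (inverse c) w = fls_rescale (inverse c) (fls_const (1 / of_nat q) * w)" for w
      using ci by (simp add: fls_rescale_mult)
    have "log_nabla g q (\<phi> v)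
        = fls_rescale (inverse c) (fls_const (1 / of_nat q) * fls_theta (e * v) + fls_rescale c g * (e * v))"
      unfolding log_nabla_def \<phi>_def fls_rescale_theta[OF ci(1), symmetric] k
      by (subst g) (simp only: fls_rescale_add[OF ci(1)] fls_rescale_mult[OF ci(1)])
    also have "fls_const (1 / of_nat q) * fls_theta (e * v) + fls_rescale c g * (e * v)
        = (fls_const (1 / of_nat q) * fls_theta e) * v + e * (fls_const (1 / of_nat q) * fls_theta v) + fls_rescale c g * (e * v)"
      by (simp add: fls_theta_mult algebra_simps)
    also have "\<dots> = e * log_nabla f q v"
      unfolding e(2) log_nabla_def by (simp add: algebra_simps)
    finally show ?thesis by (simp only: \<phi>_def)
  qed
  have "conn_morphism (E_conn f q) (E_conn g q) \<phi>"
  proof (rule conn_morphismI_E)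
    show "\<phi> (conn_nabla (E_conn f q) v) = conn_nabla (E_conn g q) (\<phi> v)" for v
      unfolding E_conn_nabla[OF q] scale log ..
  qed (use scale ci in \<open>auto simp: \<phi>_def distrib_left fls_rescale_add\<close>)
  moreover have "bij_betw \<phi> UNIV UNIV"
  proof (rule bij_betw_byWitness[where f' = "\<lambda>v. fls_rescale c v / e"])
    show "\<forall>a\<in>UNIV. fls_rescale c (\<phi> a) / e = a" "\<forall>a\<in>UNIV. \<phi> (fls_rescale c a / e) = a"
      using e(1) c0 by (simp_all add: \<phi>_def fls_rescale_rescale)
  qed auto
  ultimately show ?thesis unfolding conn_isomorphic_def by auto
qed

text \<open>In u = x^(1/N) the exponents of f are multiples of M and those of g are multiples of M'.
  Equal polar parts have exponents divisible by both, which by primitivity forces M = M' = 1;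
  \<open>E_conn_isomorphic\<close> then applies.\<close>

lemma isomorphic_if_conjugate:
  fixes f g :: "'k::field_char_0 fls"
  assumes d: "0 < d" "0 < M" "0 < M'" and coprime: "coprime M M'" and q: "q = M' * d" and q': "q' = M * d"
    and prim: "\<And>r. 0 < r \<Longrightarrow> r < q \<Longrightarrow> \<exists>n<0. f $$ n \<noteq> 0 \<and> \<not> int q dvd n * int r"
      "\<And>r. 0 < r \<Longrightarrow> r < q' \<Longrightarrow> \<exists>n<0. g $$ n \<noteq> 0 \<and> \<not> int q' dvd n * int r"
    and c: "c ^ q' = 1"
    and van: "fls_vanishes_below 1 (fls_compose_power (fls_rescale c g) M' - fls_compose_power f M)"
  shows "conn_isomorphic (E_conn f q) (E_conn g q')"
proof -
  have q'_pos: "0 < q'" using d by (simp add: q')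
  have c0: "c \<noteq> 0" using c q'_pos by (auto simp: zero_power)
  have eq: "fls_compose_power (fls_rescale c g) M' $$ n = fls_compose_power f M $$ n" if "n < 0" for n
    using van that by (simp add: fls_vanishes_below_def)
  have M': "M' = 1"
  proof (rule ccontr)
    assume "M' \<noteq> 1"
    \<comment> \<open>Primitivity is used for r = d: it gives a polar exponent of f that M' does not
      divide.\<close>
    then obtain n where n: "n < 0" "f $$ n \<noteq> 0" "\<not> int q dvd n * int d" using prim(1)[of d] d by (auto simp: q)
    have "n * int M < 0" using n(1) d by (simp add: mult_less_0_iff)
    from eq[OF this] n(2) d have "int M' dvd n * int M" by (auto simp: fls_nth_compose_power split: if_splits)
    then have "int M' dvd n" using coprime by (simp add: coprime_dvd_mult_left_iff coprime_commute)
    then show False using n(3) by (simp add: q)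
  qed
  have M: "M = 1"
  proof (rule ccontr)
    assume "M \<noteq> 1"
    then obtain n where n: "n < 0" "g $$ n \<noteq> 0" "\<not> int q' dvd n * int d" using prim(2)[of d] d by (auto simp: q')
    have "n * int M' < 0" using n(1) d by (simp add: mult_less_0_iff)
    from eq[OF this] n(2) d c0 have "int M dvd n * int M'"
      by (auto simp: fls_nth_compose_power fls_rescale_nth split: if_splits)
    then have "int M dvd n" using coprime by (simp add: coprime_dvd_mult_left_iff)
    then show False using n(3) by (simp add: q')
  qed
  have "fls_vanishes_below 1 (f - fls_rescale c g)"
    using van by (simp add: M M' fls_vanishes_below_def)
  then show ?thesis using E_conn_isomorphic[of q c f g] c d by (simp add: q q' M M')
qed

text \<open>The curve uses z^i from i = 1 on, while \<open>twisted_embed\<close> conjugates by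
  z^(-j) from j = 0 on; over full periods neither sign nor starting point matters.\<close>

lemma periodic_sum:
  fixes F :: "int \<Rightarrow> int"
  assumes "\<And>i. F (i + int d) = F i"
  shows "(\<Sum>i=1..M * d. F (int i)) = int M * (\<Sum>j<d. F (- int j))"
proof (induction M)
  case (Suc M)
  have per: "F (i + int m * int d) = F i" for i m
  proof (induction m)
    case (Suc m)
    have "F (i + int (Suc m) * int d) = F ((i + int m * int d) + int d)" by (simp add: algebra_simps)
    then show ?case using Suc assms by simp
  qed simp
  have "{1..Suc M * d} = {1..M * d} \<union> {M * d + 1..Suc M * d}" by auto
  then have "(\<Sum>i=1..Suc M * d. F (int i)) = (\<Sum>i=1..M * d. F (int i)) + (\<Sum>i=M * d + 1..Suc M * d. F (int i))"
    by (simp add: sum.union_disjoint)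
  also have "(\<Sum>i=M * d + 1..Suc M * d. F (int i)) = (\<Sum>j<d. F (- int j))"
  proof (rule sum.reindex_bij_witness[of _ "\<lambda>j. Suc M * d - j" "\<lambda>i. Suc M * d - i"])
    show "F (- int (Suc M * d - i)) = F (int i)" if "i \<in> {M * d + 1..Suc M * d}" for i
    proof -
      have "int i = - int (Suc M * d - i) + int (Suc M) * int d"
        using that by (simp add: of_nat_diff algebra_simps)
      then show ?thesis using per[of "- int (Suc M * d - i)" "Suc M"] by simp
    qed
  qed auto
  finally show ?case using Suc by (simp add: distrib_right)
qed simp

lemma fls_subdegree_prod:
  fixes F :: "'i \<Rightarrow> 'k::field fls"
  assumes "finite A" "\<And>i. i \<in> A \<Longrightarrow> F i \<noteq> 0"
  shows "fls_subdegree (\<Prod>i\<in>A. F i) = (\<Sum>i\<in>A. fls_subdegree (F i))"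
  using assms by (induction A rule: finite_induct) auto

lemma fls_subdegree_inverse_diff:
  fixes F G :: "'k::field fls"
  assumes "F \<noteq> 0" "G \<noteq> 0" "F \<noteq> G"
  shows "fls_subdegree (1 / F - 1 / G) = fls_subdegree (G - F) - fls_subdegree F - fls_subdegree G"
proof -
  have "1 / F - 1 / G = (G - F) / (F * G)" using assms by (simp add: field_simps)
  then show ?thesis using assms by (simp add: fls_divide_subdegree)
qed

text \<open>f and the conjugates of g live in different fields; substituting x^(1/q) = u^M and
  x^(1/q') = u^M' puts the product of their differences into K((u)).\<close>

lemma compose_power_puiseux_eval_curve_poly:
  fixes f g :: "'k::field_char_0 fls"
  assumes q: "0 < q" "0 < q'" "0 < M" "0 < M'" "M * q = M' * q'"
    and g: "primitive_root_of_unity q' z" "g \<noteq> 0" "fls_subdegree g \<le> 0"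
  shows "fls_compose_power (puiseux_eval q (1 / f) (curve_poly z g q')) M
    = (\<Prod>i=1..q'. 1 / fls_compose_power f M - 1 / fls_compose_power (fls_rescale (z ^ i) g) M')"
proof -
  have hom: "fls_compose_power (poly P x) n = poly (map_poly (\<lambda>h. fls_compose_power h n) P) (fls_compose_power x n)"
    if "0 < n" for P n and x :: "'k fls"
    by (rule map_poly_hom_poly) (use that in auto)
  have emb: "fls_compose_power (fps_embed q a) M = fls_compose_power (fps_embed q' a) M'" for a :: "'k fps"
    using q by (simp add: fps_embed_def fls_compose_power_compose_power mult.commute)
  have "map_poly (\<lambda>h. fls_compose_power h M) (map_poly (fps_embed q) (curve_poly z g q'))
      = map_poly (\<lambda>h. fls_compose_power h M') (map_poly (fps_embed q') (curve_poly z g q'))"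
    using q by (intro poly_eqI) (simp add: coeff_map_poly fps_embed_0 emb)
  also have "\<dots> = map_poly (\<lambda>h. fls_compose_power h M') (curve_product z g q')"
    by (simp only: map_poly_curve_poly[OF q(2) g])
  also have "\<dots> = (\<Prod>i=1..q'. map_poly (\<lambda>h. fls_compose_power h M') [:- (1 / fls_rescale (z ^ i) g), 1:])"
    unfolding curve_product_rescale by (rule map_poly_hom_prod) (use q in auto)
  also have "\<dots> = (\<Prod>i=1..q'. [:- (1 / fls_compose_power (fls_rescale (z ^ i) g) M'), 1:])"
    using q by (intro prod.cong refl) (simp add: map_poly_pCons divide_inverse fls_compose_power_inverse)
  finally have "fls_compose_power (puiseux_eval q (1 / f) (curve_poly z g q')) M
      = poly (\<Prod>i=1..q'. [:- (1 / fls_compose_power (fls_rescale (z ^ i) g) M'), 1:]) (fls_compose_power (1 / f) M)"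
    unfolding puiseux_eval_def hom[OF q(3)] by (simp only:)
  also have "fls_compose_power (1 / f) M = 1 / fls_compose_power f M"
    by (simp add: divide_inverse fls_compose_power_inverse q)
  finally show ?thesis by (simp add: poly_prod)
qed

text \<open>The factor with i = q is y - 1/f, and the derivative of (y - a) H takes the value H(a)
  at y = a.\<close>

lemma puiseux_eval_pderiv_curve_poly:
  fixes f :: "'k::field_char_0 fls"
  assumes f: "0 < q" "primitive_root_of_unity q z" "f \<noteq> 0" "fls_subdegree f \<le> 0"
  shows "puiseux_eval q (1 / f) (pderiv (curve_poly z f q)) = (\<Prod>i=1..<q. 1 / f - 1 / fls_rescale (z ^ i) f)"
proof -
  let ?H = "\<Prod>i=1..<q. [:- (1 / fls_rescale (z ^ i) f), 1:]"
  have zq: "z ^ q = 1" using f(2) by (simp add: primitive_root_of_unity_def)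
  have "{1..q} = insert q {1..<q}" using f(1) by auto
  then have "curve_product z f q = [:- (1 / f), 1:] * ?H"
    by (simp add: curve_product_rescale zq del: mult_pCons_left)
  then have "poly (pderiv (curve_product z f q)) (1 / f) = poly ?H (1 / f)"
    by (simp add: pderiv_mult pderiv_pCons del: mult_pCons_left)
  then show ?thesis
    using f(1) by (simp add: puiseux_eval_def fps_embed_map_poly map_poly_curve_poly[OF f] poly_prod)
qed

lemma fps_fps_unit:
  fixes F :: "'k::field fps fps"
  assumes "F $ 0 $ 0 \<noteq> 0" shows "F dvd 1"
proof -
  have "F $ 0 * inverse (F $ 0) = 1" using assms by (rule inverse_mult_eq_1')
  then have "F * fps_right_inverse F (inverse (F $ 0)) = 1" by (rule fps_right_inverse)
  then show ?thesis by (metis dvd_triv_left)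
qed

lemma intersection_number_curve_no_pole:
  fixes f :: "'k::field_char_0 fls"
  assumes z: "primitive_root_of_unity 1 z" and f: "f \<noteq> 0" "fls_subdegree f = 0"
  shows "intersection_number (curve z f 1) G = enat 0"
proof (rule intersection_number_unit[OF fps_fps_unit])
  have f': "fls_subdegree f \<le> 0" using f by simp
  have "z = 1" using z by (simp add: primitive_root_of_unity_def)
  then have "coeff (curve_product z f 1) 0 = - (1 / f)" by (simp add: curve_product_rescale)
  then have "fps_embed 1 (coeff (curve_poly z f 1) 0) = - (1 / f)"
    using fps_embed_coeff_curve_poly[OF _ z f(1) f'] by simp
  then have "coeff (curve_poly z f 1) 0 $ 0 = - ((1 / f) $$ 0)"
    by (metis One_nat_def fls_compose_power_1_right fls_uminus_nth fps_embed_def fps_to_fls_nth nat_0 order_refl not_less)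
  moreover have "(1 / f) $$ 0 \<noteq> 0"
  proof -
    have "1 / f \<noteq> 0" "fls_subdegree (1 / f) = 0" using f by (simp_all add: fls_divide_subdegree)
    then show ?thesis by (metis nth_fls_subdegree_nonzero)
  qed
  ultimately show "curve z f 1 $ 0 $ 0 \<noteq> 0"
    using curve_eq_curve_poly[OF _ z f(1) f'] by simp
qed

lemma intersection_number_two_curves:
  fixes f g :: "'k::field_char_0 fls"
  assumes q: "0 < q" "0 < q'"
    and f: "R_class q f \<in> R_o q - {R_class q 0}" and g: "R_class q' g \<in> R_o q' - {R_class q' 0}"
    and z: "primitive_root_of_unity q z" and z': "primitive_root_of_unity q' z'"
    and noniso: "\<not> conn_isomorphic (E_conn f q) (E_conn g q')"
  shows "\<exists>n. intersection_number (curve z f q) (curve z' g q') = enat n \<and>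
    rat_of_nat n = of_int (- fls_subdegree f * int q' - fls_subdegree g * int q)
      - irregularity (Hom_conn (E_conn f q) (E_conn g q'))"
proof -
  define d where "d = gcd q q'"
  define M where "M = q' div d"
  define M' where "M' = q div d"
  have d: "0 < d" "0 < M" "0 < M'" "coprime M M'" "q = M' * d" "q' = M * d"
    using q div_gcd_coprime[of q' q] by (auto simp: d_def M_def M'_def gcd.commute div_greater_zero_iff dest: dvd_imp_le)
  note fp = R_class_nonzero_pole[OF q(1) f] and gp = R_class_nonzero_pole[OF q(2) g]
  have z'0: "z' \<noteq> 0" by (rule primitive_root_nonzero[OF z' q(2)])
  let ?F = "fls_compose_power f M"
  define G where "G = (\<lambda>i::int. fls_compose_power (fls_rescale (z' powi i) g) M')"
  define ord where "ord = (\<lambda>i. fls_subdegree (G i - ?F))"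
  have emb: "twisted_embed z' M' j g = G (- int j)" for j
    by (simp add: twisted_embed_def G_def power_int_minus power_inverse)
  have irr: "irregularity (Hom_conn (E_conn f q) (E_conn g q')) = of_int (\<Sum>j<d. pole_order (G (- int j) - ?F))"
    using irregularity_Hom_coprime_index[OF d z', of f g] by (simp only: emb)
  have zi: "(z' powi i) ^ q' = 1" "z' powi i \<noteq> 0" for i
  proof -
    have "(z' powi i) ^ q' = z' powi (int q' * i)"
      by (simp add: mult.commute flip: power_int_of_nat power_int_mult)
    then show "(z' powi i) ^ q' = 1" by (simp add: primitive_root_powi_eq_1_iff[OF z' q(2)])
    show "z' powi i \<noteq> 0" using z'0 by simp
  qed
  \<comment> \<open>A difference of positive order would make the connections isomorphic.\<close>
  have nv: "\<not> fls_vanishes_below 1 (G i - ?F)" for i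
    using isomorphic_if_conjugate[OF d fp(4) gp(4) zi(1)] noniso unfolding G_def by blast
  have GF: "G i - ?F \<noteq> 0" "ord i \<le> 0" for i
    using nv[of i] by (auto simp: fls_vanishes_below_iff ord_def)
  then have pole: "pole_order (G i - ?F) = - ord i" for i by (simp add: pole_order_def ord_def)
  show ?thesis
  proof (cases "fls_subdegree f = 0")
    case True
    then have q1: "q = 1" by (rule fp(3))
    have "d = 1" by (simp add: d_def q1)
    then have d1: "d = 1" "M' = 1" "M = q'" by (simp_all add: M'_def M_def q1)
    \<comment> \<open>With q = 1 and no pole in f, Hom has irregularity p'; this cancels p' q = p',
      while p = 0.\<close>
    have "pole_order (G 0 - ?F) = - fls_subdegree g"
    proof (cases "fls_subdegree g < 0")
      case True
      have "fls_subdegree ?F = 0" using \<open>fls_subdegree f = 0\<close> d by (simp add: fls_subdegree_compose_power)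
      then have "fls_subdegree (g - ?F) = fls_subdegree g"
        using True gp(1) by (intro fls_subdegree_diff_eq1) auto
      then show ?thesis using True by (simp add: G_def d1 pole_order_def)
    next
      case False
      then have "fls_subdegree g = 0" using gp(2) by simp
      moreover have "0 \<le> fls_subdegree (g - ?F)"
        using \<open>fls_subdegree g = 0\<close> True d by (intro fls_subdegree_ge0I) (simp add: fls_subdegree_compose_power)
      ultimately show ?thesis by (simp add: G_def d1 pole_order_def)
    qed
    moreover have "intersection_number (curve z f q) (curve z' g q') = enat 0"
      using intersection_number_curve_no_pole[of z f] z fp(1) True by (simp add: q1)
    ultimately show ?thesis using irr by (simp add: d1 True q1)
  next
    case False
    then have fneg: "fls_subdegree f < 0" using fp(2) by simp
    let ?P = "puiseux_eval q (1 / f) (curve_poly z' g q')"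
    have F0: "?F \<noteq> 0" using fp(1) d by (simp add: fls_compose_power_eq_0_iff)
    have G0: "G i \<noteq> 0" for i using gp(1) d zi(2) by (simp add: G_def fls_compose_power_eq_0_iff fls_rescale_eq_0_iff)
    have P: "fls_compose_power ?P M = (\<Prod>i=1..q'. 1 / ?F - 1 / G (int i))"
      using compose_power_puiseux_eval_curve_poly[of q q' M M' z' g f] q d z' gp by (simp add: G_def)
    have factor: "1 / ?F - 1 / G i \<noteq> 0" for i
      using GF(1)[of i] F0 G0[of i] by (simp add: divide_inverse)
    have "fls_compose_power ?P M \<noteq> 0" unfolding P using factor by simp
    then have P0: "?P \<noteq> 0" by auto
    have "int M * fls_subdegree ?P = fls_subdegree (fls_compose_power ?P M)"
      using d by (simp add: fls_subdegree_compose_power)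
    also have "\<dots> = (\<Sum>i=1..q'. fls_subdegree (1 / ?F - 1 / G (int i)))"
      unfolding P using factor by (intro fls_subdegree_prod) auto
    also have "\<dots> = (\<Sum>i=1..q'. ord (int i) - int M * fls_subdegree f - int M' * fls_subdegree g)"
    proof (intro sum.cong refl)
      fix i
      have "?F \<noteq> G (int i)" using GF(1)[of "int i"] by auto
      then show "fls_subdegree (1 / ?F - 1 / G (int i)) = ord (int i) - int M * fls_subdegree f - int M' * fls_subdegree g"
        unfolding fls_subdegree_inverse_diff[OF F0 G0 \<open>?F \<noteq> G (int i)\<close>] ord_def
        using d zi(2)[of "int i"] by (simp add: fls_subdegree_compose_power G_def fls_rescale_subdegree)
    qed
    also have "\<dots> = (\<Sum>i=1..M * d. ord (int i)) - int q' * (int M * fls_subdegree f + int M' * fls_subdegree g)"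
      by (simp add: sum_subtractf algebra_simps d(6))
    also have "(\<Sum>i=1..M * d. ord (int i)) = int M * (\<Sum>j<d. ord (- int j))"
    proof (rule periodic_sum)
      fix i
      \<comment> \<open>Sought is w with w^M = 1 and w^M' = z'^d, so that rescaling by w fixes ?F
        and sends G i to G (i + d). The Bezout coefficient u makes w = z'^(d u) such an element,
        since z'^q' = 1.\<close>
      obtain u v where uv: "u * int M' + v * int M = 1"
        using bezout_int[of "int M'" "int M"] d(4) by (auto simp: gcd.commute coprime_commute)
      define w where "w = z' powi (int d * u)"
      have w0: "w \<noteq> 0" using z'0 by (simp add: w_def)
      have "w ^ M = z' powi (int q' * u)"
        by (simp add: w_def d(6) mult.commute mult.left_commute flip: power_int_of_nat power_int_mult)
      then have wM: "w ^ M = 1" by (simp add: primitive_root_powi_eq_1_iff[OF z' q(2)])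
      have "w ^ M' = z' powi (int d * (u * int M'))"
        by (simp add: w_def mult.assoc flip: power_int_of_nat power_int_mult)
      also have "int d * (u * int M') = int d + int q' * (- v)"
      proof -
        have eq: "u * int M' = 1 - v * int M" using uv by simp
        show ?thesis unfolding eq d(6) by (simp add: algebra_simps)
      qed
      also have "z' powi (int d + int q' * (- v)) = z' powi int d * z' powi (int q' * (- v))"
        using z'0 by (intro power_int_add) simp
      also have "z' powi (int q' * (- v)) = 1" unfolding primitive_root_powi_eq_1_iff[OF z' q(2)] by simp
      finally have wM': "w ^ M' = z' powi int d" by simp
      have "fls_rescale w (G i) = G (i + int d)"
        using w0 d zi(2) z'0 wM'
        by (simp add: G_def fls_rescale_compose_power fls_rescale_rescale power_int_add mult.commute)
      moreover have "fls_rescale w ?F = ?F"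
        using w0 d wM by (simp add: fls_rescale_compose_power)
      ultimately have "fls_rescale w (G i - ?F) = G (i + int d) - ?F"
        using w0 by (simp add: fls_rescale_diff)
      then show "ord (i + int d) = ord i"
        using w0 fls_rescale_subdegree[of w "G i - ?F"] by (simp add: ord_def)
    qed
    also have "int q' * (int M * fls_subdegree f + int M' * fls_subdegree g)
        = int M * (fls_subdegree f * int q' + fls_subdegree g * int q)"
      by (simp add: d(5,6) algebra_simps)
    finally have "int M * fls_subdegree ?P
        = int M * ((\<Sum>j<d. ord (- int j)) - (fls_subdegree f * int q' + fls_subdegree g * int q))"
      by (simp only: right_diff_distrib)
    then have n: "fls_subdegree ?P = (\<Sum>j<d. ord (- int j)) - (fls_subdegree f * int q' + fls_subdegree g * int q)"
      using d by simp
    have "fls_vanishes_below 0 (1 / f)" using fneg fp(1) by (simp add: fls_vanishes_below_iff fls_divide_subdegree)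
    then have "0 \<le> fls_subdegree ?P"
      using puiseux_eval_integral[OF q(1), of "1 / f"] P0 unfolding fls_vanishes_below_iff by blast
    then have "rat_of_nat (nat (fls_subdegree ?P)) = of_int (fls_subdegree ?P)" by simp
    moreover have "intersection_number (curve z f q) (curve z' g q') = enat (nat (fls_subdegree ?P))"
      unfolding curve_eq_curve_poly[OF q(2) z' gp(1,2)]
      by (rule intersection_number_curve[OF q(1) z fneg fp(4) P0])
    ultimately show ?thesis
      unfolding irr pole by (intro exI[of _ "nat (fls_subdegree ?P)"]) (simp add: n sum_negf)
  qed
qed

lemma intersection_number_derivative:
  fixes f :: "'k::field_char_0 fls"
  assumes q: "0 < q" and f: "R_class q f \<in> R_o q - {R_class q 0}"
    and z: "primitive_root_of_unity q z"
  shows "\<exists>n. intersection_number (curve z f q) (fps_deriv (curve z f q)) = enat n \<and>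
    rat_of_nat n = of_int (- 2 * fls_subdegree f * (int q - 1)) - irregularity (End_conn (E_conn f q))"
proof -
  note fp = R_class_nonzero_pole[OF q f]
  have z0: "z \<noteq> 0" by (rule primitive_root_nonzero[OF z q])
  have zq: "z ^ q = 1" using z by (simp add: primitive_root_of_unity_def)
  define ord where "ord = (\<lambda>i. fls_subdegree (fls_rescale (z ^ i) f - f))"
  have emb: "twisted_embed z 1 j f - fls_compose_power f 1 = fls_rescale (z ^ (q - j)) f - f" if "j < q" for j
  proof -
    have "z ^ (q - j) * z ^ j = 1" using that zq by (simp flip: power_add)
    then have "z ^ (q - j) = inverse z ^ j" using z0 by (simp add: power_inverse field_simps)
    then show ?thesis by (simp add: twisted_embed_def)
  qed
  have irr: "irregularity (End_conn (E_conn f q)) = of_int (\<Sum>j<q. pole_order (fls_rescale (z ^ (q - j)) f - f))"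
    using irregularity_Hom_coprime_index[of q 1 1 q q z f f] q z emb by (simp add: End_conn_def)
  \<comment> \<open>The term j = 0 is the trivial conjugate; it contributes 0 and has no counterpart
    in the derivative of the product.\<close>
  have "(\<Sum>j<q. pole_order (fls_rescale (z ^ (q - j)) f - f))
      = pole_order (fls_rescale (z ^ q) f - f) + (\<Sum>j=1..<q. pole_order (fls_rescale (z ^ (q - j)) f - f))"
    using q by (simp add: lessThan_atLeast0 sum.atLeast_Suc_lessThan)
  also have "(\<Sum>j=1..<q. pole_order (fls_rescale (z ^ (q - j)) f - f)) = (\<Sum>i=1..<q. pole_order (fls_rescale (z ^ i) f - f))"
    by (rule sum.reindex_bij_witness[of _ "\<lambda>i. q - i" "\<lambda>i. q - i"]) auto
  finally have irr': "irregularity (End_conn (E_conn f q)) = of_int (\<Sum>i=1..<q. pole_order (fls_rescale (z ^ i) f - f))"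
    using irr by (simp add: zq pole_order_def)
  show ?thesis
  proof (cases "fls_subdegree f = 0")
    case True
    then have "q = 1" by (rule fp(3))
    then show ?thesis
      using irr' intersection_number_curve_no_pole[of z f] z fp(1) True by simp
  next
    case False
    then have fneg: "fls_subdegree f < 0" using fp(2) by simp
    have pole: "\<exists>n<0. (fls_rescale (z ^ i) f - f) $$ n \<noteq> 0" if "i \<in> {1..<q}" for i
      using rescale_diff_has_pole[OF q z fneg fp(4), of 0 i] that by simp
    have ord_neg: "ord i < 0" and diff: "f \<noteq> fls_rescale (z ^ i) f" if i: "i \<in> {1..<q}" for i
    proof -
      obtain n where n: "n < 0" "(fls_rescale (z ^ i) f - f) $$ n \<noteq> 0" using pole[OF i] by blast
      show "ord i < 0" using fls_subdegree_leI[OF n(2)] n(1) by (simp add: ord_def)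
      show "f \<noteq> fls_rescale (z ^ i) f" using n(2) by auto
    qed
    have r0: "fls_rescale (z ^ i) f \<noteq> 0" for i using fp(1) z0 by (simp add: fls_rescale_eq_0_iff)
    let ?P = "puiseux_eval q (1 / f) (pderiv (curve_poly z f q))"
    have P: "?P = (\<Prod>i=1..<q. 1 / f - 1 / fls_rescale (z ^ i) f)"
      by (rule puiseux_eval_pderiv_curve_poly[OF q z fp(1,2)])
    have factor: "1 / f - 1 / fls_rescale (z ^ i) f \<noteq> 0" if "i \<in> {1..<q}" for i
      using diff[OF that] fp(1) r0[of i] by (simp add: divide_inverse)
    have P0: "?P \<noteq> 0" unfolding P using factor by (simp add: prod_zero_iff)
    have "fls_subdegree ?P = (\<Sum>i=1..<q. fls_subdegree (1 / f - 1 / fls_rescale (z ^ i) f))"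
      unfolding P using factor by (intro fls_subdegree_prod) auto
    also have "\<dots> = (\<Sum>i=1..<q. ord i - 2 * fls_subdegree f)"
    proof (intro sum.cong refl)
      fix i assume "i \<in> {1..<q}"
      then show "fls_subdegree (1 / f - 1 / fls_rescale (z ^ i) f) = ord i - 2 * fls_subdegree f"
        using fls_subdegree_inverse_diff[OF fp(1) r0 diff] z0 by (simp add: ord_def fls_rescale_subdegree)
    qed
    also have "\<dots> = (\<Sum>i=1..<q. ord i) - 2 * fls_subdegree f * (int q - 1)"
      using q by (simp add: sum_subtractf of_nat_diff algebra_simps)
    finally have n: "fls_subdegree ?P = (\<Sum>i=1..<q. ord i) - 2 * fls_subdegree f * (int q - 1)" .
    have "fls_vanishes_below 0 (1 / f)" using fneg fp(1) by (simp add: fls_vanishes_below_iff fls_divide_subdegree)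
    then have "0 \<le> fls_subdegree ?P"
      using puiseux_eval_integral[OF q, of "1 / f"] P0 unfolding fls_vanishes_below_iff by blast
    then have "rat_of_nat (nat (fls_subdegree ?P)) = of_int (fls_subdegree ?P)" by simp
    moreover have "intersection_number (curve z f q) (fps_deriv (curve z f q)) = enat (nat (fls_subdegree ?P))"
    proof -
      have "fps_deriv (curve z f q) = fps_of_poly (pderiv (curve_poly z f q))"
        unfolding curve_eq_curve_poly[OF q z fp(1,2)] by (rule fps_of_poly_pderiv[symmetric])
      then show ?thesis using intersection_number_curve[OF q z fneg fp(4) P0] by simp
    qed
    moreover have "(\<Sum>i=1..<q. pole_order (fls_rescale (z ^ i) f - f)) = (\<Sum>i=1..<q. - ord i)"
    proof (intro sum.cong refl)
      fix i assume "i \<in> {1..<q}"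
      from ord_neg[OF this] show "pole_order (fls_rescale (z ^ i) f - f) = - ord i"
        by (simp add: pole_order_def ord_def)
    qed
    ultimately show ?thesis
      unfolding irr' by (intro exI[of _ "nat (fls_subdegree ?P)"]) (simp add: n sum_negf)
  qed
qed

theorem theorem3p5:
  fixes f g :: "'k::{alg_closed_field, field_char_0} fls"
    and q q' :: nat and p p' :: int and \<zeta> \<zeta>' :: 'k
  assumes "0 < q" and "0 < q'"
    and "irreducible_connection (E_conn f q)"
    and "irreducible_connection (E_conn g q')"
    and "R_class q f \<in> R_o q - {R_class q 0}"
    and "R_class q' g \<in> R_o q' - {R_class q' 0}"
    and "puiseux_ord q f = - of_int p / of_nat q"
    and "puiseux_ord q' g = - of_int p' / of_nat q'"
    and "primitive_root_of_unity q \<zeta>"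
    and "primitive_root_of_unity q' \<zeta>'"
  shows "(\<not> conn_isomorphic (E_conn f q) (E_conn g q') \<longrightarrow>
           (\<exists>n. intersection_number (curve \<zeta> f q) (curve \<zeta>' g q') = enat n \<and>
                rat_of_nat n = of_int (p * int q' + p' * int q)
                  - irregularity (Hom_conn (E_conn f q) (E_conn g q')))) \<and>
         (\<exists>n. intersection_number (curve \<zeta> f q) (fps_deriv (curve \<zeta> f q)) = enat n \<and>
              rat_of_nat n = of_int (2 * p * (int q - 1))
                - irregularity (End_conn (E_conn f q)))"
proof -
  have p: "p = - fls_subdegree f" "p' = - fls_subdegree g"
    using puiseux_ord_eq_iff[OF assms(1)] puiseux_ord_eq_iff[OF assms(2)] assms(7,8) by blast+
  show ?thesis
    using intersection_number_two_curves[OF assms(1,2,5,6,9,10)]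
      intersection_number_derivative[OF assms(1,5,9)]
    unfolding p by simp
qed

end
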